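(* Let $G_0\in\mathscr M^1_+([0,\infty))$ with $G_0(\{0\})>0$, $N=M_0(G_0)$, $E=M_1(G_0)$, and suppose that for some $\alpha\in(1,3]$, $E>C(\alpha)N^{5/3}$, where $C(\alpha)=\big(\frac{(2^\alpha-2)(\alpha+1)}{\alpha-1}\big)^{2/3}$ if $\alpha\in(1,2]$ and $C(\alpha)=(\alpha(\alpha+1))^{2/3}$ if $\alpha\in(2,3]$. Then there exists a weak radial solution $G$ on $(0,\infty)$ with $G\in C([0,\infty),\mathscr M^1_+([0,\infty)))$, $G(0)=G_0$, $M_0(G(t))=N$ and $M_1(G(t))=E$ for all $t\ge0$, such that, with $n(t)=G(t,\{0\})$, for all $t_0>0$ $$\int_{t_0}^\infty n(t)\,dt\le M_\alpha(G(t_0))\,C(N,E,\alpha),\qquad C(N,E,\alpha)=\Big[\tfrac{\alpha-1}{\alpha+1}E^{\frac{2\alpha+1}{2}}N^{\frac{1-2\alpha}{2}}-C_1N^{3-\alpha}E^{\alpha-1}\Big]^{-1},$$ where $C_1=2^\alpha-2$ for $\alpha\in(1,2]$ and $C_1=\alpha(\alpha-1)$ for $\alpha\in(2,3]$ (so that $C(N,E,\alpha)>0$), and moreover $\lim_{t\to\infty}n(t)=0$.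
   Context: $\mathscr M_+([0,\infty))$ is the set of nonnegative finite Radon measures on $[0,\infty)$; for such $G$ we write $\int_A\varphi(x)G(x)dx$ for $\int_A\varphi\,dG$, $G(A)$ for the measure of $A$, $\delta_0$ is the Dirac mass at $0$, $M_\alpha(G)=\int_{[0,\infty)}x^\alpha G(x)dx$ for $\alpha\ge0$, and $\mathscr M^\alpha_+=\{G:M_\alpha(G)<\infty\}$. $C^1_b([0,\infty))$ denotes bounded $C^1$ functions with bounded derivative. Continuity of measure-valued maps refers to the narrow topology. For continuous $\varphi$ and $x,y\ge0$: $\Lambda(\varphi)(x,y)=\varphi(x+y)+\varphi(|x-y|)-2\varphi(\max\{x,y\})$, $\mathcal L_0(\varphi)(x)=x(\varphi(0)+\varphi(x))-2\int_0^x\varphi(y)dy$. For $g\in\mathscr M_+([0,\infty))$: $\mathscr Q_3^{(2)}(\varphi,g)=\iint_{(0,\infty)^2}\frac{\Lambda(\varphi)(x,y)}{\sqrt{xy}}g(x)g(y)dxdy$, $\mathscr Q_3^{(1)}(\varphi,g)=\int_{(0,\infty)}\frac{\mathcal L_0(\varphi)(x)}{\sqrt x}g(x)dx$, $\mathscr Q_3=\mathscr Q_3^{(2)}-\mathscr Q_3^{(1)}$. Weak radial solution: let $T\in(0,\infty]$. A map $G:[0,T)\to\mathscr M^1_+([0,\infty))$ is a weak radial solution on $(0,T)$ if, writing $G(t)=n(t)\delta_0+g(t)$ with $n(t)=G(t,\{0\})$ and $g(t)$ the restriction of $G(t)$ to $(0,\infty)$: (a) for every $T'\in(0,T]$, $\sup_{0\le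 t<T'}\int_{[0,\infty)}(1+x)G(t,x)dx<\infty$; (b) for every $\varphi\in C^1_b([0,\infty))$, $t\mapsto\int\varphi(x)G(t,x)dx$ belongs to $W^{1,\infty}_{loc}([0,T))$; (c) for a.e. $t\in(0,T)$, $\frac{d}{dt}\int\varphi(x)G(t,x)dx=n(t)\mathscr Q_3(\varphi,g(t))$ for all $\varphi\in C^1_b([0,\infty))$. *)

theory Defs
  imports "HOL-Probability.Probability"
begin

text \<open>Measures on [0,oo) are represented as Borel measures on the real line that
  vanish on the negative half-line.\<close>

definition Mplus :: "real measure \<Rightarrow> bool" where
  "Mplus G \<longleftrightarrow> sets G = sets borel \<and> emeasure G {..<0} = 0 \<and> emeasure G UNIV < \<infinity>"

text \<open>Moment M_alpha, with the convention x^0 = 1 (also at x = 0); valued in [0,oo].\<close>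
definition Mom :: "real measure \<Rightarrow> real \<Rightarrow> ennreal" where
  "Mom G a = (\<integral>\<^sup>+ x. ennreal (if x = 0 \<and> a = 0 then 1 else x powr a) \<partial>G)"

definition M1plus :: "real measure \<Rightarrow> bool" where
  "M1plus G \<longleftrightarrow> Mplus G \<and> Mom G 1 < \<infinity>"

definition pairing :: "real measure \<Rightarrow> (real \<Rightarrow> real) \<Rightarrow> real" where
  "pairing G \<phi> = (LINT x:{0..}|G. \<phi> x)"

definition C1b :: "(real \<Rightarrow> real) \<Rightarrow> bool" where
  "C1b \<phi> \<longleftrightarrow> (\<exists>\<phi>'. continuous_on {0..} \<phi>' \<and>
      (\<forall>x\<ge>0. (\<phi> has_real_derivative \<phi>' x) (at x within {0..})) \<and>
      bounded (\<phi> ` {0..}) \<and> bounded (\<phi>' ` {0..}))"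

definition Cb :: "(real \<Rightarrow> real) \<Rightarrow> bool" where
  "Cb \<phi> \<longleftrightarrow> continuous_on {0..} \<phi> \<and> bounded (\<phi> ` {0..})"

definition Lam :: "(real \<Rightarrow> real) \<Rightarrow> real \<Rightarrow> real \<Rightarrow> real" where
  "Lam \<phi> x y = \<phi> (x + y) + \<phi> \<bar>x - y\<bar> - 2 * \<phi> (max x y)"

definition L0 :: "(real \<Rightarrow> real) \<Rightarrow> real \<Rightarrow> real" where
  "L0 \<phi> x = x * (\<phi> 0 + \<phi> x) - 2 * integral {0..x} \<phi>"

text \<open>Q_3 applied to the restriction g of G to (0,oo).\<close>
definition Q3_2 :: "(real \<Rightarrow> real) \<Rightarrow> real measure \<Rightarrow> real" where
  "Q3_2 \<phi> G = (LINT p:({0<..} \<times> {0<..})|(G \<Otimes>\<^sub>M G).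
        Lam \<phi> (fst p) (snd p) / sqrt (fst p * snd p))"

definition Q3_1 :: "(real \<Rightarrow> real) \<Rightarrow> real measure \<Rightarrow> real" where
  "Q3_1 \<phi> G = (LINT x:{0<..}|G. L0 \<phi> x / sqrt x)"

definition Q3 :: "(real \<Rightarrow> real) \<Rightarrow> real measure \<Rightarrow> real" where
  "Q3 \<phi> G = Q3_2 \<phi> G - Q3_1 \<phi> G"

definition atom0 :: "real measure \<Rightarrow> real" where
  "atom0 G = measure G {0}"

text \<open>Weak radial solution on (0,T), T in (0,oo]. W^{1,oo}_loc([0,T)) is rendered as
  Lipschitz on every compact interval [0,T'] with T' < T.\<close>
definition weak_radial_solution :: "ereal \<Rightarrow> (real \<Rightarrow> real measure) \<Rightarrow> bool" where
  "weak_radial_solution T G \<longleftrightarrow>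
     (\<forall>t. 0 \<le> t \<and> ereal t < T \<longrightarrow> M1plus (G t)) \<and>
     (\<forall>T'. 0 < T' \<and> T' \<le> T \<longrightarrow>
        (SUP t\<in>{t. 0 \<le> t \<and> ereal t < T'}. \<integral>\<^sup>+ x. ennreal (1 + x) \<partial>(G t)) < \<infinity>) \<and>
     (\<forall>\<phi>. C1b \<phi> \<longrightarrow> (\<forall>T'::real. 0 < T' \<and> ereal T' < T \<longrightarrow>
        (\<exists>L. lipschitz_on L {0..T'} (\<lambda>t. pairing (G t) \<phi>)))) \<and>
     (AE t in lborel. 0 < t \<and> ereal t < T \<longrightarrow>
        (\<forall>\<phi>. C1b \<phi> \<longrightarrow>
          ((\<lambda>s. pairing (G s) \<phi>) has_real_derivative (atom0 (G t) * Q3 \<phi> (G t))) (at t)))"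

definition narrow_continuous_on :: "real set \<Rightarrow> (real \<Rightarrow> real measure) \<Rightarrow> bool" where
  "narrow_continuous_on S G \<longleftrightarrow>
     (\<forall>\<phi>. Cb \<phi> \<longrightarrow> continuous_on S (\<lambda>t. pairing (G t) \<phi>))"

definition Calpha :: "real \<Rightarrow> real" where
  "Calpha \<alpha> = (if \<alpha> \<le> 2 then ((2 powr \<alpha> - 2) * (\<alpha> + 1) / (\<alpha> - 1)) powr (2/3)
               else (\<alpha> * (\<alpha> + 1)) powr (2/3))"

definition C1alpha :: "real \<Rightarrow> real" where
  "C1alpha \<alpha> = (if \<alpha> \<le> 2 then 2 powr \<alpha> - 2 else \<alpha> * (\<alpha> - 1))"

definition CNEa :: "real \<Rightarrow> real \<Rightarrow> real \<Rightarrow> real" where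
  "CNEa N E \<alpha> = 1 / ((\<alpha> - 1) / (\<alpha> + 1) * E powr ((2 * \<alpha> + 1) / 2) * N powr ((1 - 2 * \<alpha>) / 2)
                       - C1alpha \<alpha> * N powr (3 - \<alpha>) * E powr (\<alpha> - 1))"

end

theory Submission
  imports Defs
begin

text \<open>In the time variable \<open>\<tau>\<close> with \<open>d\<tau> = n dt\<close> the factor \<open>n(t)\<close> disappears and the equation
  becomes \<open>d/d\<tau> \<integral> \<phi> dG = Q3 \<phi> g\<close>. It is solved up to any finite \<open>\<tau>\<close>, without regard to the sign of the
  atom, by a weakly compact family of conservative Euler schemes on lattices. Restoring \<open>dt = d\<tau> / n\<close>
  gives a solution as long as the atom stays positive.

  Let \<open>\<phi>\<close> be \<open>x powr \<alpha>\<close>, continued beyond a large \<open>R\<close> by a function of linear growth. Convexity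
  inequalities and the conservation of mass and energy show that \<open>\<integral> \<phi> dG\<close> decreases at least at rate
  \<open>1 / CNEa N E \<alpha>\<close> in the time \<open>\<tau>\<close>. As \<open>\<integral> \<phi> dG \<ge> 0\<close>, the atom must vanish at a finite \<open>\<tau> = S\<close>, and
  \<open>S - \<tau>\<close>, which is the integral of \<open>n\<close> over the remaining time, is at most
  \<open>CNEa N E \<alpha> * \<integral> \<phi> dG\<close>, hence at most \<open>CNEa N E \<alpha> * Mom G \<alpha>\<close>. The atom loses mass at a bounded rate
  only, so \<open>n \<le> C (S - \<tau>)\<close>: the new time runs up to infinity, and \<open>n\<close> tends to zero.\<close>

section \<open>Test functions and kernels\<close>

text \<open>The constants come from two interpolations. For \<open>x powr \<alpha>\<close> the
  quadratic kernel is at most \<open>C1alpha \<alpha> * (x * y) powr ((\<alpha> - 1) / 2)\<close>,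
  while \<open>L0\<close> divided by \<open>sqrt x\<close> is
  \<open>(\<alpha> - 1) / (\<alpha> + 1) * x powr (\<alpha> + 1 / 2)\<close>. With energy
  \<open>E\<close> and mass at most \<open>N\<close> on the open half-line, concavity bounds the
  first contribution by \<open>C1alpha \<alpha> * N powr (3 - \<alpha>) * E powr (\<alpha> -
  1)\<close>, convexity bounds the second from below, and
  \<open>E > Calpha \<alpha> * N powr (5/3)\<close> says that the second wins. The moment of order
  \<alpha> may be infinite, which forces a test function of linear growth that keeps both bounds.
  The atom is not continuous in the narrow topology: it is controlled from one side only, and upward
  jumps are not excluded. Hence the end of the rescaled time is an infimum, and the change of time
  is differentiable only off a countable set. A negative atom is harmless for compactness because
  the kernels vanish at the origin: a fixed Dirac mass there makes all measures nonnegative without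
  altering the equation.\<close>

definition kap :: "(real \<Rightarrow> real) \<Rightarrow> real \<Rightarrow> real \<Rightarrow> real" where
  "kap \<phi> x y = (if 0 < x \<and> 0 < y then Lam \<phi> x y / sqrt (x * y) else 0)"

text \<open>Like \<open>kap\<close>, it is extended by zero, so that integrals over the whole line
  reproduce the integrals over the open half-line in \<open>Q3_1\<close> and \<open>Q3_2\<close>,
  and an atom at the origin is invisible to both.\<close>

definition psi :: "(real \<Rightarrow> real) \<Rightarrow> real \<Rightarrow> real" where
  "psi \<phi> x = (if 0 < x then L0 \<phi> x / sqrt x else 0)"

text \<open>The Lipschitz constant controls \<open>kap\<close>; the growth condition on
  \<open>L0\<close> makes \<open>psi \<phi>\<close> grow at most linearly, which is what mass and
  energy can control. Boundedness of \<phi> is deliberately absent, since the truncated power is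
  unbounded.\<close>

definition adm :: "real \<Rightarrow> real \<Rightarrow> (real \<Rightarrow> real) \<Rightarrow> bool" where
  "adm L C \<phi> \<longleftrightarrow> 0 \<le> L \<and> 0 \<le> C \<and>
     (\<forall>x y. \<bar>\<phi> x - \<phi> y\<bar> \<le> L * \<bar>x - y\<bar>) \<and>
     (\<forall>x\<ge>0. \<bar>L0 \<phi> x\<bar> \<le> C * (sqrt x * (1 + x)))"

text \<open>The smallness condition makes \<open>kap \<phi>\<close> continuous at the origin, where \<open>1 / sqrt (x * y)\<close> is
  singular; it holds for \<open>C\<^sup>1\<close> functions \<open>\<phi>\<close>.\<close>

definition tame :: "(real \<Rightarrow> real) \<Rightarrow> bool" where
  "tame \<phi> \<longleftrightarrow> (\<exists>L C. adm L C \<phi>) \<and>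
     (\<forall>e>0. \<exists>d>0. \<forall>x y. 0 < x \<and> x < d \<and> 0 < y \<and> y < d \<longrightarrow> \<bar>kap \<phi> x y\<bar> \<le> e)"

lemma admD:
  assumes "adm L C \<phi>"
  shows "continuous_on UNIV \<phi>" "0 \<le> L" "0 \<le> C"
    "\<And>x y. \<bar>\<phi> x - \<phi> y\<bar> \<le> L * \<bar>x - y\<bar>"
    "\<And>x. 0 \<le> x \<Longrightarrow> \<bar>L0 \<phi> x\<bar> \<le> C * (sqrt x * (1 + x))"
proof -
  show L: "0 \<le> L" and lip: "\<bar>\<phi> x - \<phi> y\<bar> \<le> L * \<bar>x - y\<bar>" for x y
    using assms unfolding adm_def by auto
  show "continuous_on UNIV \<phi>"
    using lip L by (intro lipschitz_on_continuous_on[of L] lipschitz_onI) (auto simp: dist_real_def)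
qed (use assms in \<open>auto simp: adm_def\<close>)

lemma kap_commute: "kap \<phi> x y = kap \<phi> y x"
  by (simp add: kap_def Lam_def max.commute add.commute mult.commute abs_minus_commute)

text \<open>Both increments start from \<open>\<phi> x\<close> and have length \<open>y\<close>, the
  smaller argument, so \<open>Lam\<close> costs only \<open>2 * L * y\<close>, and
  \<open>y / sqrt (x * y) = sqrt (y / x)\<close>.\<close>

lemma kap_le_sqrt:
  assumes "adm L C \<phi>" "0 < y" "y \<le> x"
  shows "\<bar>kap \<phi> x y\<bar> \<le> 2 * L * sqrt (y / x)"
proof -
  have "\<bar>\<phi> (x + y) - \<phi> x\<bar> \<le> L * y" "\<bar>\<phi> (x - y) - \<phi> x\<bar> \<le> L * y"
    using admD(4)[OF assms(1), of "x+y" x] admD(4)[OF assms(1), of "x-y" x] assms by auto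
  then have "\<bar>Lam \<phi> x y\<bar> \<le> 2 * L * y"
    using assms by (simp add: Lam_def max_def abs_le_iff)
  then have "\<bar>kap \<phi> x y\<bar> \<le> 2 * L * y / sqrt (x * y)"
    using assms by (simp add: kap_def divide_right_mono abs_mult)
  also have "\<dots> = 2 * L * sqrt (y / x)"
    using assms by (simp add: real_sqrt_mult real_sqrt_divide field_simps)
  finally show ?thesis .
qed

lemma kap_le:
  assumes "adm L C \<phi>"
  shows "\<bar>kap \<phi> x y\<bar> \<le> 2 * L"
proof -
  have *: "\<bar>kap \<phi> x y\<bar> \<le> 2 * L" if "0 < y" "y \<le> x" for x y
  proof -
    have "2 * L * sqrt (y / x) \<le> 2 * L * 1"
      using that admD(2)[OF assms] by (intro mult_left_mono) auto
    with kap_le_sqrt[OF assms that] show ?thesis by simp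
  qed
  consider "0 < y" "y \<le> x" | "0 < x" "x \<le> y" | "\<not> (0 < x \<and> 0 < y)" by linarith
  then show ?thesis
  proof cases
    case 2 then show ?thesis using *[of x y] by (subst kap_commute)
  qed (use * admD(2)[OF assms] in \<open>auto simp: kap_def\<close>)
qed

text \<open>There are three regimes: inside the quadrant \<open>kap\<close> is a composition of
  continuous functions; at an axis away from the corner \<open>kap_le_sqrt\<close> forces it to
  zero; at the corner \<open>sqrt (y / x)\<close> need not be small, and only the second half of
  \<open>tame\<close> helps.\<close>

lemma isCont_kap:
  assumes "tame \<phi>"
  shows "isCont (\<lambda>p. kap \<phi> (fst p) (snd p)) p"
proof -
  obtain L C where a: "adm L C \<phi>"
    and z: "\<And>e. 0 < e \<Longrightarrow> \<exists>d>0. \<forall>x y. 0 < x \<and> x < d \<and> 0 < y \<and> y < d \<longrightarrow> \<bar>kap \<phi> x y\<bar> \<le> e"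
    using assms unfolding tame_def by blast
  note cont = admD(1)[OF a] and L = admD(2)[OF a]
  obtain a b where p: "p = (a, b)" by (cases p)
  have small: "\<exists>d>0. \<forall>x y. \<bar>x - a\<bar> < d \<and> \<bar>y - b\<bar> < d \<longrightarrow> \<bar>kap \<phi> x y\<bar> \<le> e"
    if "0 < e" "b \<le> 0 \<or> a \<le> 0" for e a b
  proof -
    have one: "\<exists>d>0. \<forall>x y. \<bar>x - a\<bar> < d \<and> \<bar>y - b\<bar> < d \<longrightarrow> \<bar>kap \<phi> x y\<bar> \<le> e"
      if b: "b \<le> 0" for a b
    proof -
      consider "b < 0 \<or> a < 0" | "b = 0" "0 < a" | "b = 0" "a = 0" using b by linarith
      then show ?thesis
      proof cases
        case 1
        then show ?thesis
        proof (rule disjE)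
          assume "b < 0"
          then show ?thesis using \<open>0 < e\<close> by (intro exI[of _ "- b"]) (auto simp: kap_def)
        next
          assume "a < 0"
          then show ?thesis using \<open>0 < e\<close> by (intro exI[of _ "- a"]) (auto simp: kap_def)
        qed
      next
        case 2
        \<comment> \<open>Within distance \<open>d\<close> one has \<open>x > a/2\<close>, hence
          \<open>y / x\<close> is at most the square of \<open>e / (2*L + 1)\<close>. The summand 1
          avoids a division by zero when \<open>L = 0\<close>.\<close>
        define d where "d = min (a/2) ((e / (2*L + 1))\<^sup>2 * (a/2))"
        have "d > 0" using 2 \<open>0 < e\<close> L by (auto simp: d_def)
        moreover have "\<bar>kap \<phi> x y\<bar> \<le> e" if xy: "\<bar>x - a\<bar> < d" "\<bar>y - b\<bar> < d" for x y
        proof (cases "0 < y")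
          case True
          have dd: "d \<le> a/2" "d \<le> (e / (2*L + 1))\<^sup>2 * (a/2)" by (auto simp: d_def)
          have x: "x > a/2" "y < a/2" using xy 2 dd by (auto simp: abs_less_iff)
          have "\<bar>kap \<phi> x y\<bar> \<le> 2 * L * sqrt (y / x)"
            using x True by (intro kap_le_sqrt[OF a]) auto
          also have "y / x \<le> (e / (2*L+1))\<^sup>2"
          proof -
            have "y \<le> (e / (2*L+1))\<^sup>2 * (a/2)" using xy 2 dd True by auto
            also have "\<dots> \<le> (e / (2*L+1))\<^sup>2 * x" using x by (intro mult_left_mono) auto
            finally show ?thesis using x 2 by (simp add: divide_le_eq)
          qed
          then have "2 * L * sqrt (y / x) \<le> 2 * L * (e / (2*L+1))"
            using L \<open>0 < e\<close> by (intro mult_left_mono real_le_lsqrt) auto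
          also have "\<dots> \<le> e" using L \<open>0 < e\<close> by (simp add: divide_le_eq)
          finally show ?thesis by simp
        qed (use \<open>0 < e\<close> in \<open>simp add: kap_def\<close>)
        ultimately show ?thesis by blast
      next
        case 3
        obtain d where "d > 0" "\<And>x y. 0 < x \<and> x < d \<and> 0 < y \<and> y < d \<Longrightarrow> \<bar>kap \<phi> x y\<bar> \<le> e"
          using z[OF \<open>0 < e\<close>] by blast
        then show ?thesis using 3 \<open>0 < e\<close>
          by (intro exI[of _ d]) (auto simp: kap_def abs_less_iff)
      qed
    qed
    show ?thesis using one[of b a] one[of a b] that(2) kap_commute by metis
  qed
  show ?thesis
  proof (cases "0 < a \<and> 0 < b")
    case True
    have ev: "\<forall>\<^sub>F q in nhds (a, b). Lam \<phi> (fst q) (snd q) / sqrt (fst q * snd q) = kap \<phi> (fst q) (snd q)"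
    proof -
      have "open ({0::real<..} \<times> {0::real<..})" by (intro open_Times) auto
      then have "\<forall>\<^sub>F q in nhds (a, b). q \<in> {0<..} \<times> {0::real<..}"
        using True by (intro eventually_nhds_in_open) auto
      then show ?thesis by eventually_elim (auto simp: kap_def)
    qed
    have c: "continuous_on UNIV (\<lambda>q. \<phi> (g q))" if "continuous_on UNIV g" for g :: "real \<times> real \<Rightarrow> real"
      using continuous_on_compose2[OF cont that] by auto
    have "isCont (\<lambda>q. Lam \<phi> (fst q) (snd q)) (a, b)"
      unfolding Lam_def
      by (rule continuous_on_interior[where S=UNIV]) (auto intro!: continuous_intros c)
    then have "isCont (\<lambda>q. Lam \<phi> (fst q) (snd q) / sqrt (fst q * snd q)) (a, b)"
      using True by (intro continuous_intros) auto
    then show ?thesis unfolding p isCont_def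
      using isCont_cong[OF ev] by (simp add: isCont_def)
  next
    case False
    then have k0: "kap \<phi> a b = 0" and ab: "b \<le> 0 \<or> a \<le> 0" by (auto simp: kap_def)
    show ?thesis unfolding p continuous_at_eps_delta
    proof (intro allI impI)
      fix e :: real assume "0 < e"
      then obtain d where "d > 0" and d: "\<And>x y. \<bar>x - a\<bar> < d \<and> \<bar>y - b\<bar> < d \<Longrightarrow> \<bar>kap \<phi> x y\<bar> \<le> e/2"
        using small[of "e/2" b a] ab half_gt_zero by metis
      have "\<bar>kap \<phi> (fst q) (snd q)\<bar> < e" if "dist q (a, b) < d" for q
      proof -
        have "\<bar>fst q - a\<bar> < d" "\<bar>snd q - b\<bar> < d"
          using that dist_fst_le[of q "(a,b)"] dist_snd_le[of q "(a,b)"] by (auto simp: dist_real_def)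
        then show ?thesis using d[of "fst q" "snd q"] \<open>0 < e\<close> by linarith
      qed
      then show "\<exists>d>0. \<forall>x'. dist x' (a, b) < d \<longrightarrow>
          dist (kap \<phi> (fst x') (snd x')) (kap \<phi> (fst (a, b)) (snd (a, b))) < e"
        using \<open>d > 0\<close> k0 by (auto simp: dist_real_def)
    qed
  qed
qed

text \<open>\<open>h * trapezoid_L0 f i\<close> is \<open>L0\<close> at \<open>i h\<close> with the integral replaced by the trapezoidal
  rule; this choice keeps the discrete mass and first moment exactly conserved.\<close>

definition trapezoid_L0 :: "(nat \<Rightarrow> real) \<Rightarrow> nat \<Rightarrow> real" where
  "trapezoid_L0 f i = real i * (f 0 + f i) - (\<Sum>l<i. f l + f (Suc l))"

text \<open>On each cell \<phi> differs from the mean of its end values by at most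
  \<open>L * h\<close>, so a cell costs \<open>L * h * h\<close>; induction adds up \<open>i\<close>
  cells.\<close>

lemma trapezoid_error:
  assumes "adm L C \<phi>" "0 < h"
  shows "\<bar>integral {0..real i * h} \<phi> - h / 2 * (\<Sum>l<i. \<phi> (real l * h) + \<phi> (real (Suc l) * h))\<bar>
           \<le> L * h * (real i * h)"
proof (induction i)
  case 0
  show ?case by simp
next
  case (Suc i)
  define a b where "a = real i * h" and "b = real (Suc i) * h"
  have ab: "0 \<le> a" "a \<le> b" "b - a = h" using assms by (auto simp: a_def b_def algebra_simps)
  have int: "\<phi> integrable_on {u..v}" for u v
    using admD(1)[OF assms(1)] by (meson continuous_on_subset integrable_continuous_real subset_UNIV)
  have comb: "integral {0..b} \<phi> = integral {0..a} \<phi> + integral {a..b} \<phi>"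
    using ab by (intro Henstock_Kurzweil_Integration.integral_combine[symmetric] int) auto
  have "norm (integral {a..b} (\<lambda>x. \<phi> x - (\<phi> a + \<phi> b)/2)) \<le> L * h * (b - a)"
  proof (rule integral_bound)
    show "continuous_on {a..b} (\<lambda>x. \<phi> x - (\<phi> a + \<phi> b)/2)"
      using admD(1)[OF assms(1)] by (intro continuous_intros) (auto intro: continuous_on_subset)
    fix x assume x: "x \<in> {a..b}"
    have "\<bar>\<phi> x - \<phi> a\<bar> \<le> L * h" "\<bar>\<phi> x - \<phi> b\<bar> \<le> L * h"
    proof -
      have "\<bar>\<phi> x - \<phi> a\<bar> \<le> L * \<bar>x - a\<bar>" "\<bar>\<phi> x - \<phi> b\<bar> \<le> L * \<bar>x - b\<bar>"
        by (simp_all only: admD(4)[OF assms(1)])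
      moreover have "L * \<bar>x - a\<bar> \<le> L * h" "L * \<bar>x - b\<bar> \<le> L * h"
        using x ab admD(2)[OF assms(1)] by (auto intro!: mult_left_mono)
      ultimately show "\<bar>\<phi> x - \<phi> a\<bar> \<le> L * h" "\<bar>\<phi> x - \<phi> b\<bar> \<le> L * h" by linarith+
    qed
    then show "norm (\<phi> x - (\<phi> a + \<phi> b)/2) \<le> L * h" unfolding real_norm_def abs_le_iff by (auto simp: add_divide_distrib)
  qed (use ab in auto)
  also have "integral {a..b} (\<lambda>x. \<phi> x - (\<phi> a + \<phi> b)/2) = integral {a..b} \<phi> - h / 2 * (\<phi> a + \<phi> b)"
  proof -
    have c: "measure lborel {a..b} = h" using ab(2,3) by simp
    have "integral {a..b} (\<lambda>x. (\<phi> a + \<phi> b)/2) = h * ((\<phi> a + \<phi> b)/2)"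
      unfolding integral_const_real c real_scaleR_def ..
    then show ?thesis
      unfolding integral_diff[OF int integrable_const_ivl] by (simp add: field_simps)
  qed
  finally have 1: "\<bar>integral {a..b} \<phi> - h / 2 * (\<phi> a + \<phi> b)\<bar> \<le> L * h * h"
    unfolding ab(3) by simp
  have 2: "\<bar>integral {0..a} \<phi> - h / 2 * (\<Sum>l<i. \<phi> (real l * h) + \<phi> (real (Suc l) * h))\<bar> \<le> L * h * a"
    using Suc by (simp add: a_def)
  have 3: "L * h * b = L * h * a + L * h * h"
    unfolding distrib_left[symmetric] using ab(3) by simp
  define S where "S = (\<Sum>l<i. \<phi> (real l * h) + \<phi> (real (Suc l) * h))"
  have 4: "\<bar>integral {0..a} \<phi> - h / 2 * S\<bar> \<le> L * h * a" using 2 by (simp add: S_def)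
  have "\<bar>integral {0..b} \<phi> - h / 2 * (S + (\<phi> a + \<phi> b))\<bar> \<le> L * h * b"
    unfolding comb 3 distrib_left[of "h/2" S] using 1 4 by linarith
  then show ?case by (simp only: S_def a_def b_def sum.lessThan_Suc)
qed

lemma trapezoid_L0_error:
  assumes "adm L C \<phi>" "0 < h"
  shows "\<bar>h * trapezoid_L0 (\<lambda>i. \<phi> (real i * h)) i - L0 \<phi> (real i * h)\<bar> \<le> 2 * L * h * (real i * h)"
proof -
  define S where "S = (\<Sum>l<i. \<phi> (real l * h) + \<phi> (real (Suc l) * h))"
  have "h * trapezoid_L0 (\<lambda>i. \<phi> (real i * h)) i - L0 \<phi> (real i * h)
      = 2 * (integral {0..real i * h} \<phi> - h / 2 * S)"
    by (simp add: trapezoid_L0_def L0_def S_def algebra_simps)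
  then show ?thesis using trapezoid_error[OF assms, of i] by (simp add: S_def abs_mult)
qed

text \<open>With a single cell of length \<open>x\<close> the trapezoidal counterpart of
  \<open>L0\<close> vanishes, so \<open>L0 \<phi> x\<close> is itself the quadrature error. The
  quadratic bound is what makes \<open>psi \<phi>\<close> continuous at the origin.\<close>

lemma L0_le_square:
  assumes "adm L C \<phi>" "0 < x"
  shows "\<bar>L0 \<phi> x\<bar> \<le> 2 * L * x * x"
  using trapezoid_L0_error[OF assms, of 1] by (simp add: trapezoid_L0_def)

lemma psi_le:
  assumes "adm L C \<phi>" "0 \<le> x"
  shows "\<bar>psi \<phi> x\<bar> \<le> C * (1 + x)"
proof (cases "0 < x")
  case True
  then have "\<bar>psi \<phi> x\<bar> \<le> C * (sqrt x * (1 + x)) / sqrt x"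
    using divide_right_mono[OF admD(5)[OF assms], of "sqrt x"] by (simp add: psi_def)
  with True show ?thesis by simp
qed (use assms admD(3)[OF assms(1)] in \<open>auto simp: psi_def\<close>)

lemma isCont_psi:
  assumes "adm L C \<phi>"
  shows "isCont (psi \<phi>) x"
proof (cases "0 < x")
  case True
  have "isCont (\<lambda>x. integral {0..x} \<phi>) x"
  proof -
    have "continuous_on {0..x+1} (\<lambda>x. integral {0..x} \<phi>)"
      by (rule indefinite_integral_continuous_1)
        (use admD(1)[OF assms] in \<open>meson continuous_on_subset integrable_continuous_real subset_UNIV\<close>)
    then show ?thesis using True by (intro continuous_on_interior[of "{0..x+1}"]) auto
  qed
  moreover have "isCont \<phi> x"
    using admD(1)[OF assms] by (simp add: continuous_on_eq_continuous_at)
  ultimately have "isCont (\<lambda>x. L0 \<phi> x / sqrt x) x"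
    unfolding L0_def using True by (intro continuous_intros) auto
  moreover have "\<forall>\<^sub>F y in nhds x. L0 \<phi> y / sqrt y = psi \<phi> y"
    using eventually_nhds_in_open[of "{0<..}" x] True by (auto elim!: eventually_mono simp: psi_def)
  ultimately show ?thesis using isCont_cong by metis
next
  case False
  have lim: "psi \<phi> \<midarrow>x\<rightarrow> 0"
  proof (rule Lim_null_comparison)
    have b: "\<bar>psi \<phi> y\<bar> \<le> 2 * L * \<bar>y - x\<bar> * sqrt \<bar>y - x\<bar>" for y
    proof (cases "0 < y")
      case True
      have "\<bar>psi \<phi> y\<bar> \<le> 2 * L * y * y / sqrt y"
        using True L0_le_square[OF assms True] by (simp add: psi_def divide_right_mono)
      also have "\<dots> = 2 * L * y * sqrt y" using True
        by (metis abs_of_pos real_div_sqrt less_eq_real_def times_divide_eq_right)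
      also have "\<dots> \<le> 2 * L * \<bar>y - x\<bar> * sqrt \<bar>y - x\<bar>"
        using True False admD(2)[OF assms] by (intro mult_mono) auto
      finally show ?thesis .
    qed (use admD(2)[OF assms] in \<open>auto simp: psi_def\<close>)
    then show "\<forall>\<^sub>F y in at x. norm (psi \<phi> y) \<le> 2 * L * \<bar>y - x\<bar> * sqrt \<bar>y - x\<bar>" by simp
    show "((\<lambda>y. 2 * L * \<bar>y - x\<bar> * sqrt \<bar>y - x\<bar>) \<longlongrightarrow> 0) (at x)"
      by (auto intro!: tendsto_eq_intros)
  qed
  with False show ?thesis by (simp add: isCont_def psi_def)
qed

section \<open>Admissible and tame test functions on the half-line\<close>

lemma L0_bounded_le:
  assumes "continuous_on {0..x} \<phi>" "\<And>y. 0 \<le> y \<Longrightarrow> \<bar>\<phi> y\<bar> \<le> B" "0 \<le> x"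
  shows "\<bar>L0 \<phi> x\<bar> \<le> 4 * B * x"
proof -
  have "norm (integral {0..x} \<phi>) \<le> B * (x - 0)"
    using assms by (intro integral_bound) auto
  moreover have "\<bar>x * (\<phi> 0 + \<phi> x)\<bar> \<le> x * (B + B)"
    unfolding abs_mult using assms(2)[of 0] assms(2)[of x] assms(3)
    by (intro mult_mono) auto
  ultimately show ?thesis unfolding L0_def by (auto simp: abs_le_iff algebra_simps)
qed

lemma le_sqrt_mult: "0 \<le> x \<Longrightarrow> x \<le> sqrt x * (1 + x)"
proof -
  assume x: "0 \<le> (x::real)"
  have "sqrt x \<le> 1 + x" using x by (intro real_le_lsqrt) (auto simp: power2_eq_square algebra_simps)
  then have "sqrt x * sqrt x \<le> sqrt x * (1 + x)" using x by (intro mult_left_mono) auto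
  then show ?thesis using x by simp
qed

lemma adm_bounded:
  assumes L: "0 \<le> L" and lip: "\<And>x y. \<bar>\<phi> x - \<phi> y\<bar> \<le> L * \<bar>x - y\<bar>"
    and bd: "\<And>y. 0 \<le> y \<Longrightarrow> \<bar>\<phi> y\<bar> \<le> B"
  shows "adm L (4 * B) \<phi>"
  unfolding adm_def
proof (intro conjI allI impI)
  show B: "0 \<le> 4 * B" using bd[of 0] by auto
  have cont: "continuous_on A \<phi>" for A
    using lip L by (intro lipschitz_on_continuous_on[of L] lipschitz_onI) (auto simp: dist_real_def)
  fix x :: real assume x: "0 \<le> x"
  have "\<bar>L0 \<phi> x\<bar> \<le> 4 * B * x"
    by (rule L0_bounded_le[OF cont bd x])
  also have "\<dots> \<le> 4 * B * (sqrt x * (1 + x))" using B le_sqrt_mult[OF x] by (intro mult_left_mono)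
  finally show "\<bar>L0 \<phi> x\<bar> \<le> 4 * B * (sqrt x * (1 + x))" .
qed (use assms in auto)

text \<open>The mean value theorem gives
  \<open>Lam \<phi> x y = y * (\<phi>' z1 - \<phi>' z2)\<close> with both points near the origin.
  Continuity of \<phi>' at 0 makes the bracket small, and \<open>y \<le> sqrt (x * y)\<close>
  absorbs the singular denominator.\<close>

lemma tameI:
  assumes a: "adm L C \<phi>" and c: "continuous_on {0..} \<phi>'"
    and d: "\<And>x. 0 \<le> x \<Longrightarrow> (\<phi> has_real_derivative \<phi>' x) (at x within {0..})"
  shows "tame \<phi>"
  unfolding tame_def
proof (intro conjI allI impI)
  show "\<exists>L C. adm L C \<phi>" using a by blast
  fix e :: real assume "0 < e"
  have "continuous (at 0 within {0..}) \<phi>'" using c by (auto simp: continuous_on_eq_continuous_within)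
  then obtain \<delta> where "\<delta> > 0" and \<delta>: "\<And>x. 0 \<le> x \<Longrightarrow> x < \<delta> \<Longrightarrow> \<bar>\<phi>' x - \<phi>' 0\<bar> < e/2"
    unfolding continuous_within_eps_delta using \<open>0 < e\<close>
    by (auto simp: dist_real_def dest!: spec[of _ "e/2"])
  have le: "\<bar>kap \<phi> x y\<bar> \<le> e" if xy: "0 < y" "y \<le> x" "x < \<delta>/2" for x y
  proof -
    have mvt: "\<exists>z. a \<le> z \<and> z \<le> b \<and> \<phi> b - \<phi> a = (b - a) * \<phi>' z" if ab: "0 \<le> a" "a < b" for a b
    proof -
      have "\<exists>z\<in>{a..b}. \<phi> b - \<phi> a = (*) (\<phi>' z) (b - a)"
      proof (rule mvt_very_simple[OF less_imp_le[OF ab(2)]])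
        fix z assume "a \<le> z" "z \<le> b"
        then show "(\<phi> has_derivative (*) (\<phi>' z)) (at z within {a..b})"
          using d[of z] ab unfolding has_field_derivative_def
          by (auto intro: has_derivative_subset)
      qed
      then show ?thesis by (auto simp: mult.commute)
    qed
    obtain z1 z2 where z: "x \<le> z1" "z1 \<le> x + y" "\<phi> (x + y) - \<phi> x = y * \<phi>' z1"
        "x - y \<le> z2" "z2 \<le> x" "\<phi> x - \<phi> (x - y) = y * \<phi>' z2"
      using mvt[of x "x+y"] mvt[of "x-y" x] xy by auto
    then have "Lam \<phi> x y = y * (\<phi>' z1 - \<phi>' z2)"
      using xy by (simp add: Lam_def max_def algebra_simps)
    moreover have "\<bar>\<phi>' z1 - \<phi>' 0\<bar> < e/2" "\<bar>\<phi>' z2 - \<phi>' 0\<bar> < e/2"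
      using \<delta>[of z1] \<delta>[of z2] z xy by simp_all
    then have "\<bar>\<phi>' z1 - \<phi>' z2\<bar> \<le> e" by linarith
    ultimately have "\<bar>Lam \<phi> x y\<bar> \<le> y * e" using xy by (simp add: abs_mult)
    moreover have "y \<le> sqrt (x * y)" using xy
      by (intro real_le_rsqrt) (auto simp: power2_eq_square intro!: mult_right_mono)
    ultimately have "\<bar>Lam \<phi> x y\<bar> \<le> sqrt (x * y) * e"
      using \<open>0 < e\<close> by (smt (verit) mult_right_mono)
    then show ?thesis using xy by (simp add: kap_def divide_le_eq mult.commute)
  qed
  show "\<exists>d>0. \<forall>x y. 0 < x \<and> x < d \<and> 0 < y \<and> y < d \<longrightarrow> \<bar>kap \<phi> x y\<bar> \<le> e"
  proof (intro exI[of _ "\<delta>/2"] conjI allI impI)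
    fix x y assume "0 < x \<and> x < \<delta>/2 \<and> 0 < y \<and> y < \<delta>/2"
    then show "\<bar>kap \<phi> x y\<bar> \<le> e" using le[of y x] le[of x y] kap_commute[of \<phi> x y] by (cases "y \<le> x") auto
  qed (use \<open>\<delta> > 0\<close> in simp)
qed

text \<open>Only values of \<phi> on the half-line enter the kernels. Test functions are therefore
  extended by \<open>\<phi> (max 0 x)\<close>, which keeps their Lipschitz constant and makes weak
  convergence on the real line applicable.\<close>

lemma kap_max0: "kap (\<lambda>x. \<phi> (max 0 x)) = kap \<phi>"
  by (auto simp: kap_def Lam_def fun_eq_iff max_def)

lemma L0_max0: "0 \<le> x \<Longrightarrow> L0 (\<lambda>x. \<phi> (max 0 x)) x = L0 \<phi> x"
proof -
  assume x: "0 \<le> x"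
  have "integral {0..x} (\<lambda>x. \<phi> (max 0 x)) = integral {0..x} \<phi>"
    by (intro integral_cong) auto
  then show ?thesis using x by (simp add: L0_def)
qed

lemma psi_max0: "psi (\<lambda>x. \<phi> (max 0 x)) = psi \<phi>"
  by (auto simp: psi_def L0_max0 fun_eq_iff)

lemma continuous_max0:
  "continuous_on {0..} \<phi> \<Longrightarrow> continuous_on UNIV (\<lambda>x::real. \<phi> (max 0 x) :: real)"
  by (rule continuous_on_compose2[of "{0..}" \<phi> UNIV "\<lambda>x. max 0 x"]) (auto intro!: continuous_intros)

lemma has_real_derivative_Lipschitz:
  assumes "\<And>x. 0 \<le> x \<Longrightarrow> (\<phi> has_real_derivative \<phi>' x) (at x within {0..})"
    "\<And>x. 0 \<le> x \<Longrightarrow> \<bar>\<phi>' x\<bar> \<le> L" "0 \<le> x" "0 \<le> y"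
  shows "\<bar>\<phi> x - \<phi> y\<bar> \<le> L * \<bar>x - y\<bar>"
  using field_differentiable_bound[of "{0::real..}" \<phi> \<phi>' L x y] assms by auto

lemma tame_max0:
  assumes c: "continuous_on {0..} \<phi>'"
    and d: "\<And>x. 0 \<le> x \<Longrightarrow> (\<phi> has_real_derivative \<phi>' x) (at x within {0..})"
    and L: "\<And>x. 0 \<le> x \<Longrightarrow> \<bar>\<phi>' x\<bar> \<le> L"
    and C: "0 \<le> C" "\<And>x. 0 \<le> x \<Longrightarrow> \<bar>L0 \<phi> x\<bar> \<le> C * (sqrt x * (1 + x))"
  shows "adm L C (\<lambda>x. \<phi> (max 0 x))" "tame (\<lambda>x. \<phi> (max 0 x))"
proof -
  have L0: "0 \<le> L" using L[of 0] by auto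
  have "\<bar>\<phi> (max 0 x) - \<phi> (max 0 y)\<bar> \<le> L * \<bar>x - y\<bar>" for x y
  proof -
    have "\<bar>\<phi> (max 0 x) - \<phi> (max 0 y)\<bar> \<le> L * \<bar>max 0 x - max 0 y\<bar>"
      by (rule has_real_derivative_Lipschitz[OF d L]) auto
    also have "\<dots> \<le> L * \<bar>x - y\<bar>" using L0 by (intro mult_left_mono) auto
    finally show ?thesis .
  qed
  then show a: "adm L C (\<lambda>x. \<phi> (max 0 x))"
    unfolding adm_def using L0 C by (simp add: L0_max0)
  have "((\<lambda>x. \<phi> (max 0 x)) has_real_derivative \<phi>' x) (at x within {0..})" if "0 \<le> x" for x
    using has_field_derivative_transform_within[OF d[OF that] zero_less_one] that by auto
  then show "tame (\<lambda>x. \<phi> (max 0 x))" by (rule tameI[OF a c])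
qed

lemma tame_bounded:
  assumes c: "continuous_on {0..} \<phi>'"
    and d: "\<And>x. 0 \<le> x \<Longrightarrow> (\<phi> has_real_derivative \<phi>' x) (at x within {0..})"
    and L: "\<And>x. 0 \<le> x \<Longrightarrow> \<bar>\<phi>' x\<bar> \<le> L" and B: "\<And>y. 0 \<le> y \<Longrightarrow> \<bar>\<phi> y\<bar> \<le> B"
  shows "tame (\<lambda>x. \<phi> (max 0 x))"
proof -
  have B0: "0 \<le> 4 * B" using B[of 0] by auto
  have "continuous_on {0..} \<phi>"
    using d by (auto simp: continuous_on_eq_continuous_within intro: DERIV_continuous)
  then have cont: "continuous_on {0..x} \<phi>" for x
    by (rule continuous_on_subset) auto
  have "\<bar>L0 \<phi> x\<bar> \<le> 4 * B * (sqrt x * (1 + x))" if "0 \<le> x" for x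
  proof -
    have "\<bar>L0 \<phi> x\<bar> \<le> 4 * B * x" by (rule L0_bounded_le[OF cont B that])
    also have "\<dots> \<le> 4 * B * (sqrt x * (1 + x))" using B0 le_sqrt_mult[OF that] by (intro mult_left_mono)
    finally show ?thesis .
  qed
  then show ?thesis using tame_max0[OF c d L B0] by auto
qed

lemma C1b_tame:
  assumes "C1b \<phi>"
  shows "tame (\<lambda>x. \<phi> (max 0 x))"
proof -
  obtain \<phi>' where f: "continuous_on {0..} \<phi>'"
      "\<And>x. x\<ge>0 \<Longrightarrow> (\<phi> has_real_derivative \<phi>' x) (at x within {0..})"
      "bounded (\<phi> ` {0..})" "bounded (\<phi>' ` {0..})"
    using assms unfolding C1b_def by blast
  obtain B where B: "\<And>x. x\<ge>0 \<Longrightarrow> \<bar>\<phi> x\<bar> \<le> B" using f(3) by (auto simp: bounded_iff)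
  obtain L where L: "\<And>x. x\<ge>0 \<Longrightarrow> \<bar>\<phi>' x\<bar> \<le> L" using f(4) by (auto simp: bounded_iff)
  show ?thesis
    by (rule tame_bounded[OF f(1,2) L B])
qed

section \<open>An explicit Euler scheme on a lattice\<close>

text \<open>Subtraction on naturals is truncated, so \<open>(i - l) + (l - i)\<close> is the
  distance of \<open>i\<close> and \<open>l\<close>.\<close>

definition dLam :: "(nat \<Rightarrow> real) \<Rightarrow> nat \<Rightarrow> nat \<Rightarrow> real" where
  "dLam f i l = f (i + l) + f ((i - l) + (l - i)) - 2 * f (max i l)"

text \<open>Collisions that would leave \<open>{0..K}\<close> are suppressed, so the scheme stays finite.\<close>

definition dQ :: "real \<Rightarrow> nat \<Rightarrow> (nat \<Rightarrow> real) \<Rightarrow> (nat \<Rightarrow> real) \<Rightarrow> real" where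
  "dQ h K f w =
     (\<Sum>i\<in>{1..K}. \<Sum>l\<in>{1..K}. if i + l \<le> K then dLam f i l / (h * sqrt (real i * real l)) * (w i * w l) else 0)
     - (\<Sum>i\<in>{1..K}. h * trapezoid_L0 f i / sqrt (real i * h) * w i)"

definition dpair :: "nat \<Rightarrow> (nat \<Rightarrow> real) \<Rightarrow> (nat \<Rightarrow> real) \<Rightarrow> real" where
  "dpair K f w = (\<Sum>i\<le>K. f i * w i)"

text \<open>The step is defined by duality: the new weight at \<open>m\<close> is what the discrete
  weak equation prescribes for the indicator of \<open>m\<close>.\<close>

definition estep :: "real \<Rightarrow> real \<Rightarrow> nat \<Rightarrow> (nat \<Rightarrow> real) \<Rightarrow> nat \<Rightarrow> real" where
  "estep \<delta> h K w m = w m + \<delta> * dQ h K (\<lambda>i. if i = m then 1 else 0) w"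

lemma trapezoid_L0_cong:
  "(\<And>j. j \<le> i \<Longrightarrow> f j = g j) \<Longrightarrow> trapezoid_L0 f i = trapezoid_L0 g i"
  unfolding trapezoid_L0_def by (intro arg_cong2[where f="(-)"] sum.cong) auto

lemma dQ_cong:
  assumes "\<And>i. i \<le> K \<Longrightarrow> f i = g i"
  shows "dQ h K f w = dQ h K g w"
proof -
  have "dLam f i l = dLam g i l" if "i + l \<le> K" for i l
    using that unfolding dLam_def by (intro arg_cong2[where f="(-)"] arg_cong2[where f="(+)"] arg_cong2[where f="(*)"] assms) auto
  moreover have "trapezoid_L0 f i = trapezoid_L0 g i" if "i \<le> K" for i
    using that by (intro trapezoid_L0_cong assms) auto
  ultimately show ?thesis unfolding dQ_def
    by (intro arg_cong2[where f="(-)"] sum.cong) auto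
qed

lemma trapezoid_L0_add: "trapezoid_L0 (\<lambda>i. f i + g i) i = trapezoid_L0 f i + trapezoid_L0 g i"
  by (simp add: trapezoid_L0_def sum.distrib algebra_simps)

lemma trapezoid_L0_scale: "trapezoid_L0 (\<lambda>i. c * f i) i = c * trapezoid_L0 f i"
  by (simp add: trapezoid_L0_def sum_distrib_left algebra_simps)

lemma dLam_add: "dLam (\<lambda>i. f i + g i) i l = dLam f i l + dLam g i l"
  by (simp add: dLam_def)

lemma dLam_scale: "dLam (\<lambda>i. c * f i) i l = c * dLam f i l"
  by (simp add: dLam_def algebra_simps)

lemma dQ_add: "dQ h K (\<lambda>i. f i + g i) w = dQ h K f w + dQ h K g w"
proof -
  have *: "(if P then (a + b) / c * d else 0) = (if P then a / c * d else 0) + (if P then b / c * d else (0::real))"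
    for P a b c d by (simp add: add_divide_distrib algebra_simps)
  have **: "h * (a + b) / c * d = h * a / c * d + h * b / c * (d::real)" for a b c d
    by (simp add: add_divide_distrib algebra_simps)
  show ?thesis
    unfolding dQ_def dLam_add trapezoid_L0_add * ** sum.distrib by simp
qed

lemma dQ_scale: "dQ h K (\<lambda>i. c * f i) w = c * dQ h K f w"
proof -
  have *: "(if P then (c * a) / b * d else 0) = c * (if P then a / b * d else (0::real))"
    for P a b d by simp
  have **: "h * (c * a) / b * d = c * (h * a / b * (d::real))" for a b d
    by simp
  show ?thesis
    unfolding dQ_def dLam_scale trapezoid_L0_scale * ** sum_distrib_left[symmetric] right_diff_distrib ..
qed

lemma dQ_sum:
  "finite M \<Longrightarrow> dQ h K (\<lambda>i. \<Sum>m\<in>M. c m * F m i) w = (\<Sum>m\<in>M. c m * dQ h K (F m) w)"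
proof (induction M rule: finite_induct)
  case empty
  show ?case using dQ_scale[of h K 0 "\<lambda>_. 0" w] by simp
qed (simp add: dQ_add dQ_scale)

text \<open>Every function on \<open>{0..K}\<close> is a combination of indicators, and
  \<open>dQ\<close> is linear in the test function and reads only its values up to \<open>K\<close>.
  The weak equation thus passes from indicators to all test functions.\<close>

lemma dpair_estep: "dpair K f (estep \<delta> h K w) = dpair K f w + \<delta> * dQ h K f w"
proof -
  have "dQ h K f w = dQ h K (\<lambda>i. \<Sum>m\<le>K. f m * (if i = m then 1 else 0)) w"
    by (rule dQ_cong) (simp add: sum.delta if_distrib cong: if_cong)
  also have "\<dots> = (\<Sum>m\<le>K. f m * dQ h K (\<lambda>i. if i = m then 1 else 0) w)"
    by (rule dQ_sum) simp
  finally show ?thesis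
    by (simp add: dpair_def estep_def distrib_left sum.distrib sum_distrib_left mult.left_commute)
qed

lemma trapezoid_L0_const: "trapezoid_L0 (\<lambda>_. c) i = 0"
  by (simp add: trapezoid_L0_def)

lemma trapezoid_L0_id: "trapezoid_L0 real i = 0"
proof -
  have "(\<Sum>l<i. real l + real (Suc l)) = real i * real i"
    by (induction i) (auto simp: algebra_simps)
  then show ?thesis by (simp add: trapezoid_L0_def)
qed

lemma dQ_const: "dQ h K (\<lambda>_. 1) w = 0"
  by (simp add: dQ_def dLam_def trapezoid_L0_const cong: if_cong)

text \<open>Conservation of energy rests on \<open>(x + y) + \<bar>x - y\<bar> = 2 * max x y\<close>
  and on the exactness of the trapezoidal rule for affine functions.\<close>

lemma dQ_id: "dQ h K (\<lambda>i. real i * h) w = 0"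
proof -
  have "dLam real i l = 0" for i l
    by (cases "i \<le> l") (auto simp: dLam_def max_def)
  then have "dQ h K real w = 0"
    by (simp add: dQ_def trapezoid_L0_id cong: if_cong)
  then show ?thesis using dQ_scale[of h K h real w] by (simp add: mult.commute)
qed

section \<open>Estimates for a single Euler step\<close>

lemma sqrt_le_one_plus: "0 \<le> x \<Longrightarrow> sqrt x \<le> 1 + x"
  by (rule real_le_lsqrt) (auto simp: power2_eq_square algebra_simps)

context
  fixes h \<delta> Mb E :: real and K :: nat and w :: "nat \<Rightarrow> real"
  assumes h: "0 < h" and d: "0 \<le> \<delta>"
    and pos: "\<And>i. 1 \<le> i \<Longrightarrow> i \<le> K \<Longrightarrow> 0 \<le> w i"
    and mass: "(\<Sum>i\<in>{1..K}. w i) \<le> Mb"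
    and en: "(\<Sum>i\<in>{1..K}. real i * h * w i) \<le> E"
begin

lemma sum_mass_ge0: "0 \<le> (\<Sum>i\<in>{1..K}. w i)"
  using pos by (intro sum_nonneg) auto

lemma sum_energy_ge0: "0 \<le> (\<Sum>i\<in>{1..K}. real i * h * w i)"
  using pos h by (intro sum_nonneg mult_nonneg_nonneg) auto

lemma sum_sqrt_le: "(\<Sum>i\<in>{1..K}. sqrt (real i * h) * w i) \<le> Mb + E"
proof -
  have "(\<Sum>i\<in>{1..K}. sqrt (real i * h) * w i) \<le> (\<Sum>i\<in>{1..K}. (1 + real i * h) * w i)"
    using pos h by (intro sum_mono mult_right_mono sqrt_le_one_plus) auto
  also have "\<dots> = (\<Sum>i\<in>{1..K}. w i) + (\<Sum>i\<in>{1..K}. real i * h * w i)"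
    by (simp add: distrib_right sum.distrib)
  finally show ?thesis using mass en by simp
qed

lemma sum_sqrt_le': "(\<Sum>i\<in>{1..K}. sqrt (real i * h) * w i)
    \<le> (\<Sum>i\<in>{1..K}. w i) + (\<Sum>i\<in>{1..K}. real i * h * w i)"
proof -
  have "(\<Sum>i\<in>{1..K}. sqrt (real i * h) * w i) \<le> (\<Sum>i\<in>{1..K}. (1 + real i * h) * w i)"
    using pos h by (intro sum_mono mult_right_mono sqrt_le_one_plus) auto
  also have "\<dots> = (\<Sum>i\<in>{1..K}. w i) + (\<Sum>i\<in>{1..K}. real i * h * w i)"
    by (simp add: distrib_right sum.distrib)
  finally show ?thesis .
qed

text \<open>The loss is proportional to \<open>w m\<close> itself, which is what positivity needs.
  In the quadratic part only the term with \<open>max i l\<close> is negative; it requires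
  \<open>i = m\<close> or \<open>l = m\<close>, and each alternative contributes at most
  \<open>2 / h * w m * Mb\<close>. The linear part removes at most
  \<open>i * h / sqrt (i * h) = sqrt (i * h)\<close> per unit weight.\<close>

lemma loss_rate:
  assumes m: "1 \<le> m" "m \<le> K"
  shows "- (w m * (4 * Mb / h + sqrt (real K * h))) \<le> dQ h K (\<lambda>i. if i = m then 1 else 0) w"
proof -
  let ?e = "\<lambda>i. if i = m then 1 else (0::real)"
  let ?s = "\<Sum>i\<in>{1..K}. w i"
  have t1: "- (2 / h) * ((?e i + ?e l) * (w i * w l))
      \<le> (if i + l \<le> K then dLam ?e i l / (h * sqrt (real i * real l)) * (w i * w l) else 0)"
    if il: "i \<in> {1..K}" "l \<in> {1..K}" for i l
  proof (cases "i + l \<le> K")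
    case True
    have w: "0 \<le> w i * w l" using pos il by auto
    have "1 \<le> real i * real l" using il
      by (metis One_nat_def atLeastAtMost_iff mult_le_mono nat_mult_1 of_nat_1 of_nat_le_iff of_nat_mult)
    then have sq: "h \<le> h * sqrt (real i * real l)" using h by simp
    have "- (2 / h) * (?e i + ?e l) \<le> - (2 / (h * sqrt (real i * real l))) * (?e i + ?e l)"
      using sq h by (intro mult_right_mono) (auto intro!: divide_left_mono mult_pos_pos)
    also have "\<dots> = - 2 * (?e i + ?e l) / (h * sqrt (real i * real l))" by simp
    also have "\<dots> \<le> dLam ?e i l / (h * sqrt (real i * real l))"
      using sq h by (intro divide_right_mono) (auto simp: dLam_def max_def)
    finally have "- (2 / h) * (?e i + ?e l) * (w i * w l) \<le> dLam ?e i l / (h * sqrt (real i * real l)) * (w i * w l)"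
      using w by (rule mult_right_mono)
    then show ?thesis using True by (simp only: mult.assoc if_True)
  next
    case False
    have "0 \<le> w i * w l" using pos il by auto
    then show ?thesis using False h by simp
  qed
  have em: "(\<Sum>i\<in>{1..K}. ?e i * w i) = w m"
    using m by (simp add: sum.delta if_distrib[of "\<lambda>x. x * _"] cong: if_cong)
  have "(\<Sum>i\<in>{1..K}. \<Sum>l\<in>{1..K}. (?e i + ?e l) * (w i * w l))
      = (\<Sum>i\<in>{1..K}. \<Sum>l\<in>{1..K}. (?e i * w i) * w l) + (\<Sum>i\<in>{1..K}. \<Sum>l\<in>{1..K}. w i * (?e l * w l))"
    unfolding sum.distrib[symmetric] by (intro sum.cong) (auto simp: algebra_simps)
  also have "\<dots> = 2 * (w m * ?s)"
    unfolding sum_product[symmetric] em by simp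
  finally have e1: "(\<Sum>i\<in>{1..K}. \<Sum>l\<in>{1..K}. - (2/h) * ((?e i + ?e l) * (w i * w l))) = - (4/h) * (w m * ?s)"
    unfolding sum_distrib_left[symmetric] by simp
  have "- (4/h) * (w m * ?s) \<le> (\<Sum>i\<in>{1..K}. \<Sum>l\<in>{1..K}.
      if i + l \<le> K then dLam ?e i l / (h * sqrt (real i * real l)) * (w i * w l) else 0)"
    unfolding e1[symmetric] by (intro sum_mono t1)
  moreover have "- (4/h) * (w m * Mb) \<le> - (4/h) * (w m * ?s)"
    using h pos[OF m] mass by (simp add: divide_right_mono mult_left_mono)
  moreover have "(\<Sum>i\<in>{1..K}. h * trapezoid_L0 ?e i / sqrt (real i * h) * w i) \<le> w m * sqrt (real K * h)"
  proof -
    have "(\<Sum>i\<in>{1..K}. h * trapezoid_L0 ?e i / sqrt (real i * h) * w i)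
        \<le> (\<Sum>i\<in>{1..K}. sqrt (real K * h) * (?e i * w i))"
    proof (rule sum_mono)
      fix i assume i: "i \<in> {1..K}"
      have "trapezoid_L0 ?e i \<le> real i * ?e i"
        unfolding trapezoid_L0_def using m sum_nonneg[of "{..<i}" "\<lambda>l. ?e l + ?e (Suc l)"] by auto
      then have "h * trapezoid_L0 ?e i / sqrt (real i * h) \<le> h * (real i * ?e i) / sqrt (real i * h)"
        using h i by (intro divide_right_mono mult_left_mono) auto
      also have "\<dots> = (real i * h) / sqrt (real i * h) * ?e i" by simp
      also have "(real i * h) / sqrt (real i * h) = sqrt (real i * h)"
        using h by (simp add: real_div_sqrt)
      also have "sqrt (real i * h) * ?e i \<le> sqrt (real K * h) * ?e i"
        using h i by (intro mult_right_mono) auto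
      finally show "h * trapezoid_L0 ?e i / sqrt (real i * h) * w i \<le> sqrt (real K * h) * (?e i * w i)"
        using pos i by (metis atLeastAtMost_iff mult.assoc mult_right_mono)
    qed
    also have "\<dots> = w m * sqrt (real K * h)" unfolding sum_distrib_left[symmetric] em by simp
    finally show ?thesis .
  qed
  ultimately show ?thesis unfolding dQ_def by (simp add: algebra_simps)
qed

text \<open>The condition on \<delta> is a stability condition of CFL type: within one step no site
  can lose more than it holds.\<close>

lemma estep_nonneg:
  assumes "\<delta> * (4 * Mb / h + sqrt (real K * h)) \<le> 1" "1 \<le> m" "m \<le> K"
  shows "0 \<le> estep \<delta> h K w m"
proof -
  have "0 \<le> w m * (1 - \<delta> * (4 * Mb / h + sqrt (real K * h)))"
    using assms pos by simp
  also have "\<dots> = w m + \<delta> * (- (w m * (4 * Mb / h + sqrt (real K * h))))" by (simp add: algebra_simps)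
  also have "\<dots> \<le> estep \<delta> h K w m"
    unfolding estep_def using d loss_rate[OF assms(2,3)] by (intro add_left_mono mult_left_mono)
  finally show ?thesis .
qed

text \<open>Since \<open>max i l\<close> is positive, the quadratic part never removes mass from the
  origin. The linear part removes it at rate at most \<open>sqrt (i * h)\<close>, which is bounded
  by \<open>1 + i * h\<close>.\<close>

lemma atom_loss:
  "- ((\<Sum>i\<in>{1..K}. w i) + (\<Sum>i\<in>{1..K}. real i * h * w i)) \<le> dQ h K (\<lambda>i. if i = 0 then 1 else 0) w"
proof -
  let ?e = "\<lambda>i. if i = 0 then 1 else (0::real)"
  have 1: "0 \<le> (\<Sum>i\<in>{1..K}. \<Sum>l\<in>{1..K}.
      if i + l \<le> K then dLam ?e i l / (h * sqrt (real i * real l)) * (w i * w l) else 0)"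
  proof (intro sum_nonneg)
    fix i l assume il: "i \<in> {1..K}" "l \<in> {1..K}"
    then have "0 \<le> dLam ?e i l" by (auto simp: dLam_def max_def)
    then show "0 \<le> (if i + l \<le> K then dLam ?e i l / (h * sqrt (real i * real l)) * (w i * w l) else 0)"
      using pos il h by auto
  qed
  have "(\<Sum>i\<in>{1..K}. h * trapezoid_L0 ?e i / sqrt (real i * h) * w i) \<le> (\<Sum>i\<in>{1..K}. sqrt (real i * h) * w i)"
  proof (intro sum_mono mult_right_mono)
    fix i assume i: "i \<in> {1..K}"
    have "trapezoid_L0 ?e i \<le> real i"
      unfolding trapezoid_L0_def using i sum_nonneg[of "{..<i}" "\<lambda>l. ?e l + ?e (Suc l)"] by auto
    then have "h * trapezoid_L0 ?e i / sqrt (real i * h) \<le> (real i * h) / sqrt (real i * h)"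
      using h i by (intro divide_right_mono) (auto simp: mult.commute)
    also have "\<dots> = sqrt (real i * h)" using h by (simp add: real_div_sqrt)
    finally show "h * trapezoid_L0 ?e i / sqrt (real i * h) \<le> sqrt (real i * h)" .
  qed (use pos in auto)
  with 1 sum_sqrt_le' show ?thesis unfolding dQ_def by linarith
qed

text \<open>The tails of the first moment are controlled with the convex test function
  \<open>(x - R)\<^sub>+\<close>, for which only the quadratic part can contribute positively.\<close>

lemma tail_production:
  assumes R: "0 < R"
  shows "dQ h K (\<lambda>i. max 0 (real i * h - R)) w \<le> Mb * (Mb + E) / sqrt (R / 2)"
proof -
  let ?f = "\<lambda>i. max 0 (real i * h - R)"
  have t1: "(if i + l \<le> K then dLam ?f i l / (h * sqrt (real i * real l)) * (w i * w l) else 0)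
      \<le> (1 + real i * h) / sqrt (R / 2) * (w i * w l)"
    if il: "i \<in> {1..K}" "l \<in> {1..K}" for i l
  proof -
    have w: "0 \<le> w i * w l" using pos il by auto
    define x y where "x = real i * h" and "y = real l * h"
    have xy: "0 < x" "0 < y" using il h by (auto simp: x_def y_def)
    have hs: "h * sqrt (real i * real l) = sqrt (x * y)"
      using h by (simp add: x_def y_def real_sqrt_mult algebra_simps)
    have "dLam ?f i l \<le> max 0 (x + y - R) + max 0 (\<bar>x - y\<bar> - R) - 2 * max 0 (max x y - R)"
    proof -
      have "real ((i - l) + (l - i)) * h = \<bar>x - y\<bar>"
        using h by (cases "i \<le> l") (auto simp: x_def y_def of_nat_diff algebra_simps abs_if mult_left_mono)
      moreover have "real (max i l) * h = max x y"
        using h by (auto simp: x_def y_def max_def)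
      ultimately show ?thesis unfolding dLam_def by (simp add: x_def y_def algebra_simps)
    qed
    \<comment> \<open>If \<open>x + y < R\<close>, all three terms vanish. Otherwise going up from
      \<open>max x y\<close> to \<open>x + y\<close> gains at most \<open>min x y\<close>, because
      the slope is at most one, and going down to \<open>\<bar>x - y\<bar>\<close> gains
      nothing.\<close>
    also have "\<dots> \<le> (if R \<le> x + y then min x y else 0)"
      using xy R by (auto simp: max_def min_def abs_if)
    finally have lam: "dLam ?f i l \<le> (if R \<le> x + y then min x y else 0)" .
    have "dLam ?f i l / sqrt (x * y) \<le> (1 + x) / sqrt (R / 2)"
    proof (cases "R \<le> x + y")
      case True
      have "dLam ?f i l / sqrt (x * y) \<le> min x y / sqrt (x * y)"
        using lam True xy by (intro divide_right_mono) auto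
      also have "\<dots> = sqrt (min x y) * sqrt (min x y) / (sqrt (min x y) * sqrt (max x y))"
        using xy by (auto simp: min_def max_def real_sqrt_mult)
      also have "\<dots> = sqrt (min x y) / sqrt (max x y)"
        using xy by (intro mult_divide_mult_cancel_left) (auto simp: min_def)
      \<comment> \<open>The larger argument is at least \<open>R / 2\<close>, because the sum is at
        least \<open>R\<close>. This is the source of the decay in \<open>R\<close>.\<close>
      also have "\<dots> \<le> (1 + x) / sqrt (R / 2)"
      proof (rule frac_le)
        have "sqrt (min x y) \<le> sqrt x" by simp
        then show "sqrt (min x y) \<le> 1 + x" using sqrt_le_one_plus[of x] xy by linarith
        show "sqrt (R / 2) \<le> sqrt (max x y)" using True by simp
      qed (use xy R in auto)
      finally show ?thesis .
    next
      case False
      then have "dLam ?f i l / sqrt (x * y) \<le> 0" using lam xy by (simp add: divide_nonpos_pos)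
      also have "0 \<le> (1 + x) / sqrt (R / 2)" using xy R by simp
      finally show ?thesis .
    qed
    then have "dLam ?f i l / sqrt (x * y) * (w i * w l) \<le> (1 + x) / sqrt (R / 2) * (w i * w l)"
      using w by (rule mult_right_mono)
    moreover have "0 \<le> (1 + x) / sqrt (R / 2) * (w i * w l)" using xy R w by simp
    ultimately show ?thesis by (simp add: hs x_def)
  qed
  have "(\<Sum>i\<in>{1..K}. \<Sum>l\<in>{1..K}. if i + l \<le> K then dLam ?f i l / (h * sqrt (real i * real l)) * (w i * w l) else 0)
     \<le> (\<Sum>i\<in>{1..K}. \<Sum>l\<in>{1..K}. (1 + real i * h) / sqrt (R / 2) * (w i * w l))"
    by (intro sum_mono t1)
  also have "\<dots> = (\<Sum>i\<in>{1..K}. (1 + real i * h) * w i) * (\<Sum>l\<in>{1..K}. w l) / sqrt (R / 2)"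
    unfolding sum_product sum_divide_distrib by (intro sum.cong) auto
  also have "(\<Sum>i\<in>{1..K}. (1 + real i * h) * w i) = (\<Sum>i\<in>{1..K}. w i) + (\<Sum>i\<in>{1..K}. real i * h * w i)"
    by (simp add: distrib_right sum.distrib)
  also have "((\<Sum>i\<in>{1..K}. w i) + (\<Sum>i\<in>{1..K}. real i * h * w i)) * (\<Sum>l\<in>{1..K}. w l) / sqrt (R / 2)
      \<le> (Mb + E) * Mb / sqrt (R / 2)"
    using R mass en sum_mass_ge0 sum_energy_ge0 by (intro divide_right_mono mult_mono) auto
  finally have q2: "(\<Sum>i\<in>{1..K}. \<Sum>l\<in>{1..K}. if i + l \<le> K then dLam ?f i l / (h * sqrt (real i * real l)) * (w i * w l) else 0)
      \<le> Mb * (Mb + E) / sqrt (R / 2)" by (simp add: mult.commute)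
  have "0 \<le> (\<Sum>i\<in>{1..K}. h * trapezoid_L0 ?f i / sqrt (real i * h) * w i)"
  proof (intro sum_nonneg mult_nonneg_nonneg divide_nonneg_nonneg)
    fix i assume "i \<in> {1..K}"
    have "(\<Sum>l<i. ?f l + ?f (Suc l)) = (\<Sum>l<i. ?f l) + (\<Sum>l<i. ?f (Suc l))" by (rule sum.distrib)
    \<comment> \<open>The second sum is reversed so that \<open>l\<close> is paired with
      \<open>i - l\<close>. Convexity then gives \<open>f l + f (i - l) \<le> f 0 + f i\<close>,
      which is the sign of the linear part.\<close>
    also have "(\<Sum>l<i. ?f (Suc l)) = (\<Sum>l<i. ?f (i - l))"
      by (subst sum.nat_diff_reindex[symmetric]) (auto intro!: sum.cong simp: Suc_diff_Suc)
    also have "(\<Sum>l<i. ?f l) + (\<Sum>l<i. ?f (i - l)) = (\<Sum>l<i. ?f l + ?f (i - l))" by (rule sum.distrib[symmetric])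
    also have "\<dots> \<le> (\<Sum>l<i. ?f 0 + ?f i)"
    proof (rule sum_mono)
      fix l assume "l \<in> {..<i}"
      then have "real (i - l) * h = real i * h - real l * h" "0 \<le> real l * h" "real l * h \<le> real i * h"
        using h by (auto simp: of_nat_diff algebra_simps)
      then show "?f l + ?f (i - l) \<le> ?f 0 + ?f i" using R by (auto simp: max_def)
    qed
    finally show "0 \<le> trapezoid_L0 ?f i" by (simp add: trapezoid_L0_def)
  qed (use pos h in auto)
  with q2 show ?thesis unfolding dQ_def by linarith
qed

lemma dLam_eq: "dLam (\<lambda>i. \<phi> (real i * h)) i l = Lam \<phi> (real i * h) (real l * h)"
proof -
  have "real ((i - l) + (l - i)) * h = \<bar>real i * h - real l * h\<bar>"
    using h by (cases "i \<le> l") (auto simp: of_nat_diff algebra_simps abs_if mult_left_mono)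
  moreover have "real (max i l) * h = max (real i * h) (real l * h)"
    using h by (auto simp: max_def)
  ultimately show ?thesis unfolding dLam_def Lam_def by (simp add: distrib_right)
qed

lemma dLam_kap:
  assumes "1 \<le> i" "1 \<le> l"
  shows "dLam (\<lambda>i. \<phi> (real i * h)) i l / (h * sqrt (real i * real l)) = kap \<phi> (real i * h) (real l * h)"
proof -
  have "h * sqrt (real i * real l) = sqrt ((real i * h) * (real l * h))"
    using h by (simp add: real_sqrt_mult algebra_simps)
  then show ?thesis unfolding dLam_eq using assms h by (simp add: kap_def)
qed

text \<open>There are two sources of error. Suppressed collisions satisfy
  \<open>1 \<le> (x + y) / (K * h)\<close>, so the energy pays for them, as in Chebyshev's
  inequality; the linear part contributes the trapezoidal error, divided by
  \<open>sqrt x\<close>.\<close>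

lemma dQ_consistent:
  assumes a: "adm L C \<phi>" and K: "0 < K"
  shows "\<bar>dQ h K (\<lambda>i. \<phi> (real i * h)) w
     - ((\<Sum>i\<in>{1..K}. \<Sum>l\<in>{1..K}. kap \<phi> (real i * h) (real l * h) * (w i * w l))
        - (\<Sum>i\<in>{1..K}. psi \<phi> (real i * h) * w i))\<bar> \<le> 4 * L * Mb * E / (real K * h) + 2 * L * h * (Mb + E)"
proof -
  note L = admD(2)[OF a]
  let ?f = "\<lambda>i. \<phi> (real i * h)"
  have "\<bar>(\<Sum>i\<in>{1..K}. \<Sum>l\<in>{1..K}. if i + l \<le> K then dLam ?f i l / (h * sqrt (real i * real l)) * (w i * w l) else 0)
     - (\<Sum>i\<in>{1..K}. \<Sum>l\<in>{1..K}. kap \<phi> (real i * h) (real l * h) * (w i * w l))\<bar>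
     \<le> (\<Sum>i\<in>{1..K}. \<Sum>l\<in>{1..K}. 2 * L / (real K * h) * ((real i * h + real l * h) * (w i * w l)))"
    unfolding sum_subtractf[symmetric]
  proof (intro order_trans[OF sum_abs] sum_mono)
    fix i l assume il: "i \<in> {1..K}" "l \<in> {1..K}"
    have w: "0 \<le> w i * w l" using pos il by auto
    show "\<bar>(if i + l \<le> K then dLam ?f i l / (h * sqrt (real i * real l)) * (w i * w l) else 0)
       - kap \<phi> (real i * h) (real l * h) * (w i * w l)\<bar> \<le> 2 * L / (real K * h) * ((real i * h + real l * h) * (w i * w l))"
    proof (cases "i + l \<le> K")
      case True
      then show ?thesis using il dLam_kap[of i l \<phi>] w h L by simp
    next
      case False
      have "\<bar>kap \<phi> (real i * h) (real l * h)\<bar> \<le> 2 * L * 1" using kap_le[OF a] by simp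
      also have "\<dots> \<le> 2 * L * ((real i * h + real l * h) / (real K * h))"
      proof (intro mult_left_mono)
        have "real K \<le> real i + real l" using False by linarith
        then have "real K * h \<le> (real i + real l) * h" using h by (intro mult_right_mono) auto
        then show "1 \<le> (real i * h + real l * h) / (real K * h)"
          using h K by (simp add: distrib_right)
      qed (use L in auto)
      finally have "\<bar>kap \<phi> (real i * h) (real l * h)\<bar> * (w i * w l)
          \<le> 2 * L * ((real i * h + real l * h) / (real K * h)) * (w i * w l)"
        using w by (rule mult_right_mono)
      also have "\<dots> = 2 * L / (real K * h) * ((real i * h + real l * h) * (w i * w l))" by simp
      finally show ?thesis
        using False by (simp add: abs_mult[of _ "w i * w l"] abs_of_nonneg[OF w] del: abs_mult)
    qed
  qed
  also have "\<dots> = 2 * L / (real K * h) * ((\<Sum>i\<in>{1..K}. \<Sum>l\<in>{1..K}. (real i * h * w i) * w l)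
      + (\<Sum>i\<in>{1..K}. \<Sum>l\<in>{1..K}. w i * (real l * h * w l)))"
  proof -
    have "(\<Sum>i\<in>{1..K}. \<Sum>l\<in>{1..K}. 2 * L / (real K * h) * ((real i * h + real l * h) * (w i * w l)))
      = (\<Sum>i\<in>{1..K}. \<Sum>l\<in>{1..K}. 2 * L / (real K * h) * ((real i * h * w i) * w l + w i * (real l * h * w l)))"
      by (intro sum.cong refl arg_cong2[where f="(*)"]) (simp add: algebra_simps)
    then show ?thesis by (simp only: sum_distrib_left[symmetric] sum.distrib)
  qed
  also have "\<dots> = 4 * L / (real K * h) * ((\<Sum>i\<in>{1..K}. w i) * (\<Sum>i\<in>{1..K}. real i * h * w i))"
    unfolding sum_product[symmetric] by (simp add: mult.commute)
  also have "\<dots> \<le> 4 * L / (real K * h) * (Mb * E)"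
    using L h mass en sum_mass_ge0 sum_energy_ge0 by (intro mult_left_mono mult_mono) auto
  finally have 1: "\<bar>(\<Sum>i\<in>{1..K}. \<Sum>l\<in>{1..K}. if i + l \<le> K then dLam ?f i l / (h * sqrt (real i * real l)) * (w i * w l) else 0)
     - (\<Sum>i\<in>{1..K}. \<Sum>l\<in>{1..K}. kap \<phi> (real i * h) (real l * h) * (w i * w l))\<bar> \<le> 4 * L * Mb * E / (real K * h)"
    by simp
  have "\<bar>(\<Sum>i\<in>{1..K}. h * trapezoid_L0 ?f i / sqrt (real i * h) * w i) - (\<Sum>i\<in>{1..K}. psi \<phi> (real i * h) * w i)\<bar>
     \<le> (\<Sum>i\<in>{1..K}. 2 * L * h * (sqrt (real i * h) * w i))"
    unfolding sum_subtractf[symmetric]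
  proof (intro order_trans[OF sum_abs] sum_mono)
    fix i assume i: "i \<in> {1..K}"
    have x: "0 < real i * h" using i h by simp
    have "\<bar>h * trapezoid_L0 ?f i / sqrt (real i * h) - psi \<phi> (real i * h)\<bar>
        = \<bar>h * trapezoid_L0 ?f i - L0 \<phi> (real i * h)\<bar> / sqrt (real i * h)"
      using x by (simp add: psi_def abs_divide flip: diff_divide_distrib)
    also have "\<dots> \<le> 2 * L * h * (real i * h) / sqrt (real i * h)"
      using trapezoid_L0_error[OF a h, of i] x by (intro divide_right_mono) auto
    also have "\<dots> = 2 * L * h * sqrt (real i * h)"
      using x by (metis less_eq_real_def real_div_sqrt times_divide_eq_right)
    finally have *: "\<bar>h * trapezoid_L0 ?f i / sqrt (real i * h) - psi \<phi> (real i * h)\<bar> * w i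
       \<le> 2 * L * h * sqrt (real i * h) * w i" using pos i by (intro mult_right_mono) auto
    show "\<bar>h * trapezoid_L0 ?f i / sqrt (real i * h) * w i - psi \<phi> (real i * h) * w i\<bar>
       \<le> 2 * L * h * (sqrt (real i * h) * w i)"
    proof -
      have "h * trapezoid_L0 ?f i / sqrt (real i * h) * w i - psi \<phi> (real i * h) * w i
         = (h * trapezoid_L0 ?f i / sqrt (real i * h) - psi \<phi> (real i * h)) * w i"
        by (rule left_diff_distrib[symmetric])
      then show ?thesis using * pos i by (simp only: abs_mult) (simp add: mult.assoc)
    qed
  qed
  also have "\<dots> \<le> 2 * L * h * (Mb + E)"
    unfolding sum_distrib_left[symmetric] using L h sum_sqrt_le by (intro mult_left_mono) auto
  finally show ?thesis using 1 unfolding dQ_def by linarith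
qed

lemma sum_kap_bound:
  assumes a: "adm L C \<phi>"
  shows "\<bar>(\<Sum>i\<in>{1..K}. \<Sum>l\<in>{1..K}. kap \<phi> (real i * h) (real l * h) * (w i * w l))
        - (\<Sum>i\<in>{1..K}. psi \<phi> (real i * h) * w i)\<bar> \<le> 2 * L * Mb * Mb + C * (Mb + E)"
proof -
  have "\<bar>\<Sum>i\<in>{1..K}. \<Sum>l\<in>{1..K}. kap \<phi> (real i * h) (real l * h) * (w i * w l)\<bar>
      \<le> (\<Sum>i\<in>{1..K}. \<Sum>l\<in>{1..K}. 2 * L * (w i * w l))"
  proof (intro order_trans[OF sum_abs] sum_mono)
    fix i l assume il: "i \<in> {1..K}" "l \<in> {1..K}"
    have w: "0 \<le> w i * w l" using pos il by auto
    show "\<bar>kap \<phi> (real i * h) (real l * h) * (w i * w l)\<bar> \<le> 2 * L * (w i * w l)"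
      unfolding abs_mult[of _ "w i * w l"] abs_of_nonneg[OF w] using kap_le[OF a] w by (intro mult_right_mono)
  qed
  also have "\<dots> = 2 * L * ((\<Sum>i\<in>{1..K}. w i) * (\<Sum>i\<in>{1..K}. w i))"
    by (simp only: sum_distrib_left[symmetric] sum_product)
  also have "\<dots> \<le> 2 * L * (Mb * Mb)"
    using mass sum_mass_ge0 admD(2)[OF a] by (intro mult_left_mono mult_mono) auto
  finally have 1: "\<bar>\<Sum>i\<in>{1..K}. \<Sum>l\<in>{1..K}. kap \<phi> (real i * h) (real l * h) * (w i * w l)\<bar> \<le> 2 * L * Mb * Mb"
    by simp
  have "\<bar>\<Sum>i\<in>{1..K}. psi \<phi> (real i * h) * w i\<bar> \<le> (\<Sum>i\<in>{1..K}. C * (1 + real i * h) * w i)"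
  proof (intro order_trans[OF sum_abs] sum_mono)
    fix i assume i: "i \<in> {1..K}"
    show "\<bar>psi \<phi> (real i * h) * w i\<bar> \<le> C * (1 + real i * h) * w i"
      unfolding abs_mult using psi_le[OF a, of "real i * h"] pos i h by (intro mult_mono) auto
  qed
  also have "\<dots> = C * ((\<Sum>i\<in>{1..K}. w i) + (\<Sum>i\<in>{1..K}. real i * h * w i))"
    unfolding sum.distrib[symmetric] sum_distrib_left by (intro sum.cong) (auto simp: algebra_simps)
  also have "\<dots> \<le> C * (Mb + E)" using mass en admD(3)[OF a] by (intro mult_left_mono) auto
  finally show ?thesis using 1 by linarith
qed

end

section \<open>Iteration of the scheme over a finite stretch of rescaled time\<close>

lemma dpair_atom: "dpair K f w = f 0 * w 0 + (\<Sum>i\<in>{1..K}. f i * w i)"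
  unfolding dpair_def atMost_atLeast0
  by (subst sum.atLeast_Suc_atMost) (auto simp: One_nat_def)

text \<open>\<open>Mb\<close> is the Gronwall bound up to time \<open>T\<close> for the mass on the
  open half-line, and \<open>step\<close> is the stability condition of \<open>estep_nonneg\<close>
  for that bound. The energy is only bounded by \<open>E\<close>, because the initial measure will
  be rounded down to the lattice.\<close>

locale euler =
  fixes h \<delta> T N E Mb :: real and K :: nat and w0 :: "nat \<Rightarrow> real"
  assumes h: "0 < h" and d: "0 < \<delta>" and K: "0 < K"
    and w0: "\<And>i. i \<le> K \<Longrightarrow> 0 \<le> w0 i"
    and N: "dpair K (\<lambda>_. 1) w0 = N" and E: "dpair K (\<lambda>i. real i * h) w0 \<le> E"
    and Mb: "Mb = exp T * (N + E)"
    and step: "\<delta> * (4 * Mb / h + sqrt (real K * h)) \<le> 1"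
begin

definition W :: "nat \<Rightarrow> nat \<Rightarrow> real" where
  "W j = (estep \<delta> h K ^^ j) w0"

lemma W_0: "W 0 = w0" and W_Suc: "W (Suc j) = estep \<delta> h K (W j)"
  by (simp_all add: W_def)

lemma dpair_W_Suc: "dpair K f (W (Suc j)) = dpair K f (W j) + \<delta> * dQ h K f (W j)"
  by (simp add: W_Suc dpair_estep)

lemma mass_W: "dpair K (\<lambda>_. 1) (W j) = N"
  by (induction j) (simp_all add: W_0 N dpair_W_Suc dQ_const)

lemma energy_W: "dpair K (\<lambda>i. real i * h) (W j) = dpair K (\<lambda>i. real i * h) w0"
  by (induction j) (simp_all add: W_0 dpair_W_Suc dQ_id)

lemma energy_W_sum: "(\<Sum>i\<in>{1..K}. real i * h * W j i) = dpair K (\<lambda>i. real i * h) w0"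
  using energy_W[of j] by (simp add: dpair_atom)

lemma energy0_ge0: "0 \<le> dpair K (\<lambda>i. real i * h) w0"
  unfolding dpair_def using w0 h by (intro sum_nonneg) auto

lemma N_ge0: "0 \<le> N"
  unfolding N[symmetric] dpair_def using w0 by (intro sum_nonneg) auto

lemma Suc_bound:
  assumes "real j * \<delta> \<le> T"
  shows "(1 + \<delta>) ^ j * (N + E) \<le> Mb"
proof -
  have "(1 + \<delta>) ^ j \<le> exp \<delta> ^ j" using d exp_ge_add_one_self[of \<delta>] by (intro power_mono) auto
  also have "\<dots> = exp (real j * \<delta>)" by (simp add: exp_of_nat_mult)
  also have "\<dots> \<le> exp T" using assms by simp
  finally show ?thesis unfolding Mb using N_ge0 E energy0_ge0 by (intro mult_right_mono) auto
qed

text \<open>Only the atom can become negative: its loss per unit time is at most \<open>\<Sum>\<surd>x\<close>, which gives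
  exponential growth of the mass on \<open>(0,\<infinity>)\<close> at worst.\<close>

lemma invariant:
  assumes "real j * \<delta> \<le> T"
  shows "(\<forall>i\<in>{1..K}. 0 \<le> W j i) \<and> (\<Sum>i\<in>{1..K}. W j i) + E \<le> (1 + \<delta>) ^ j * (N + E)"
  using assms
proof (induction j)
  case 0
  have "(\<Sum>i\<in>{1..K}. w0 i) \<le> N" using N w0[of 0] by (simp add: dpair_atom)
  then show ?case using w0 by (simp add: W_0)
next
  case (Suc j)
  have "real j * \<delta> \<le> real (Suc j) * \<delta>" using d by (intro mult_right_mono) auto
  then have j: "real j * \<delta> \<le> T" using Suc.prems by linarith
  note IH = Suc.IH[OF j]
  have E0: "0 \<le> E" using E energy0_ge0 by simp
  have pos: "\<And>i. 1 \<le> i \<Longrightarrow> i \<le> K \<Longrightarrow> 0 \<le> W j i" using IH by auto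
  have mass: "(\<Sum>i\<in>{1..K}. W j i) \<le> Mb" using IH Suc_bound[OF j] E0 by linarith
  have en: "(\<Sum>i\<in>{1..K}. real i * h * W j i) \<le> E" using energy_W_sum E by simp
  have d0: "0 \<le> \<delta>" using d by simp
  let ?s = "\<Sum>i\<in>{1..K}. W j i"
  have "N = W (Suc j) 0 + (\<Sum>i\<in>{1..K}. W (Suc j) i)"
    using mass_W[of "Suc j"] by (simp add: dpair_atom)
  moreover have "N = W j 0 + ?s" using mass_W[of j] by (simp add: dpair_atom)
  moreover have "W j 0 - \<delta> * (?s + E) \<le> W (Suc j) 0"
  proof -
    have "- (?s + E) \<le> dQ h K (\<lambda>i. if i = 0 then 1 else 0) (W j)"
      using atom_loss[OF h d0 pos mass en] en by linarith
    from mult_left_mono[OF this d0] show ?thesis by (simp add: W_Suc estep_def algebra_simps)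
  qed
  ultimately have "(\<Sum>i\<in>{1..K}. W (Suc j) i) + E \<le> (?s + E) * (1 + \<delta>)" by (simp add: algebra_simps)
  also have "\<dots> \<le> (1 + \<delta>) ^ j * (N + E) * (1 + \<delta>)" using IH d by (intro mult_right_mono) auto
  finally have "(\<Sum>i\<in>{1..K}. W (Suc j) i) + E \<le> (1 + \<delta>) ^ Suc j * (N + E)" by (simp add: algebra_simps)
  moreover have "\<forall>i\<in>{1..K}. 0 \<le> W (Suc j) i"
    using estep_nonneg[OF h d0 pos mass en step] by (auto simp: W_Suc)
  ultimately show ?case by blast
qed

context
  fixes j :: nat
  assumes j: "real j * \<delta> \<le> T"
begin

lemma W_nonneg: "1 \<le> i \<Longrightarrow> i \<le> K \<Longrightarrow> 0 \<le> W j i"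
  using invariant[OF j] by auto

lemma W_mass: "(\<Sum>i\<in>{1..K}. W j i) \<le> Mb"
  using invariant[OF j] Suc_bound[OF j] E energy0_ge0 by linarith

lemma W_energy: "(\<Sum>i\<in>{1..K}. real i * h * W j i) \<le> E"
  using energy_W_sum E by simp

lemma W_atom: "0 \<le> W j 0 + Mb"
  using mass_W[of j] W_mass N_ge0 by (simp add: dpair_atom)

lemmas W_facts = h less_imp_le[OF d] W_nonneg W_mass W_energy

end

text \<open>The production of tails is summed over the steps. The bound does not depend on the mesh
  and tends to zero for large \<open>R\<close> once the initial tails do, so no energy escapes to
  infinity in the limit.\<close>

lemma W_tail:
  assumes "0 < R" "real j * \<delta> \<le> T"
  shows "dpair K (\<lambda>i. max 0 (real i * h - R)) (W j)
     \<le> dpair K (\<lambda>i. max 0 (real i * h - R)) w0 + real j * \<delta> * (Mb * (Mb + E) / sqrt (R / 2))"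
  using assms(2)
proof (induction j)
  case (Suc j)
  have "real j * \<delta> \<le> real (Suc j) * \<delta>" using d by (intro mult_right_mono) auto
  then have j: "real j * \<delta> \<le> T" using Suc.prems by linarith
  have "\<delta> * dQ h K (\<lambda>i. max 0 (real i * h - R)) (W j) \<le> \<delta> * (Mb * (Mb + E) / sqrt (R / 2))"
    using d by (intro mult_left_mono tail_production[OF W_facts[OF j] assms(1)]) auto
  then show ?case using Suc.IH[OF j] unfolding dpair_W_Suc of_nat_Suc distrib_right by linarith
qed (simp add: W_0)

end

section \<open>Weak convergence and compactness\<close>

text \<open>This is uniform integrability of the first moment with modulus \<eta>. The positive part
  is used instead of a restriction to \<open>\<bar>x\<bar> > R\<close> because it is continuous,
  hence compatible with weak limits, and convex, hence accessible to the scheme.\<close>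

definition tails :: "(real \<Rightarrow> real) \<Rightarrow> real measure \<Rightarrow> bool" where
  "tails \<eta> M \<longleftrightarrow> integrable M (\<lambda>x. x) \<and> (\<forall>R>0. (\<integral>x. max 0 (\<bar>x\<bar> - R) \<partial>M) \<le> \<eta> R)"

lemma isCont_borel_measurable:
  fixes f :: "real \<Rightarrow> real"
  assumes "sets M = sets borel" "\<And>x. isCont f x"
  shows "f \<in> borel_measurable M"
proof -
  have "f \<in> borel_measurable borel"
    using assms(2) by (intro borel_measurable_continuous_onI continuous_at_imp_continuous_on) auto
  then show ?thesis using measurable_cong_sets[OF assms(1) refl] by blast
qed

lemma (in real_distribution) integrable_continuous_bounded:
  fixes f :: "real \<Rightarrow> real"
  assumes "\<And>x. isCont f x" "\<And>x. \<bar>f x\<bar> \<le> B"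
  shows "integrable M f"
  using assms by (intro integrable_const_bound[of _ B] isCont_borel_measurable) auto

text \<open>Skorohod's representation replaces weak convergence by pointwise convergence of random
  variables on one probability space. Two nested applications of dominated convergence then treat
  the double integral, so no weak convergence of product measures enters.\<close>

lemma weak_conv_double_integral:
  fixes F :: "real \<Rightarrow> real \<Rightarrow> real"
  assumes rd: "\<And>n. real_distribution (\<mu> n)" "real_distribution M" and wc: "weak_conv_m \<mu> M"
    and cont: "\<And>p. isCont (\<lambda>p. F (fst p) (snd p)) p" and bd: "\<And>x y. \<bar>F x y\<bar> \<le> B"
  shows "(\<lambda>n. \<integral>x. \<integral>y. F x y \<partial>\<mu> n \<partial>\<mu> n) \<longlonglongrightarrow> (\<integral>x. \<integral>y. F x y \<partial>M \<partial>M)"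
proof -
  obtain \<Omega> Y Z where
    ps: "prob_space \<Omega>" and Y: "\<And>n. Y n \<in> measurable \<Omega> borel" "\<And>n. distr \<Omega> borel (Y n) = \<mu> n"
    and Z: "Z \<in> measurable \<Omega> lborel" "distr \<Omega> borel Z = M"
    and lim: "\<And>x::real. x \<in> space \<Omega> \<Longrightarrow> (\<lambda>n. Y n x) \<longlonglongrightarrow> Z x"
    using Skorohod[OF rd wc] by blast
  interpret prob_space \<Omega> by fact
  have Z': "Z \<in> borel_measurable \<Omega>" using Z(1) by simp
  have B0: "0 \<le> B" using bd[of 0 0] by auto
  have Fm: "(\<lambda>p. F (fst p) (snd p)) \<in> borel_measurable borel"
    using cont by (intro borel_measurable_continuous_onI continuous_at_imp_continuous_on) auto
  have Fm': "(\<lambda>z. F (f z) (g z)) \<in> borel_measurable N"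
    if "f \<in> borel_measurable N" "g \<in> borel_measurable N" for f g and N :: "'x measure"
  proof -
    have "(\<lambda>z. (f z, g z)) \<in> borel_measurable N"
      using that by (simp add: borel_prod[symmetric])
    from measurable_compose[OF this Fm] show ?thesis by simp
  qed
  have eq: "(\<integral>x. \<integral>y. F x y \<partial>D \<partial>D) = (\<integral>\<omega>. \<integral>\<omega>'. F (X \<omega>) (X \<omega>') \<partial>\<Omega> \<partial>\<Omega>)"
    if X: "X \<in> borel_measurable \<Omega>" and D: "distr \<Omega> borel X = D" for X D
  proof -
    have inner: "(\<integral>y. F x y \<partial>D) = (\<integral>\<omega>'. F x (X \<omega>') \<partial>\<Omega>)" for x
      unfolding D[symmetric] by (rule integral_distr[OF X]) (auto intro!: Fm')
    have "(\<lambda>x. \<integral>\<omega>'. F x (X \<omega>') \<partial>\<Omega>) \<in> borel_measurable borel"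
      by (rule borel_measurable_lebesgue_integral)
        (unfold case_prod_beta, intro Fm' measurable_compose[OF measurable_snd X] measurable_fst)
    then have "(\<integral>x. (\<integral>\<omega>'. F x (X \<omega>') \<partial>\<Omega>) \<partial>D) = (\<integral>\<omega>. \<integral>\<omega>'. F (X \<omega>) (X \<omega>') \<partial>\<Omega> \<partial>\<Omega>)"
      unfolding D[symmetric] by (rule integral_distr[OF X])
    then show ?thesis by (simp only: inner)
  qed
  have tend: "(\<lambda>n. F (Y n a) (Y n b)) \<longlonglongrightarrow> F (Z a) (Z b)" if "a \<in> space \<Omega>" "b \<in> space \<Omega>" for a b
    using isCont_tendsto_compose[OF cont[of "(Z a, Z b)"] tendsto_Pair[OF lim[OF that(1)] lim[OF that(2)]]]
    by simp
  have "(\<lambda>n. \<integral>a. \<integral>b. F (Y n a) (Y n b) \<partial>\<Omega> \<partial>\<Omega>) \<longlonglongrightarrow> (\<integral>a. \<integral>b. F (Z a) (Z b) \<partial>\<Omega> \<partial>\<Omega>)"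
  proof (rule integral_dominated_convergence[where w="\<lambda>_. B"])
    have m: "(\<lambda>a. \<integral>b. F (X a) (X b) \<partial>\<Omega>) \<in> borel_measurable \<Omega>" if "X \<in> borel_measurable \<Omega>" for X
      by (rule borel_measurable_lebesgue_integral)
        (unfold case_prod_beta, intro Fm' measurable_compose[OF measurable_snd that] measurable_compose[OF measurable_fst that])
    show "(\<lambda>a. \<integral>b. F (Z a) (Z b) \<partial>\<Omega>) \<in> borel_measurable \<Omega>" by (rule m[OF Z'])
    show "(\<lambda>a. \<integral>b. F (Y n a) (Y n b) \<partial>\<Omega>) \<in> borel_measurable \<Omega>" for n by (rule m[OF Y(1)])
    show "AE a in \<Omega>. (\<lambda>n. \<integral>b. F (Y n a) (Y n b) \<partial>\<Omega>) \<longlonglongrightarrow> (\<integral>b. F (Z a) (Z b) \<partial>\<Omega>)"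
    proof (rule AE_I2)
      fix a assume a: "a \<in> space \<Omega>"
      show "(\<lambda>n. \<integral>b. F (Y n a) (Y n b) \<partial>\<Omega>) \<longlonglongrightarrow> (\<integral>b. F (Z a) (Z b) \<partial>\<Omega>)"
        by (rule integral_dominated_convergence[where w="\<lambda>_. B"])
          (auto intro!: Fm' Y Z' tend a bd)
    qed
    show "AE a in \<Omega>. norm (\<integral>b. F (Y n a) (Y n b) \<partial>\<Omega>) \<le> B" for n
    proof (rule AE_I2)
      fix a
      have "norm (\<integral>b. F (Y n a) (Y n b) \<partial>\<Omega>) \<le> (\<integral>b. B \<partial>\<Omega>)"
        by (rule Bochner_Integration.integral_norm_bound_integral[OF integrable_const_bound[where B=B]])
          (auto intro!: Fm' Y bd)
      then show "norm (\<integral>b. F (Y n a) (Y n b) \<partial>\<Omega>) \<le> B" by (simp add: prob_space)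
    qed
  qed auto
  then show ?thesis using eq[OF Y] eq[OF Z' Z(2)] by simp
qed

text \<open>The integrand is cut off at height \<open>S\<close>, where weak convergence applies;
  monotone convergence in \<open>S\<close> then removes the cut-off. Integrability of the limit is
  part of what is gained.\<close>

lemma tails_weak_limit:
  assumes rd: "\<And>n. real_distribution (\<mu> n)" "real_distribution M" and wc: "weak_conv_m \<mu> M"
    and t: "\<And>n. tails \<eta> (\<mu> n)"
  shows "tails \<eta> M"
proof -
  interpret M: real_distribution M by fact
  interpret \<mu>: real_distribution "\<mu> n" for n by fact
  have le: "(\<integral>\<^sup>+x. ennreal (max 0 (\<bar>x\<bar> - R)) \<partial>M) \<le> ennreal (\<eta> R)" if R: "0 < R" for R
  proof -
    have "(\<integral>\<^sup>+x. ennreal (min (max 0 (\<bar>x\<bar> - R)) (real S)) \<partial>M) \<le> ennreal (\<eta> R)" for S :: nat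
    proof -
      let ?f = "\<lambda>x::real. min (max 0 (\<bar>x\<bar> - R)) (real S)"
      have c: "isCont ?f x" and b: "\<bar>?f x\<bar> \<le> real S" for x by (auto intro!: continuous_intros)
      have "(\<lambda>n. integral\<^sup>L (\<mu> n) ?f) \<longlonglongrightarrow> integral\<^sup>L M ?f"
        using weak_conv_imp_integral_bdd_continuous_conv[OF rd wc, of ?f "real S"] c b by auto
      moreover have "integral\<^sup>L (\<mu> n) ?f \<le> \<eta> R" for n
      proof -
        have i: "integrable (\<mu> n) (\<lambda>x. max 0 (\<bar>x\<bar> - R))"
          using t[of n] unfolding tails_def by auto
        have "integral\<^sup>L (\<mu> n) ?f \<le> (\<integral>x. max 0 (\<bar>x\<bar> - R) \<partial>\<mu> n)"
          by (rule integral_mono[OF \<mu>.integrable_continuous_bounded[OF c b] i]) auto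
        also have "\<dots> \<le> \<eta> R" using t[of n] R unfolding tails_def by auto
        finally show ?thesis .
      qed
      ultimately have "integral\<^sup>L M ?f \<le> \<eta> R" by (intro LIMSEQ_le_const2) auto
      then show ?thesis
        using nn_integral_eq_integral[OF M.integrable_continuous_bounded[OF c b]] by (simp add: ennreal_leI)
    qed
    then have "(SUP S. \<integral>\<^sup>+x. ennreal (min (max 0 (\<bar>x\<bar> - R)) (real S)) \<partial>M) \<le> ennreal (\<eta> R)"
      by (rule SUP_least)
    also have "(SUP S. \<integral>\<^sup>+x. ennreal (min (max 0 (\<bar>x\<bar> - R)) (real S)) \<partial>M)
        = (\<integral>\<^sup>+x. (SUP S. ennreal (min (max 0 (\<bar>x\<bar> - R)) (real S))) \<partial>M)"
      by (rule nn_integral_monotone_convergence_SUP[symmetric])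
        (auto simp: incseq_def le_fun_def intro!: ennreal_leI min.mono)
    also have "\<dots> = (\<integral>\<^sup>+x. ennreal (max 0 (\<bar>x\<bar> - R)) \<partial>M)"
    proof (rule nn_integral_cong)
      fix x
      obtain S0 :: nat where "max 0 (\<bar>x\<bar> - R) \<le> real S0" using real_arch_simple by blast
      then have "ennreal (max 0 (\<bar>x\<bar> - R)) = ennreal (min (max 0 (\<bar>x\<bar> - R)) (real S0))" by simp
      also have "\<dots> \<le> (SUP S. ennreal (min (max 0 (\<bar>x\<bar> - R)) (real S)))" by (rule SUP_upper) simp
      finally show "(SUP S. ennreal (min (max 0 (\<bar>x\<bar> - R)) (real S))) = ennreal (max 0 (\<bar>x\<bar> - R))"
        by (intro antisym SUP_least ennreal_leI) auto
    qed
    finally show ?thesis .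
  qed
  have int: "integrable M (\<lambda>x. max 0 (\<bar>x\<bar> - R))" if "0 < R" for R
    using le[OF that] by (intro integrableI_nonneg) (auto simp: less_top[symmetric] top_unique)
  have "integrable M (\<lambda>x. 1 + max 0 (\<bar>x\<bar> - 1))" using int[of 1] by auto
  then have "integrable M (\<lambda>x. x)" by (rule Bochner_Integration.integrable_bound) auto
  moreover have "(\<integral>x. max 0 (\<bar>x\<bar> - R) \<partial>M) \<le> \<eta> R" if "0 < R" for R
  proof -
    have "0 \<le> (\<integral>x. max 0 (\<bar>x\<bar> - R) \<partial>\<mu> 0)" by (intro Bochner_Integration.integral_nonneg) auto
    also have "\<dots> \<le> \<eta> R" using t[of 0] that by (auto simp: tails_def)
    finally have "0 \<le> \<eta> R" .
    then show ?thesis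
      using le[OF that] nn_integral_eq_integral[OF int[OF that]] by simp
  qed
  ultimately show ?thesis unfolding tails_def by blast
qed

lemma tails_integrable:
  assumes rd: "real_distribution M" and t: "tails \<eta> M"
    and c: "\<And>x. isCont f x" and b: "\<And>x. \<bar>f x\<bar> \<le> C * (1 + \<bar>x::real\<bar>)"
  shows "integrable M (f :: real \<Rightarrow> real)"
proof -
  interpret M: real_distribution M by fact
  have "integrable M (\<lambda>x. C * (1 + \<bar>x\<bar>))" using t unfolding tails_def by auto
  then show ?thesis
  proof (rule Bochner_Integration.integrable_bound)
    show "f \<in> borel_measurable M"
      using c by (intro isCont_borel_measurable) auto
    show "AE x in M. norm (f x) \<le> norm (C * (1 + \<bar>x\<bar>))"
      using order_trans[OF b abs_ge_self] by (intro AE_I2) simp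
  qed
qed

lemma tails_truncation:
  assumes rd: "real_distribution M" and t: "tails \<eta> M"
    and c: "\<And>x. isCont f x" and b: "\<And>x. \<bar>f x\<bar> \<le> C * (1 + \<bar>x::real\<bar>)" and R: "1 \<le> R"
  shows "\<bar>(\<integral>x. f x \<partial>M) - (\<integral>x. f (max (-R) (min R x)) \<partial>M)\<bar> \<le> 8 * C * \<eta> (R / 2)"
proof -
  interpret M: real_distribution M by fact
  have C0: "0 \<le> C" using b[of 0] by auto
  have c': "isCont (\<lambda>x. f (max (-R) (min R x))) x" for x
    by (rule isCont_o2[OF _ c]) (auto intro!: continuous_intros)
  have b': "\<bar>f (max (-R) (min R x))\<bar> \<le> C * (1 + R)" for x
    by (rule order_trans[OF b]) (use R C0 in \<open>auto intro!: mult_left_mono\<close>)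
  have int: "integrable M f" by (rule tails_integrable[OF rd t c b])
  have int': "integrable M (\<lambda>x. f (max (-R) (min R x)))"
    by (rule M.integrable_continuous_bounded[OF c' b'])
  have "integrable M (\<lambda>x. max 0 (\<bar>x\<bar> - R/2))" using t unfolding tails_def by auto
  then have i8: "integrable M (\<lambda>x. 8 * C * max 0 (\<bar>x\<bar> - R/2))" by auto
  have "\<bar>(\<integral>x. f x \<partial>M) - (\<integral>x. f (max (-R) (min R x)) \<partial>M)\<bar>
      = norm (\<integral>x. f x - f (max (-R) (min R x)) \<partial>M)"
    using int int' by simp
  also have "\<dots> \<le> (\<integral>x. 8 * C * max 0 (\<bar>x\<bar> - R/2) \<partial>M)"
  proof (rule Bochner_Integration.integral_norm_bound_integral[OF _ i8])
    fix x
    show "norm (f x - f (max (-R) (min R x))) \<le> 8 * C * max 0 (\<bar>x\<bar> - R/2)"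
    proof (cases "\<bar>x\<bar> \<le> R")
      case True
      then have "max (-R) (min R x) = x" by auto
      then show ?thesis using C0 by simp
    next
      case False
      have "\<bar>f x - f (max (-R) (min R x))\<bar> \<le> C * (1 + \<bar>x\<bar>) + C * (1 + R)"
        using b[of x] b'[of x] by linarith
      also have "\<dots> = C * (2 + \<bar>x\<bar> + R)" by (simp add: algebra_simps)
      \<comment> \<open>Here \<open>\<bar>x\<bar> > R\<close> and \<open>R \<ge> 1\<close>, so
        \<open>2 + \<bar>x\<bar> + R \<le> \<bar>x\<bar> + 3 * R \<le> 8 * (\<bar>x\<bar> - R /
        2)\<close>. The threshold \<open>R / 2\<close> keeps the right-hand side comparable with
        \<open>\<bar>x\<bar>\<close>.\<close>
      also have "\<dots> \<le> C * (8 * max 0 (\<bar>x\<bar> - R/2))"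
        using False R C0 by (intro mult_left_mono) auto
      finally show ?thesis by (simp add: algebra_simps)
    qed
  qed (use int int' in auto)
  also have "\<dots> = 8 * C * (\<integral>x. max 0 (\<bar>x\<bar> - R/2) \<partial>M)" by simp
  also have "\<dots> \<le> 8 * C * \<eta> (R/2)"
    using t R C0 unfolding tails_def by (intro mult_left_mono) auto
  finally show ?thesis .
qed

text \<open>Clipping the argument at \<open>R\<close> makes the integrand bounded, and
  \<open>tails_truncation\<close> makes the error small uniformly in \<open>n\<close> and for the
  limit as well.\<close>

lemma weak_conv_integral_linear_growth:
  assumes rd: "\<And>n. real_distribution (\<mu> n)" "real_distribution M" and wc: "weak_conv_m \<mu> M"
    and t: "\<And>n. tails \<eta> (\<mu> n)" and \<eta>: "(\<eta> \<longlongrightarrow> 0) at_top"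
    and c: "\<And>x. isCont f x" and b: "\<And>x. \<bar>f x\<bar> \<le> C * (1 + \<bar>x::real\<bar>)"
  shows "(\<lambda>n. \<integral>x. f x \<partial>\<mu> n) \<longlonglongrightarrow> (\<integral>x. f x \<partial>M :: real)"
proof (rule LIMSEQ_I)
  fix e :: real assume e: "0 < e"
  have tM: "tails \<eta> M" by (rule tails_weak_limit[OF rd wc t])
  have C0: "0 \<le> C" using b[of 0] by auto
  have "((\<lambda>R. 8 * C * \<eta> (R / 2)) \<longlongrightarrow> 8 * C * 0) at_top"
    by (intro tendsto_intros filterlim_compose[OF \<eta>]) real_asymp
  then have "eventually (\<lambda>R. 8 * C * \<eta> (R / 2) < e / 3) at_top"
    using order_tendstoD(2)[of "\<lambda>R. 8 * C * \<eta> (R / 2)" "8 * C * 0" at_top "e/3"] e by simp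
  then obtain R where R: "1 \<le> R" "8 * C * \<eta> (R / 2) < e / 3"
    using eventually_happens'[OF _ eventually_conj[OF eventually_ge_at_top[of 1]]] by auto
  let ?g = "\<lambda>x. f (max (-R) (min R x))"
  have c': "isCont ?g x" for x
    by (rule isCont_o2[OF _ c]) (auto intro!: continuous_intros)
  have b': "\<bar>?g x\<bar> \<le> C * (1 + R)" for x
    by (rule order_trans[OF b]) (use R C0 in \<open>auto intro!: mult_left_mono\<close>)
  have "(\<lambda>n. integral\<^sup>L (\<mu> n) ?g) \<longlonglongrightarrow> integral\<^sup>L M ?g"
    using weak_conv_imp_integral_bdd_continuous_conv[OF rd wc, of ?g "C * (1 + R)"] c' b' by auto
  then obtain n0 where n0: "\<And>n. n0 \<le> n \<Longrightarrow> \<bar>integral\<^sup>L (\<mu> n) ?g - integral\<^sup>L M ?g\<bar> < e / 3"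
    using LIMSEQ_D[of _ _ "e/3"] e by (metis divide_pos_pos real_norm_def zero_less_numeral)
  have "norm ((\<integral>x. f x \<partial>\<mu> n) - (\<integral>x. f x \<partial>M)) < e" if "n0 \<le> n" for n
    using n0[OF that] tails_truncation[OF rd(1) t c b R(1), of n] tails_truncation[OF rd(2) tM c b R(1)] R(2)
    unfolding real_norm_def by linarith
  then show "\<exists>no. \<forall>n\<ge>no. norm ((\<integral>x. f x \<partial>\<mu> n) - (\<integral>x. f x \<partial>M)) < e" by blast
qed

lemma tails_tight:
  assumes rd: "\<And>n. real_distribution (\<mu> n)" and t: "\<And>n. tails \<eta> (\<mu> n)"
  shows "tight \<mu>"
  unfolding tight_def
proof (intro conjI allI impI)
  show "real_distribution (\<mu> n)" for n by (rule rd)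
  fix e :: real assume e: "0 < e"
  \<comment> \<open>\<open>B\<close> bounds all absolute first moments, since
    \<open>\<bar>x\<bar> \<le> 1 + max 0 (\<bar>x\<bar> - 1)\<close>. With
    \<open>R = 2 * B / e\<close>, Markov's inequality leaves mass at most \<open>e / 2\<close>
    outside.\<close>
  define B where "B = 1 + \<bar>\<eta> 1\<bar>"
  have B: "0 < B" by (simp add: B_def add_pos_nonneg)
  define R where "R = 2 * B / e"
  have R: "0 < R" using B e by (simp add: R_def)
  show "\<exists>a b. a < b \<and> (\<forall>n. 1 - e < measure (\<mu> n) {a<..b})"
  proof (intro exI conjI allI)
    show "- R < R" using R by simp
    fix n
    interpret real_distribution "\<mu> n" by (rule rd)
    have i: "integrable (\<mu> n) (\<lambda>x. x)" using t[of n] by (simp add: tails_def)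
    have "(\<integral>x. \<bar>x\<bar> \<partial>\<mu> n) \<le> (\<integral>x. 1 + max 0 (\<bar>x\<bar> - 1) \<partial>\<mu> n)"
      using i by (intro integral_mono) auto
    also have "\<dots> = 1 + (\<integral>x. max 0 (\<bar>x\<bar> - 1) \<partial>\<mu> n)"
      using i prob_space by (subst Bochner_Integration.integral_add) auto
    also have "\<dots> \<le> B" using t[of n] unfolding tails_def B_def by (auto dest!: spec[of _ 1])
    finally have le: "(\<integral>x. \<bar>x\<bar> \<partial>\<mu> n) \<le> B" .
    have "measure (\<mu> n) {x \<in> space (\<mu> n). \<bar>x\<bar> \<ge> R} \<le> (\<integral>x. \<bar>x\<bar> \<partial>\<mu> n) / R"
      using i R by (intro integral_Markov_inequality_measure[where A="{}"]) auto
    also have "\<dots> \<le> B / R" using le R by (simp add: divide_right_mono)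
    also have "B / R < e" using B e by (simp add: R_def)
    finally have s: "measure (\<mu> n) {x. \<bar>x\<bar> \<ge> R} < e" by simp
    have "1 - measure (\<mu> n) {-R<..R} = measure (\<mu> n) (UNIV - {-R<..R})"
      using prob_compl[of "{-R<..R}"] by simp
    also have "\<dots> \<le> measure (\<mu> n) {x. \<bar>x\<bar> \<ge> R}" by (intro finite_measure_mono) auto
    finally show "1 - e < measure (\<mu> n) {-R<..R}" using s by linarith
  qed
qed

lemma weak_conv_m_offset: "weak_conv_m (\<lambda>k. \<mu> (k + m)) M \<Longrightarrow> weak_conv_m \<mu> M"
  unfolding weak_conv_m_def weak_conv_def
  using LIMSEQ_offset[of "\<lambda>n. cdf (\<mu> n) x" m for x] by blast

lemma weak_conv_m_subseq: "weak_conv_m \<mu> M \<Longrightarrow> strict_mono r \<Longrightarrow> weak_conv_m (\<lambda>k. \<mu> (r k)) M"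
  unfolding weak_conv_m_def weak_conv_def
  using LIMSEQ_subseq_LIMSEQ[of "\<lambda>n. cdf (\<mu> n) x" _ r for x] by (auto simp: o_def)

text \<open>Arzela--Ascoli for curves of probability measures: compactness at rational times, and
  equicontinuity against the functions \<open>cts_step\<close>, which determine weak convergence.\<close>

lemma weak_compactness_curves:
  fixes \<mu> :: "nat \<Rightarrow> real \<Rightarrow> real measure"
  assumes T: "0 \<le> T"
    and rd: "\<And>k t. t \<in> {0..T} \<Longrightarrow> real_distribution (\<mu> k t)"
    and t: "\<And>k t. t \<in> {0..T} \<Longrightarrow> tails \<eta> (\<mu> k t)"
    and eqc: "\<And>a b. a < b \<Longrightarrow> \<exists>C. \<forall>k. \<forall>s\<in>{0..T}. \<forall>t\<in>{0..T}.
        \<bar>(\<integral>x. cts_step a b x \<partial>\<mu> k s) - (\<integral>x. cts_step a b x \<partial>\<mu> k t)\<bar> \<le> C * (\<bar>s - t\<bar> + d k)"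
    and d: "d \<longlonglongrightarrow> (0::real)"
  obtains r \<nu> where "strict_mono (r :: nat \<Rightarrow> nat)" "\<And>t. t \<in> {0..T} \<Longrightarrow> real_distribution (\<nu> t)"
    "\<And>t. t \<in> {0..T} \<Longrightarrow> weak_conv_m (\<lambda>k. \<mu> (r k) t) (\<nu> t)"
proof -
  define q where "q = from_nat_into (\<rat> \<inter> {0..T})"
  have "0 \<in> \<rat> \<inter> {0..T}" using T by auto
  then have "\<rat> \<inter> {0..T} \<noteq> {}" by blast
  then have qin: "q n \<in> {0..T}" for n
    using from_nat_into[of "\<rat> \<inter> {0..T}" n] by (simp add: q_def)
  have dense: "\<exists>n. \<bar>q n - t\<bar> < e" if te: "t \<in> {0..T}" "0 < e" for t e
  proof -
    have "\<exists>x\<in>\<rat> \<inter> {0..T}. \<bar>x - t\<bar> < e"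
    proof (cases "t = 0")
      case True then show ?thesis using T te by (intro bexI[of _ 0]) auto
    next
      case False
      then have "max 0 (t - e) < t" using te by auto
      then obtain x where "x \<in> \<rat>" "max 0 (t - e) < x" "x < t" using Rats_dense_in_real by blast
      then show ?thesis using te by (intro bexI[of _ x]) auto
    qed
    then obtain x where x: "x \<in> \<rat> \<inter> {0..T}" "\<bar>x - t\<bar> < e" by blast
    have "countable (\<rat> \<inter> {0..T})" using countable_rat by auto
    then obtain n where "q n = x"
      using from_nat_into_surj[OF _ x(1)] by (auto simp: q_def)
    then show ?thesis using x by blast
  qed
  \<comment> \<open>A diagonal argument produces one subsequence that serves all rational
    times.\<close>
  interpret S: subseqs "\<lambda>n s. \<exists>M. real_distribution M \<and> weak_conv_m (\<lambda>k. \<mu> (s k) (q n)) M"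
  proof
    fix n and s :: "nat \<Rightarrow> nat" assume s: "strict_mono s"
    have "tight (\<lambda>k. \<mu> k (q n))" by (rule tails_tight[OF rd[OF qin] t[OF qin]])
    from tight_imp_convergent_subsubsequence[OF this s]
    show "\<exists>r'. strict_mono r' \<and> (\<exists>M. real_distribution M \<and> weak_conv_m (\<lambda>k. \<mu> ((s \<circ> r') k) (q n)) M)"
      by (auto simp: o_def)
  qed
  define r where "r = S.diagseq"
  have r: "strict_mono r" unfolding r_def by (rule S.subseq_diagseq)
  have conv_q: "\<exists>M. real_distribution M \<and> weak_conv_m (\<lambda>k. \<mu> (r k) (q n)) M" for n
  proof -
    \<comment> \<open>The diagonal sequence is known to refine the \<open>n\<close>-th subsequence
      only after an initial segment; the shift by \<open>Suc n\<close> is undone by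
      \<open>weak_conv_m_offset\<close>.\<close>
    have "\<exists>M. real_distribution M \<and> weak_conv_m (\<lambda>k. \<mu> ((S.diagseq \<circ> (+) (Suc n)) k) (q n)) M"
    proof (rule S.diagseq_holds)
      fix r' s :: "nat \<Rightarrow> nat" and n
      assume "strict_mono r'" "\<exists>M. real_distribution M \<and> weak_conv_m (\<lambda>k. \<mu> (s k) (q n)) M"
      then show "\<exists>M. real_distribution M \<and> weak_conv_m (\<lambda>k. \<mu> ((s \<circ> r') k) (q n)) M"
        using weak_conv_m_subseq[of "\<lambda>k. \<mu> (s k) (q n)" _ r'] unfolding o_def by blast
    qed
    then obtain M where "real_distribution M" "weak_conv_m (\<lambda>k. \<mu> (r (k + Suc n)) (q n)) M"
      unfolding r_def o_def add.commute[of "Suc n"] by blast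
    then show ?thesis using weak_conv_m_offset[of "\<lambda>k. \<mu> (r k) (q n)"] by blast
  qed
  have "\<exists>M. real_distribution M \<and> weak_conv_m (\<lambda>k. \<mu> (r k) t) M" if tT: "t \<in> {0..T}" for t
  proof -
    have "tight (\<lambda>k. \<mu> k t)" by (rule tails_tight[OF rd[OF tT] t[OF tT]])
    from tight_imp_convergent_subsubsequence[OF this r]
    obtain r2 M where r2: "strict_mono r2" and M: "real_distribution M"
      and wc: "weak_conv_m (\<lambda>k. \<mu> (r (r2 k)) t) M" by (auto simp: o_def)
    have "weak_conv_m (\<lambda>k. \<mu> (r k) t) M"
    proof (rule integral_cts_step_conv_imp_weak_conv[OF rd[OF tT] M])
      fix a b :: real assume ab: "a < b"
      have cc: "isCont (cts_step a b) x" and cb: "norm (cts_step a b x) \<le> 1" for x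
        using continuous_on_interior[OF uniformly_continuous_imp_continuous[OF cts_step_uniformly_continuous[OF ab]]]
        by (auto simp: cts_step_def)
      define I where "I k s = (\<integral>x. cts_step a b x \<partial>\<mu> (r k) s)" for k s
      obtain C0 where C0: "\<And>k s u. s \<in> {0..T} \<Longrightarrow> u \<in> {0..T} \<Longrightarrow> \<bar>I k s - I k u\<bar> \<le> C0 * (\<bar>s - u\<bar> + d (r k))"
        using eqc[OF ab] unfolding I_def by blast
      define C where "C = \<bar>C0\<bar> + 1"
      have Cpos: "0 < C" by (simp add: C_def add_nonneg_pos)
      have C: "\<bar>I k s - I k u\<bar> \<le> C * (\<bar>s - u\<bar> + \<bar>d (r k)\<bar>)" if "s \<in> {0..T}" "u \<in> {0..T}" for k s u
      proof -
        have "C0 * (\<bar>s - u\<bar> + d (r k)) \<le> \<bar>C0\<bar> * \<bar>\<bar>s - u\<bar> + d (r k)\<bar>"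
          unfolding abs_mult[symmetric] by (rule abs_ge_self)
        also have "\<dots> \<le> \<bar>C0\<bar> * (\<bar>s - u\<bar> + \<bar>d (r k)\<bar>)" by (intro mult_left_mono) auto
        also have "\<dots> \<le> C * (\<bar>s - u\<bar> + \<bar>d (r k)\<bar>)" by (intro mult_right_mono) (auto simp: C_def)
        finally show ?thesis using C0[OF that, of k] by linarith
      qed
      \<comment> \<open>The integrals at \<open>t\<close> are compared with those at a nearby
        rational time, where they converge. The curves are equicontinuous only up to
        \<open>d (r k)\<close>, which disappears for large \<open>k\<close>.\<close>
      have "Cauchy (\<lambda>k. I k t)"
      proof (rule CauchyI)
        fix e :: real assume e: "0 < e"
        obtain n where n: "\<bar>q n - t\<bar> < e / (6 * C)" using dense[OF tT, of "e / (6 * C)"] e Cpos by auto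
        obtain Mq where "real_distribution Mq" "weak_conv_m (\<lambda>k. \<mu> (r k) (q n)) Mq" using conv_q by blast
        then have "convergent (\<lambda>k. I k (q n))"
          using weak_conv_imp_integral_bdd_continuous_conv[of "\<lambda>k. \<mu> (r k) (q n)" Mq, OF rd[OF qin] _ _ cc cb]
          unfolding I_def convergent_def by blast
        then have "Cauchy (\<lambda>k. I k (q n))" by (simp add: Cauchy_convergent_iff)
        then obtain N1 where N1: "\<And>k l. N1 \<le> k \<Longrightarrow> N1 \<le> l \<Longrightarrow> \<bar>I k (q n) - I l (q n)\<bar> < e / 3"
          using CauchyD[of _ "e/3"] e by (metis divide_pos_pos real_norm_def zero_less_numeral)
        have "(\<lambda>k. d (r k)) \<longlonglongrightarrow> 0" using LIMSEQ_subseq_LIMSEQ[OF d r] by (simp add: o_def)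
        then obtain N2 where N2: "\<And>k. N2 \<le> k \<Longrightarrow> \<bar>d (r k)\<bar> < e / (6 * C)"
          using LIMSEQ_D[of "\<lambda>k. d (r k)" 0 "e / (6 * C)"] e Cpos by auto
        have near: "\<bar>I k t - I k (q n)\<bar> < e / 3" if "N2 \<le> k" for k
        proof -
          have "\<bar>I k t - I k (q n)\<bar> \<le> C * (\<bar>t - q n\<bar> + \<bar>d (r k)\<bar>)" by (rule C[OF tT qin])
          also have "\<dots> < C * (e / (6 * C) + e / (6 * C))"
            using N2[OF that] n Cpos by (intro mult_strict_left_mono) auto
          also have "\<dots> = e / 3" using Cpos by simp
          finally show ?thesis .
        qed
        show "\<exists>M. \<forall>m\<ge>M. \<forall>n\<ge>M. norm (I m t - I n t) < e"
        proof (intro exI[of _ "max N1 N2"] allI impI)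
          fix k l assume "max N1 N2 \<le> k" "max N1 N2 \<le> l"
          then show "norm (I k t - I l t) < e"
            using near[of k] near[of l] N1[of k l] unfolding real_norm_def abs_less_iff by simp
        qed
      qed
      then obtain L where L: "(\<lambda>k. I k t) \<longlonglongrightarrow> L" by (auto simp: Cauchy_convergent_iff convergent_def)
      \<comment> \<open>The full sequence converges by the Cauchy property; a further subsequence,
        provided by tightness, identifies its limit as the integral against
        \<open>M\<close>.\<close>
      have "(\<lambda>k. I (r2 k) t) \<longlonglongrightarrow> integral\<^sup>L M (cts_step a b)"
        unfolding I_def by (rule weak_conv_imp_integral_bdd_continuous_conv[OF rd[OF tT] M wc cc cb])
      moreover have "(\<lambda>k. I (r2 k) t) \<longlonglongrightarrow> L" using LIMSEQ_subseq_LIMSEQ[OF L r2] by (simp add: o_def)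
      ultimately have "L = integral\<^sup>L M (cts_step a b)" using LIMSEQ_unique by blast
      then show "(\<lambda>n. integral\<^sup>L (\<mu> (r n) t) (cts_step a b)) \<longlonglongrightarrow> integral\<^sup>L M (cts_step a b)"
        using L by (simp add: I_def)
    qed
    then show ?thesis using M by blast
  qed
  then show ?thesis using that[OF r] by metis
qed

section \<open>Passage to the limit\<close>

definition lattice_measure :: "real \<Rightarrow> nat \<Rightarrow> (nat \<Rightarrow> real) \<Rightarrow> real measure" where
  "lattice_measure h K c = distr (point_measure {..K} (\<lambda>i. ennreal (c i))) borel (\<lambda>i. real i * h)"

context
  fixes h :: real and K :: nat and c :: "nat \<Rightarrow> real"
  assumes c0: "\<And>i. i \<le> K \<Longrightarrow> 0 \<le> c i" and c1: "(\<Sum>i\<le>K. c i) = 1"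
begin

lemma lattice_measurable: "(\<lambda>i. real i * h) \<in> measurable (point_measure {..K} (\<lambda>i. ennreal (c i))) borel"
  by (simp add: measurable_point_measure_eq1)

lemma lattice_real_distribution: "real_distribution (lattice_measure h K c)"
proof -
  have "emeasure (point_measure {..K} (\<lambda>i. ennreal (c i))) {..K} = (\<Sum>i\<le>K. ennreal (c i))"
    by (subst emeasure_point_measure_finite) auto
  also have "\<dots> = 1" using c0 c1 by (subst sum_ennreal) auto
  finally have "prob_space (point_measure {..K} (\<lambda>i. ennreal (c i)))"
    by (intro prob_spaceI) (simp add: space_point_measure)
  then have "prob_space (lattice_measure h K c)"
    unfolding lattice_measure_def by (rule prob_space.prob_space_distr[OF _ lattice_measurable])
  then show ?thesis
    by (simp add: real_distribution_def real_distribution_axioms_def lattice_measure_def)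
qed

lemma integral_lattice_measure:
  fixes f :: "real \<Rightarrow> real"
  assumes "f \<in> borel_measurable borel"
  shows "(\<integral>x. f x \<partial>lattice_measure h K c) = (\<Sum>i\<le>K. c i * f (real i * h))"
proof -
  have "(\<integral>x. f x \<partial>lattice_measure h K c) = (\<integral>i. f (real i * h) \<partial>point_measure {..K} (\<lambda>i. ennreal (c i)))"
    unfolding lattice_measure_def by (rule integral_distr[OF lattice_measurable assms])
  also have "\<dots> = (\<Sum>i\<le>K. c i *\<^sub>R f (real i * h))"
    by (rule lebesgue_integral_point_measure_finite) (use c0 in auto)
  finally show ?thesis by simp
qed

lemma integrable_lattice_measure:
  fixes f :: "real \<Rightarrow> real"
  assumes "f \<in> borel_measurable borel"
  shows "integrable (lattice_measure h K c) f"
  unfolding lattice_measure_def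
  by (subst integrable_distr_eq[OF lattice_measurable assms]) (simp add: integrable_point_measure_finite)

lemma AE_lattice_measure:
  assumes "0 < h"
  shows "AE x in lattice_measure h K c. 0 \<le> x"
  unfolding lattice_measure_def
  by (subst AE_distr_iff[OF lattice_measurable]) (use assms in auto)

end

section \<open>The scheme as a curve of probability measures in continuous time\<close>

lemma nat_floor_div:
  fixes t d :: real
  assumes "0 < d" "0 \<le> t"
  shows "real (nat \<lfloor>t / d\<rfloor>) * d \<le> t" "t < (real (nat \<lfloor>t / d\<rfloor>) + 1) * d"
proof -
  have "real (nat \<lfloor>t / d\<rfloor>) \<le> t / d" "t / d < real (nat \<lfloor>t / d\<rfloor>) + 1"
    using assms by auto
  then show "real (nat \<lfloor>t / d\<rfloor>) * d \<le> t" "t < (real (nat \<lfloor>t / d\<rfloor>) + 1) * d"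
    using assms(1) by (auto simp: pos_le_divide_eq pos_divide_less_eq)
qed

text \<open>It turns the Euler recursion into an integrated equation for the piecewise constant
  rate. At a time between two grid points, the unfinished step enters with its elapsed length
  \<open>t - real j * d\<close>.\<close>

lemma step_function_has_integral:
  fixes a b :: "nat \<Rightarrow> real"
  assumes d: "0 < d" and rec: "\<And>j. a (Suc j) = a j + d * b j"
    and t: "real j * d \<le> t" "t \<le> real (Suc j) * d"
  shows "((\<lambda>s. b (nat \<lfloor>s / d\<rfloor>)) has_integral (a j - a 0 + (t - real j * d) * b j)) {0..t}"
  using t
proof (induction j arbitrary: t)
  case (0 t)
  have "((\<lambda>s. b 0) has_integral (t - 0) * b 0) {0..t}"
    using has_integral_const_real[of "b 0" 0 t] 0 by simp
  then have "((\<lambda>s. b (nat \<lfloor>s / d\<rfloor>)) has_integral (t - 0) * b 0) {0..t}"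
  proof (rule has_integral_spike_finite[of "{d}", rotated 2])
    fix s assume s: "s \<in> {0..t} - {d}"
    then have "0 \<le> s / d" "s / d < 1" using 0 d by auto
    then have "\<lfloor>s / d\<rfloor> = 0" by linarith
    then show "b (nat \<lfloor>s / d\<rfloor>) = b 0" by simp
  qed simp
  then show ?case by simp
next
  case (Suc j t)
  define u where "u = real (Suc j) * d"
  have u: "0 \<le> u" "real j * d \<le> u" "u \<le> t" using d Suc.prems by (auto simp: u_def)
  have 1: "((\<lambda>s. b (nat \<lfloor>s / d\<rfloor>)) has_integral (a j - a 0 + (u - real j * d) * b j)) {0..u}"
    by (rule Suc.IH) (use u in \<open>auto simp: u_def\<close>)
  have "((\<lambda>s. b (Suc j)) has_integral (t - u) * b (Suc j)) {u..t}"
    using has_integral_const_real[of "b (Suc j)" u t] u by simp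
  then have 2: "((\<lambda>s. b (nat \<lfloor>s / d\<rfloor>)) has_integral (t - u) * b (Suc j)) {u..t}"
  proof (rule has_integral_spike_finite[of "{real (Suc (Suc j)) * d}", rotated 2])
    fix s assume s: "s \<in> {u..t} - {real (Suc (Suc j)) * d}"
    then have "real (Suc j) \<le> s / d" "s / d < real (Suc (Suc j))"
      using Suc.prems d by (auto simp: u_def pos_le_divide_eq pos_divide_less_eq)
    then have "\<lfloor>s / d\<rfloor> = int (Suc j)" by linarith
    then show "b (nat \<lfloor>s / d\<rfloor>) = b (Suc j)" by (simp only: nat_int)
  qed simp
  have "a j - a 0 + (u - real j * d) * b j + (t - u) * b (Suc j) = a (Suc j) - a 0 + (t - real (Suc j) * d) * b (Suc j)"
    by (simp add: rec u_def algebra_simps)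
  then show ?case using has_integral_combine[OF u(1,3) 1 2] by (simp only:)
qed

text \<open>This is \<open>Q3\<close> evaluated at \<open>m\<close> times \<open>M\<close>. As
  \<open>kap\<close> and \<open>psi\<close> vanish when an argument is 0, it is also
  \<open>Q3\<close> of that measure with any mass at the origin added or removed, which allows the
  normalisation to probability measures.\<close>

definition rate :: "real \<Rightarrow> (real \<Rightarrow> real) \<Rightarrow> real measure \<Rightarrow> real" where
  "rate m \<phi> M = m * m * (\<integral>x. \<integral>y. kap \<phi> x y \<partial>M \<partial>M) - m * (\<integral>x. psi \<phi> x \<partial>M)"

lemma isCont_kap_left: "tame \<phi> \<Longrightarrow> isCont (\<lambda>x. kap \<phi> x y) x"
  using isCont_o2[where f="\<lambda>x. (x, y)" and a=x and g="\<lambda>p. kap \<phi> (fst p) (snd p)"] isCont_kap[of \<phi> "(x, y)"]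
  by (auto intro!: continuous_intros)

lemma isCont_kap_right: "tame \<phi> \<Longrightarrow> isCont (\<lambda>y. kap \<phi> x y) y"
  unfolding kap_commute[of \<phi> x] by (rule isCont_kap_left)

lemma isCont_adm: "adm L C \<phi> \<Longrightarrow> isCont \<phi> x"
  using admD(1) by (simp add: continuous_on_eq_continuous_at)

lemma borel_measurable_adm: "adm L C \<phi> \<Longrightarrow> \<phi> \<in> borel_measurable borel"
  by (rule isCont_borel_measurable[OF refl isCont_adm])

text \<open>The nonnegative measures \<open>lattice_measure \<dots>\<close> below represent the scheme plus \<open>Mb\<close> times a
  Dirac mass at the origin, normalised to total mass one.\<close>

context euler
begin

definition m where "m = N + Mb"

definition wt :: "real \<Rightarrow> nat \<Rightarrow> real" where "wt t = W (nat \<lfloor>t / \<delta>\<rfloor>)"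

definition mu :: "real \<Rightarrow> real measure" where
  "mu t = lattice_measure h K (\<lambda>i. (wt t i + (if i = 0 then Mb else 0)) / m)"

text \<open>The first two summands bound the limiting rate, the bracket is the consistency error;
  together they bound \<open>dQ\<close>.\<close>

definition bnd :: "real \<Rightarrow> real \<Rightarrow> real" where
  "bnd L C = 2 * L * Mb * Mb + C * (Mb + E) + (4 * L * Mb * E / (real K * h) + 2 * L * h * (Mb + E))"

context
  assumes Npos: "0 < N"
begin

lemma E_nonneg: "0 \<le> E" using E energy0_ge0 by simp

lemma Mb_nonneg: "0 \<le> Mb"
  unfolding Mb using Npos E_nonneg by simp

lemma m_pos: "0 < m"
  using Npos Mb_nonneg by (simp add: m_def)

context
  fixes t :: real assumes t: "t \<in> {0..T}"
begin

lemma jt: "real (nat \<lfloor>t / \<delta>\<rfloor>) * \<delta> \<le> T"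
  using nat_floor_div(1)[OF d, of t] t by auto

lemmas wt_facts = W_facts[OF jt, folded wt_def]

lemma coeff_nonneg: "i \<le> K \<Longrightarrow> 0 \<le> (wt t i + (if i = 0 then Mb else 0)) / m"
  using wt_facts(3)[of i] W_atom[OF jt] m_pos by (cases "i = 0") (auto simp: wt_def)

lemma coeff_sum:
  "(\<Sum>i\<le>K. (wt t i + (if i = 0 then Mb else 0)) / m * f i) = (dpair K f (wt t) + Mb * f 0) / m"
proof -
  have "(\<Sum>i\<le>K. (wt t i + (if i = 0 then Mb else 0)) / m * f i)
     = ((\<Sum>i\<le>K. f i * wt t i) + (\<Sum>i\<le>K. (if i = 0 then Mb * f i else 0))) / m"
    unfolding sum.distrib[symmetric] sum_divide_distrib
    by (intro sum.cong) (auto simp: algebra_simps add_divide_distrib)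
  also have "(\<Sum>i\<le>K. (if i = 0 then Mb * f i else 0)) = Mb * f 0"
    by (simp add: sum.delta)
  finally show ?thesis by (simp add: dpair_def)
qed

lemma coeff_sum_1: "(\<Sum>i\<le>K. (wt t i + (if i = 0 then Mb else 0)) / m) = 1"
  using coeff_sum[of "\<lambda>_. 1"] mass_W m_pos by (simp add: wt_def m_def)

lemma mu_real_distribution: "real_distribution (mu t)"
  unfolding mu_def by (rule lattice_real_distribution[OF coeff_nonneg coeff_sum_1])

lemma mu_AE: "AE x in mu t. 0 \<le> x"
  unfolding mu_def by (rule AE_lattice_measure[OF coeff_nonneg coeff_sum_1 h])

lemma mu_integrable: "f \<in> borel_measurable borel \<Longrightarrow> integrable (mu t) (f :: real \<Rightarrow> real)"
  unfolding mu_def by (rule integrable_lattice_measure[OF coeff_nonneg coeff_sum_1])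

lemma mu_integral:
  assumes "f \<in> borel_measurable borel"
  shows "m * (\<integral>x. f x \<partial>mu t) = dpair K (\<lambda>i. f (real i * h)) (wt t) + Mb * f 0"
proof -
  have "(\<integral>x. f x \<partial>mu t) = (\<Sum>i\<le>K. (wt t i + (if i = 0 then Mb else 0)) / m * f (real i * h))"
    unfolding mu_def by (rule integral_lattice_measure[OF coeff_nonneg coeff_sum_1 assms])
  then show ?thesis using coeff_sum[of "\<lambda>i. f (real i * h)"] m_pos by simp
qed

lemma mu_integral_0:
  assumes "f \<in> borel_measurable borel" "f 0 = 0"
  shows "m * (\<integral>x. f x \<partial>mu t) = (\<Sum>i\<in>{1..K}. f (real i * h) * wt t i)"
  unfolding mu_integral[OF assms(1)] by (simp add: dpair_atom assms(2))

lemma mu_rate: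
  assumes "tame \<phi>"
  shows "rate m \<phi> (mu t) =
     (\<Sum>i\<in>{1..K}. \<Sum>l\<in>{1..K}. kap \<phi> (real i * h) (real l * h) * (wt t i * wt t l))
        - (\<Sum>i\<in>{1..K}. psi \<phi> (real i * h) * wt t i)"
proof -
  obtain L C where a: "adm L C \<phi>" using assms unfolding tame_def by blast
  have mk: "(\<lambda>y. kap \<phi> x y) \<in> borel_measurable borel" for x
    by (rule isCont_borel_measurable[OF refl isCont_kap_right[OF assms]])
  have mk': "(\<lambda>x. kap \<phi> x y) \<in> borel_measurable borel" for y
    by (rule isCont_borel_measurable[OF refl isCont_kap_left[OF assms]])
  have inner: "m * (\<integral>y. kap \<phi> x y \<partial>mu t) = (\<Sum>l\<in>{1..K}. kap \<phi> x (real l * h) * wt t l)" for x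
    by (rule mu_integral_0[OF mk]) (simp add: kap_def)
  have "m * m * (\<integral>x. \<integral>y. kap \<phi> x y \<partial>mu t \<partial>mu t) = m * (\<integral>x. m * (\<integral>y. kap \<phi> x y \<partial>mu t) \<partial>mu t)"
    by simp
  also have "\<dots> = m * (\<integral>x. (\<Sum>l\<in>{1..K}. kap \<phi> x (real l * h) * wt t l) \<partial>mu t)"
    unfolding inner ..
  also have "\<dots> = (\<Sum>i\<in>{1..K}. (\<Sum>l\<in>{1..K}. kap \<phi> (real i * h) (real l * h) * wt t l) * wt t i)"
  proof (rule mu_integral_0)
    show "(\<lambda>x. \<Sum>l\<in>{1..K}. kap \<phi> x (real l * h) * wt t l) \<in> borel_measurable borel"
      by (intro borel_measurable_sum borel_measurable_times mk') auto
  qed (simp add: kap_def)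
  also have "\<dots> = (\<Sum>i\<in>{1..K}. \<Sum>l\<in>{1..K}. kap \<phi> (real i * h) (real l * h) * (wt t i * wt t l))"
    unfolding sum_distrib_right by (intro sum.cong) (auto simp: mult_ac)
  finally show ?thesis
    unfolding rate_def
    using mu_integral_0[OF isCont_borel_measurable[OF refl isCont_psi[OF a]]] psi_def[of \<phi> 0] by simp
qed

lemma mu_dQ:
  assumes "tame \<phi>" "adm L C \<phi>"
  shows "\<bar>dQ h K (\<lambda>i. \<phi> (real i * h)) (wt t) - rate m \<phi> (mu t)\<bar>
     \<le> 4 * L * Mb * E / (real K * h) + 2 * L * h * (Mb + E)"
  unfolding mu_rate[OF assms(1)] by (rule dQ_consistent[OF wt_facts assms(2) K])

lemma dQ_bnd:
  assumes "adm L C \<phi>"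
  shows "\<bar>dQ h K (\<lambda>i. \<phi> (real i * h)) (wt t)\<bar> \<le> bnd L C"
  using dQ_consistent[OF wt_facts assms K] sum_kap_bound[OF wt_facts assms] unfolding bnd_def by linarith

lemma mu_tail:
  assumes R: "0 < R"
  shows "m * (\<integral>x. max 0 (\<bar>x\<bar> - R) \<partial>mu t) \<le> dpair K (\<lambda>i. max 0 (real i * h - R)) w0 + T * (Mb * (Mb + E) / sqrt (R / 2))"
proof -
  have "m * (\<integral>x. max 0 (\<bar>x\<bar> - R) \<partial>mu t) = dpair K (\<lambda>i. max 0 (real i * h - R)) (wt t)"
    by (subst mu_integral) (use R h in \<open>auto simp: abs_mult\<close>)
  also have "\<dots> \<le> dpair K (\<lambda>i. max 0 (real i * h - R)) w0
      + real (nat \<lfloor>t / \<delta>\<rfloor>) * \<delta> * (Mb * (Mb + E) / sqrt (R / 2))"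
    unfolding wt_def by (rule W_tail[OF R jt])
  also have "real (nat \<lfloor>t / \<delta>\<rfloor>) * \<delta> * (Mb * (Mb + E) / sqrt (R / 2)) \<le> T * (Mb * (Mb + E) / sqrt (R / 2))"
    using jt Mb_nonneg E_nonneg R by (intro mult_right_mono) auto
  finally show ?thesis by simp
qed

end

text \<open>The curve is constant between grid points while the integral keeps growing, so the
  discrepancy is a single unfinished step, of size at most
  \<open>bnd L C * \<delta>\<close>.\<close>

lemma mu_evolution:
  assumes t: "t \<in> {0..T}" and a: "adm L C \<phi>"
  shows "(\<lambda>s. dQ h K (\<lambda>i. \<phi> (real i * h)) (wt s)) integrable_on {0..t}"
    "\<bar>m * (\<integral>x. \<phi> x \<partial>mu t) - m * (\<integral>x. \<phi> x \<partial>mu 0) - integral {0..t} (\<lambda>s. dQ h K (\<lambda>i. \<phi> (real i * h)) (wt s))\<bar>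
       \<le> bnd L C * \<delta>"
proof -
  let ?f = "\<lambda>i. \<phi> (real i * h)"
  define j where "j = nat \<lfloor>t / \<delta>\<rfloor>"
  have t0: "0 \<le> t" and T0: "0 \<in> {0..T}" using t by auto
  have j: "real j * \<delta> \<le> t" "t < (real j + 1) * \<delta>" unfolding j_def by (rule nat_floor_div[OF d t0])+
  have w: "wt t = W j" "wt 0 = W 0" by (simp_all add: wt_def j_def)
  have *: "((\<lambda>s. dQ h K ?f (wt s)) has_integral
      (dpair K ?f (W j) - dpair K ?f (W 0) + (t - real j * \<delta>) * dQ h K ?f (W j))) {0..t}"
    unfolding wt_def
    by (rule step_function_has_integral[OF d, of "\<lambda>j. dpair K ?f (W j)" "\<lambda>j. dQ h K ?f (W j)"])
      (use j in \<open>auto simp: dpair_W_Suc algebra_simps\<close>)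
  then show "(\<lambda>s. dQ h K ?f (wt s)) integrable_on {0..t}" by blast
  have e: "m * (\<integral>x. \<phi> x \<partial>mu t) - m * (\<integral>x. \<phi> x \<partial>mu 0) = dpair K ?f (W j) - dpair K ?f (W 0)"
    unfolding mu_integral[OF t borel_measurable_adm[OF a]] mu_integral[OF T0 borel_measurable_adm[OF a]] w
    by simp
  have "\<bar>(t - real j * \<delta>) * dQ h K ?f (W j)\<bar> \<le> \<delta> * bnd L C"
    unfolding abs_mult using dQ_bnd[OF t a] j d
    by (intro mult_mono) (auto simp: w algebra_simps)
  then show "\<bar>m * (\<integral>x. \<phi> x \<partial>mu t) - m * (\<integral>x. \<phi> x \<partial>mu 0) - integral {0..t} (\<lambda>s. dQ h K ?f (wt s))\<bar>
       \<le> bnd L C * \<delta>"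
    unfolding e integral_unique[OF *] by (simp add: mult.commute)
qed

lemma mu_equicontinuous:
  assumes s: "s \<in> {0..T}" and t: "t \<in> {0..T}" and a: "adm L C \<phi>"
  shows "\<bar>m * (\<integral>x. \<phi> x \<partial>mu s) - m * (\<integral>x. \<phi> x \<partial>mu t)\<bar> \<le> bnd L C * (\<bar>s - t\<bar> + 2 * \<delta>)"
proof -
  let ?q = "\<lambda>s. dQ h K (\<lambda>i. \<phi> (real i * h)) (wt s)"
  have *: "\<bar>m * (\<integral>x. \<phi> x \<partial>mu t) - m * (\<integral>x. \<phi> x \<partial>mu s)\<bar> \<le> bnd L C * (t - s + 2 * \<delta>)"
    if "s \<le> t" "s \<in> {0..T}" "t \<in> {0..T}" for s t
  proof -
    have i: "?q integrable_on {0..t}" by (rule mu_evolution(1)[OF that(3) a])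
    have "integral {0..s} ?q + integral {s..t} ?q = integral {0..t} ?q"
      using that i by (intro Henstock_Kurzweil_Integration.integral_combine) auto
    moreover have "norm (integral {s..t} ?q) \<le> integral {s..t} (\<lambda>_. bnd L C)"
    proof (rule integral_norm_bound_integral)
      show "?q integrable_on {s..t}" by (rule integrable_on_subinterval[OF i]) (use that in auto)
      fix x assume "x \<in> {s..t}"
      then show "norm (?q x) \<le> bnd L C" using dQ_bnd[of x, OF _ a] that by auto
    qed auto
    moreover have "integral {s..t} (\<lambda>_. bnd L C) = bnd L C * (t - s)" using that by simp
    ultimately show ?thesis
      using mu_evolution(2)[OF that(2) a] mu_evolution(2)[OF that(3) a]
      unfolding distrib_left real_norm_def abs_le_iff by linarith
  qed
  show ?thesis using *[of s t] *[of t s] s t by (cases "s \<le> t") auto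
qed

end
end

lemma rate_tendsto:
  assumes rd: "\<And>n. real_distribution (\<mu> n)" "real_distribution M" and wc: "weak_conv_m \<mu> M"
    and t: "\<And>n. tails \<eta> (\<mu> n)" and \<eta>: "(\<eta> \<longlongrightarrow> 0) at_top" and \<phi>: "tame \<phi>"
  shows "(\<lambda>n. rate m \<phi> (\<mu> n)) \<longlonglongrightarrow> rate m \<phi> M"
proof -
  obtain L C where a: "adm L C \<phi>" using \<phi> unfolding tame_def by blast
  have b: "\<bar>psi \<phi> x\<bar> \<le> C * (1 + \<bar>x\<bar>)" for x
    using psi_le[OF a, of x] admD(3)[OF a] by (cases "0 \<le> x") (auto simp: psi_def)
  show ?thesis unfolding rate_def
    by (intro tendsto_intros weak_conv_double_integral[OF rd wc isCont_kap[OF \<phi>] kap_le[OF a]]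
        weak_conv_integral_linear_growth[OF rd wc t \<eta> isCont_psi[OF a] b])
qed

text \<open>Changing the density at the origin alone amounts to adding or removing a Dirac mass
  there. With \<alpha> inversely proportional to an existing positive atom, this passes between the
  solution and its normalised version without a subtraction of measures.\<close>

lemma integral_density_atom:
  fixes f :: "real \<Rightarrow> real"
  assumes M: "sets M = sets borel" "finite_measure M" and f: "integrable M f" and \<alpha>: "0 \<le> \<alpha>" "0 \<le> \<beta>"
  shows "integrable (density M (\<lambda>x. ennreal (if x = 0 then \<alpha> else \<beta>))) f"
    "(\<integral>x. f x \<partial>density M (\<lambda>x. ennreal (if x = 0 then \<alpha> else \<beta>)))
       = \<beta> * (\<integral>x. f x \<partial>M) + (\<alpha> - \<beta>) * measure M {0} * f 0"
proof -
  interpret finite_measure M by fact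
  let ?g = "\<lambda>x::real. if x = 0 then \<alpha> else \<beta>"
  have s0: "{0} \<in> sets M" using M by simp
  have eq: "?g x * f x = \<beta> * f x + (\<alpha> - \<beta>) * f 0 * indicator {0} x" for x
    by (auto simp: algebra_simps)
  have i0: "integrable M (\<lambda>x. (\<alpha> - \<beta>) * f 0 * indicator {0} x)"
    using s0 by (intro integrable_mult_right integrable_real_indicator) (auto simp: less_top[symmetric])
  have g: "?g \<in> borel_measurable M"
  proof -
    have "?g \<in> borel_measurable borel" by measurable
    then show ?thesis using measurable_cong_sets[OF M(1) refl, of borel] by blast
  qed
  have fm: "f \<in> borel_measurable M" using f by auto
  have nn: "AE x in M. 0 \<le> ?g x" using \<alpha> by auto
  show "integrable (density M (\<lambda>x. ennreal (?g x))) f"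
    unfolding integrable_real_density[OF g nn fm] eq using f i0 by auto
  show "(\<integral>x. f x \<partial>density M (\<lambda>x. ennreal (?g x)))
       = \<beta> * (\<integral>x. f x \<partial>M) + (\<alpha> - \<beta>) * measure M {0} * f 0"
    unfolding integral_real_density[OF g nn fm] eq
    using f i0 s0 by (subst Bochner_Integration.integral_add) (auto simp: mult_ac)
qed

lemma real_distribution_density_atom:
  assumes M: "sets M = sets borel" "finite_measure M" and \<alpha>: "0 \<le> \<alpha>" "0 \<le> \<beta>"
    and 1: "\<beta> * measure M UNIV + (\<alpha> - \<beta>) * measure M {0} = 1"
  shows "real_distribution (density M (\<lambda>x. ennreal (if x = 0 then \<alpha> else \<beta>)))" (is "real_distribution ?D")
proof -
  interpret finite_measure M by fact
  have sp: "space M = UNIV" using sets_eq_imp_space_eq[OF M(1)] by simp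
  have i: "integrable M (\<lambda>_. 1 :: real)" by simp
  have int: "integrable ?D (\<lambda>_. 1 :: real)" and "(\<integral>x. 1 \<partial>?D) = (1::real)"
    using integral_density_atom[OF M i \<alpha>] 1 sp by auto
  then have m: "measure ?D (space ?D) = 1" by simp
  have "emeasure ?D (space ?D) \<noteq> \<top>"
    using m unfolding measure_def by (intro notI) simp
  then have "emeasure ?D (space ?D) = 1"
    using m by (subst emeasure_eq_ennreal_measure) simp_all
  then have "prob_space ?D" by (rule prob_spaceI)
  then show ?thesis using M sp by (simp add: real_distribution_def real_distribution_axioms_def)
qed

section \<open>Discretisation of the initial measure\<close>

definition cell :: "real \<Rightarrow> nat \<Rightarrow> real \<Rightarrow> nat" where
  "cell h K x = min (nat \<lfloor>x / h\<rfloor>) K"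

definition cell_mass :: "real measure \<Rightarrow> real \<Rightarrow> nat \<Rightarrow> nat \<Rightarrow> real" where
  "cell_mass G h K i = (\<integral>x. (if cell h K x = i then 1 else 0) \<partial>G)"

lemma cell_measurable: "sets G = sets borel \<Longrightarrow> (\<lambda>x. f (cell h K x) :: real) \<in> borel_measurable G"
proof -
  assume s: "sets G = sets borel"
  have "cell h K \<in> measurable borel (count_space UNIV)"
    unfolding cell_def[abs_def] by measurable
  then have "(\<lambda>x. f (cell h K x)) \<in> borel_measurable borel"
    by (rule measurable_compose) simp
  then show ?thesis using measurable_cong_sets[OF s refl] by blast
qed

lemma dpair_cell_mass:
  assumes "sets G = sets borel" "finite_measure G"
  shows "dpair K f (cell_mass G h K) = (\<integral>x. f (cell h K x) \<partial>G)"
proof -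
  interpret finite_measure G by fact
  have i: "integrable G (\<lambda>x. f i * (if cell h K x = i then 1 else 0))" for i
    by (intro integrable_mult_right integrable_const_bound[of _ 1] cell_measurable[OF assms(1)]) auto
  have "dpair K f (cell_mass G h K) = (\<Sum>i\<le>K. \<integral>x. f i * (if cell h K x = i then 1 else 0) \<partial>G)"
    by (simp add: dpair_def cell_mass_def)
  also have "\<dots> = (\<integral>x. (\<Sum>i\<le>K. f i * (if cell h K x = i then 1 else 0)) \<partial>G)"
    using i by (simp add: Bochner_Integration.integral_sum)
  also have "\<dots> = (\<integral>x. f (cell h K x) \<partial>G)"
  proof (rule Bochner_Integration.integral_cong)
    fix x
    have "(\<Sum>i\<le>K. f i * (if cell h K x = i then 1 else 0)) = (\<Sum>i\<le>K. if cell h K x = i then f i else 0)"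
      by (intro sum.cong) auto
    also have "\<dots> = f (cell h K x)" by (subst sum.delta') (auto simp: cell_def)
    finally show "(\<Sum>i\<le>K. f i * (if cell h K x = i then 1 else 0)) = f (cell h K x)" .
  qed simp
  finally show ?thesis .
qed

text \<open>Rounding is downwards, so that the discrete energy and the discrete tails stay below
  those of the initial measure.\<close>

lemma cell_le:
  assumes "0 < h" "0 \<le> x"
  shows "real (cell h K x) * h \<le> x"
proof -
  have "real (cell h K x) \<le> real (nat \<lfloor>x / h\<rfloor>)" by (simp add: cell_def)
  then have "real (cell h K x) * h \<le> real (nat \<lfloor>x / h\<rfloor>) * h" using assms by (intro mult_right_mono) auto
  then show ?thesis using nat_floor_div(1)[OF assms] by simp
qed

text \<open>The mesh \<open>1 / Suc k\<close> tends to zero while \<open>(Suc k)\<close> squared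
  cells cover the interval up to \<open>Suc k\<close>, so a fixed \<open>x\<close> eventually
  escapes the clamp in \<open>cell\<close> and is off by at most one mesh width.\<close>

lemma cell_tendsto:
  assumes "0 \<le> x"
  shows "(\<lambda>k. real (cell (1 / real (Suc k)) ((Suc k)\<^sup>2) x) * (1 / real (Suc k))) \<longlonglongrightarrow> x"
proof (rule tendsto_sandwich)
  have lo: "x - 1 / real (Suc k) \<le> real (cell (1 / real (Suc k)) ((Suc k)\<^sup>2) x) * (1 / real (Suc k))"
    if "x \<le> real k" for k
  proof -
    have "nat \<lfloor>x / (1 / real (Suc k))\<rfloor> \<le> (Suc k)\<^sup>2"
    proof -
      have "x * real (Suc k) \<le> real (Suc k) * real (Suc k)"
        using that by (intro mult_right_mono) auto
      then have "\<lfloor>x * real (Suc k)\<rfloor> \<le> \<lfloor>real ((Suc k)\<^sup>2)\<rfloor>"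
        by (intro floor_mono) (simp only: power2_eq_square of_nat_mult)
      then show ?thesis by (simp add: nat_le_iff del: of_nat_Suc of_nat_power)
    qed
    then have "cell (1 / real (Suc k)) ((Suc k)\<^sup>2) x = nat \<lfloor>x / (1 / real (Suc k))\<rfloor>"
      unfolding cell_def by simp
    then show ?thesis
      using nat_floor_div(2)[of "1 / real (Suc k)" x] assms by (simp add: add_divide_distrib del: of_nat_Suc)
  qed
  show "\<forall>\<^sub>F k in sequentially. x - 1 / real (Suc k) \<le> real (cell (1 / real (Suc k)) ((Suc k)\<^sup>2) x) * (1 / real (Suc k))"
    using eventually_ge_at_top[of "nat \<lceil>x\<rceil>"]
    by eventually_elim (intro lo, linarith)
  show "\<forall>\<^sub>F k in sequentially. real (cell (1 / real (Suc k)) ((Suc k)\<^sup>2) x) * (1 / real (Suc k)) \<le> x"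
    by (intro always_eventually allI cell_le[OF _ assms]) simp
  show "(\<lambda>k. x - 1 / real (Suc k)) \<longlonglongrightarrow> x"
    using tendsto_diff[OF tendsto_const LIMSEQ_inverse_real_of_nat, of x] by (simp add: inverse_eq_divide)
qed simp

lemma adm_cts_step:
  assumes "a < b"
  shows "adm (1 / (b - a)) (4 * 1) (cts_step a b)"
proof (rule adm_bounded)
  fix x y
  have eq: "cts_step a b x = max 0 (min 1 ((b - x) / (b - a)))" for x
    using assms by (auto simp: cts_step_def max_def min_def divide_le_eq le_divide_eq)
  have "\<bar>cts_step a b x - cts_step a b y\<bar> \<le> \<bar>(b - x) / (b - a) - (b - y) / (b - a)\<bar>"
    unfolding eq by linarith
  also have "\<dots> = 1 / (b - a) * \<bar>x - y\<bar>"
    using assms by (simp add: diff_divide_distrib[symmetric] abs_divide abs_minus_commute)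
  finally show "\<bar>cts_step a b x - cts_step a b y\<bar> \<le> 1 / (b - a) * \<bar>x - y\<bar>" .
  show "\<bar>cts_step a b y\<bar> \<le> 1" using assms by (auto simp: cts_step_def divide_le_eq)
qed (use assms in auto)

lemma adm_growth:
  assumes "adm L C \<phi>"
  shows "\<bar>\<phi> x\<bar> \<le> (\<bar>\<phi> 0\<bar> + L) * (1 + \<bar>x\<bar>)"
proof -
  have "\<bar>\<phi> x\<bar> \<le> \<bar>\<phi> 0\<bar> + L * \<bar>x\<bar>" using admD(4)[OF assms, of x 0] by auto
  also have "\<dots> \<le> (\<bar>\<phi> 0\<bar> + L) * (1 + \<bar>x\<bar>)" using admD(2)[OF assms] by (simp add: algebra_simps)
  finally show ?thesis .
qed

section \<open>Solutions in the rescaled time\<close>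

lemma tendsto_inverse_sqrt_half: "((\<lambda>R. c / sqrt (R / 2)) \<longlongrightarrow> 0) at_top"
  by real_asymp

text \<open>\<open>(N + Mb) \<nu> t - Mb \<delta>\<^sub>0\<close> is the solution in the time variable \<open>\<tau>\<close> with \<open>d\<tau> = n dt\<close>, in
  which the factor \<open>n(t)\<close> disappears from the equation; it may be negative at the origin.\<close>

lemma rescaled_solution:
  fixes G0 :: "real measure" and T N E a0 :: real
  assumes sets: "sets G0 = sets borel" and fin: "finite_measure G0" and pos: "AE x in G0. 0 \<le> x"
    and int: "integrable G0 (\<lambda>x. x)" and a0: "a0 = measure G0 {0}" "0 < a0"
    and N: "N = measure G0 UNIV" and E: "E = (\<integral>x. x \<partial>G0)" and T: "0 < T"
  obtains Mb \<eta> \<nu> where "0 < Mb"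
    "\<And>t. t \<in> {0..T} \<Longrightarrow> real_distribution (\<nu> t)"
    "\<And>t. t \<in> {0..T} \<Longrightarrow> AE x in \<nu> t. 0 \<le> x"
    "\<And>t. t \<in> {0..T} \<Longrightarrow> tails \<eta> (\<nu> t)"
    "\<And>t. t \<in> {0..T} \<Longrightarrow> (N + Mb) * (\<integral>x. x \<partial>\<nu> t) = E"
    "\<nu> 0 = density G0 (\<lambda>x. ennreal (if x = 0 then (a0 + Mb) / (a0 * (N + Mb)) else 1 / (N + Mb)))"
    "\<And>s t. (\<And>n. s n \<in> {0..T}) \<Longrightarrow> t \<in> {0..T} \<Longrightarrow> s \<longlonglongrightarrow> t \<Longrightarrow> weak_conv_m (\<lambda>n. \<nu> (s n)) (\<nu> t)"
    "\<And>\<phi> t. tame \<phi> \<Longrightarrow> t \<in> {0..T} \<Longrightarrow>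
       ((\<lambda>t. (N + Mb) * (\<integral>x. \<phi> x \<partial>\<nu> t)) has_real_derivative rate (N + Mb) \<phi> (\<nu> t)) (at t within {0..T})"
proof -
  interpret G0: finite_measure G0 by fact
  have sp: "space G0 = UNIV" using sets_eq_imp_space_eq[OF sets] by simp
  have meas: "f \<in> borel_measurable G0 \<longleftrightarrow> f \<in> borel_measurable borel" for f :: "real \<Rightarrow> real"
    using measurable_cong_sets[OF sets refl] by blast
  have aN: "a0 \<le> N" unfolding a0 N using sp by (metis G0.bounded_measure)
  have Npos: "0 < N" using a0 aN by simp
  have E0: "0 \<le> E" unfolding E using pos by (rule integral_nonneg_AE)
  define Mb where "Mb = exp T * (N + E)"
  have Mb: "0 < Mb" unfolding Mb_def using Npos E0 by (intro mult_pos_pos) auto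
  define m where "m = N + Mb"
  have m: "0 < m" using Npos Mb by (simp add: m_def)
  define h :: "nat \<Rightarrow> real" where "h k = 1 / real (Suc k)" for k
  define K :: "nat \<Rightarrow> nat" where "K k = (Suc k)\<^sup>2" for k
  have h: "0 < h k" "h k \<le> 1" for k by (auto simp: h_def)
  have Kh: "real (K k) * h k = real (Suc k)" for k
    by (simp only: K_def h_def power2_eq_square of_nat_mult) simp
  have K: "0 < K k" for k by (simp add: K_def)
  \<comment> \<open>The time step will be \<open>1 / D k\<close>: the first two summands give the
    stability condition, the last one forces the step to zero.\<close>
  define D where "D k = 4 * Mb / h k + sqrt (real (K k) * h k) + real (Suc k)" for k
  have D: "real (Suc k) \<le> D k" "0 < D k" for k
  proof -
    have "0 \<le> 4 * Mb / h k + sqrt (real (K k) * h k)" using Mb h[of k] by auto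
    then show "real (Suc k) \<le> D k" "0 < D k" unfolding D_def by linarith+
  qed
  define \<delta> where "\<delta> k = 1 / D k" for k
  have \<delta>: "0 < \<delta> k" "\<delta> k \<le> 1 / real (Suc k)" for k
    using D[of k] by (auto simp: \<delta>_def intro!: divide_left_mono mult_pos_pos simp del: of_nat_Suc)
  have lim1: "(\<lambda>k. 1 / real (Suc k)) \<longlonglongrightarrow> 0"
    using LIMSEQ_inverse_real_of_nat by (simp add: inverse_eq_divide)
  have \<delta>lim: "\<delta> \<longlonglongrightarrow> 0"
    by (rule tendsto_sandwich[OF _ _ tendsto_const lim1]) (use \<delta> in \<open>auto simp: less_imp_le simp del: of_nat_Suc\<close>)
  define w0 where "w0 k = cell_mass G0 (h k) (K k)" for k
  have dp: "dpair (K k) f (w0 k) = (\<integral>x. f (cell (h k) (K k) x) \<partial>G0)" for k f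
    unfolding w0_def by (rule dpair_cell_mass[OF sets fin])
  have cm: "(\<lambda>x. f (cell (h k) (K k) x) :: real) \<in> borel_measurable G0" for k f
    by (rule cell_measurable[OF sets])
  have cle: "real (cell (h k) (K k) x) * h k \<le> x" if "0 \<le> x" for k x
    by (rule cell_le[OF h(1) that])
  have clim: "(\<lambda>k. real (cell (h k) (K k) x) * h k) \<longlonglongrightarrow> x" if "0 \<le> x" for x
    using cell_tendsto[OF that] by (simp add: h_def K_def)
  have ci: "integrable G0 (\<lambda>x. real (cell (h k) (K k) x) * h k)" for k
    by (rule Bochner_Integration.integrable_bound[OF int cm]) (use pos cle h in \<open>auto simp: less_imp_le\<close>)
  interpret S: euler "h k" "\<delta> k" T N E Mb "K k" "w0 k" for k
  proof
    show "0 \<le> w0 k i" for i unfolding w0_def cell_mass_def by (rule Bochner_Integration.integral_nonneg) auto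
    show "dpair (K k) (\<lambda>_. 1) (w0 k) = N" unfolding dp using N sp by simp
    show "dpair (K k) (\<lambda>i. real i * h k) (w0 k) \<le> E"
      unfolding dp E by (rule integral_mono_AE[OF ci int]) (use pos cle in auto)
    show "\<delta> k * (4 * Mb / h k + sqrt (real (K k) * h k)) \<le> 1"
      using D[of k] by (simp add: \<delta>_def divide_le_eq D_def)
  qed (use h \<delta> K in \<open>auto simp: Mb_def\<close>)
  have Sm: "S.m = m" by (simp add: S.m_def m_def)
  define \<mu> where "\<mu> k t = S.mu k t" for k t
  have T0: "0 \<in> {0..T}" using T by simp
  have rd: "real_distribution (\<mu> k t)" if "t \<in> {0..T}" for k t
    unfolding \<mu>_def by (rule S.mu_real_distribution[OF Npos that])
  \<comment> \<open>The initial tails plus what can be produced up to time \<open>T\<close>,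
    normalised by \<open>m\<close>: one modulus for all meshes and times.\<close>
  define \<eta> where "\<eta> R = ((\<integral>x. max 0 (\<bar>x\<bar> - R) \<partial>G0) + T * (Mb * (Mb + E) / sqrt (R / 2))) / m" for R
  have \<eta>lim: "(\<eta> \<longlongrightarrow> 0) at_top"
  proof -
    have "((\<lambda>R. \<integral>x. max 0 (\<bar>x\<bar> - R) \<partial>G0) \<longlongrightarrow> (\<integral>x. 0 \<partial>G0)) at_top"
    proof (rule integral_dominated_convergence_at_top[where w="\<lambda>x. \<bar>x\<bar>"])
      show "AE x in G0. ((\<lambda>R. max 0 (\<bar>x\<bar> - R)) \<longlongrightarrow> 0) at_top"
      proof (rule AE_I2)
        fix x :: real
        have "\<forall>\<^sub>F R in at_top. 0 = max 0 (\<bar>x\<bar> - R)"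
          using eventually_ge_at_top[of "\<bar>x\<bar>"] by eventually_elim auto
        then show "((\<lambda>R. max 0 (\<bar>x\<bar> - R)) \<longlongrightarrow> 0) at_top" by (rule Lim_transform_eventually[OF tendsto_const])
      qed
      show "\<forall>\<^sub>F R in at_top. AE x in G0. norm (max 0 (\<bar>x\<bar> - R)) \<le> \<bar>x\<bar>"
        using eventually_ge_at_top[of 0] by eventually_elim auto
      show "(\<lambda>x. max 0 (\<bar>x\<bar> - R)) \<in> borel_measurable G0" for R :: real
        unfolding meas by measurable
      show "integrable G0 (\<lambda>x. \<bar>x\<bar>)" using int by (rule integrable_abs)
    qed simp
    moreover have "((\<lambda>R. T * (Mb * (Mb + E) / sqrt (R / 2))) \<longlongrightarrow> T * 0) at_top"
      by (intro tendsto_intros tendsto_inverse_sqrt_half)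
    ultimately have "((\<lambda>R. ((\<integral>x. max 0 (\<bar>x\<bar> - R) \<partial>G0) + T * (Mb * (Mb + E) / sqrt (R / 2))) / m) \<longlongrightarrow> (0 + 0) / m) at_top"
      using m by (intro tendsto_intros) auto
    then show ?thesis by (simp add: \<eta>_def[abs_def])
  qed
  have tl: "tails \<eta> (\<mu> k t)" if t: "t \<in> {0..T}" for k t
    unfolding tails_def
  proof (intro conjI allI impI)
    show "integrable (\<mu> k t) (\<lambda>x. x)" unfolding \<mu>_def by (rule S.mu_integrable[OF Npos t]) simp
    fix R :: real assume R: "0 < R"
    have "dpair (K k) (\<lambda>i. max 0 (real i * h k - R)) (w0 k) \<le> (\<integral>x. max 0 (\<bar>x\<bar> - R) \<partial>G0)"
      unfolding dp
    proof (rule integral_mono_AE)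
      show i: "integrable G0 (\<lambda>x. max 0 (\<bar>x\<bar> - R))" using int by auto
      have AEle: "AE x in G0. max 0 (real (cell (h k) (K k) x) * h k - R) \<le> max 0 (\<bar>x\<bar> - R)"
        using pos
      proof eventually_elim
        fix x :: real assume "0 \<le> x"
        then show "max 0 (real (cell (h k) (K k) x) * h k - R) \<le> max 0 (\<bar>x\<bar> - R)"
          using cle[of x k] by (intro max.mono) auto
      qed
      show "AE x in G0. max 0 (real (cell (h k) (K k) x) * h k - R) \<le> max 0 (\<bar>x\<bar> - R)" by (rule AEle)
      show "integrable G0 (\<lambda>x. max 0 (real (cell (h k) (K k) x) * h k - R))"
        by (rule Bochner_Integration.integrable_bound[OF i cm]) (use AEle in auto)
    qed
    with S.mu_tail[OF Npos t R, of k] show "(\<integral>x. max 0 (\<bar>x\<bar> - R) \<partial>\<mu> k t) \<le> \<eta> R"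
      using m unfolding \<eta>_def \<mu>_def Sm by (simp add: pos_le_divide_eq mult.commute)
  qed
  define BB where "BB L C = 2 * L * Mb * Mb + C * (Mb + E) + (4 * L * Mb * E + 2 * L * (Mb + E))" for L C
  have bnd: "S.bnd k L C \<le> BB L C" if "0 \<le> L" for k L C
  proof -
    have "4 * L * Mb * E / real (Suc k) \<le> 4 * L * Mb * E / 1"
      using that Mb E0 by (intro divide_left_mono) auto
    moreover have "2 * L * h k * (Mb + E) \<le> 2 * L * 1 * (Mb + E)"
      using that Mb E0 h by (intro mult_right_mono mult_left_mono) auto
    ultimately show ?thesis unfolding S.bnd_def BB_def Kh by simp
  qed
  have BB0: "0 \<le> BB L C" if "adm L C \<phi>" for L C \<phi>
    unfolding BB_def using admD(2,3)[OF that] Mb E0 by auto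
  have eqc: "\<bar>m * (\<integral>x. \<phi> x \<partial>\<mu> k s) - m * (\<integral>x. \<phi> x \<partial>\<mu> k t)\<bar> \<le> BB L C * (\<bar>s - t\<bar> + 2 * \<delta> k)"
    if "adm L C \<phi>" "s \<in> {0..T}" "t \<in> {0..T}" for \<phi> L C k s t
  proof -
    have "\<bar>m * (\<integral>x. \<phi> x \<partial>\<mu> k s) - m * (\<integral>x. \<phi> x \<partial>\<mu> k t)\<bar> \<le> S.bnd k L C * (\<bar>s - t\<bar> + 2 * \<delta> k)"
      using S.mu_equicontinuous[OF Npos that(2,3,1), of k] unfolding Sm \<mu>_def .
    also have "\<dots> \<le> BB L C * (\<bar>s - t\<bar> + 2 * \<delta> k)"
      using bnd[OF admD(2)[OF that(1)]] \<delta>(1)[of k] by (intro mult_right_mono) auto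
    finally show ?thesis .
  qed
  obtain r \<nu>' where r: "strict_mono (r :: nat \<Rightarrow> nat)"
    and rd': "\<And>t. t \<in> {0..T} \<Longrightarrow> real_distribution (\<nu>' t)"
    and wc': "\<And>t. t \<in> {0..T} \<Longrightarrow> weak_conv_m (\<lambda>k. \<mu> (r k) t) (\<nu>' t)"
  proof (rule weak_compactness_curves[of T \<mu> \<eta> "\<lambda>k. 2 * \<delta> k"])
    show "(\<lambda>k. 2 * \<delta> k) \<longlonglongrightarrow> 0" using tendsto_mult_right_zero[OF \<delta>lim] by simp
    fix a b :: real assume ab: "a < b"
    show "\<exists>C. \<forall>k. \<forall>s\<in>{0..T}. \<forall>t\<in>{0..T}.
        \<bar>(\<integral>x. cts_step a b x \<partial>\<mu> k s) - (\<integral>x. cts_step a b x \<partial>\<mu> k t)\<bar> \<le> C * (\<bar>s - t\<bar> + 2 * \<delta> k)"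
    proof (intro exI[of _ "BB (1 / (b - a)) (4 * 1) / m"] allI ballI)
      fix k s t assume "s \<in> {0..T}" "t \<in> {0..T}"
      from eqc[OF adm_cts_step[OF ab] this, of k]
      have "m * \<bar>(\<integral>x. cts_step a b x \<partial>\<mu> k s) - (\<integral>x. cts_step a b x \<partial>\<mu> k t)\<bar>
          \<le> BB (1 / (b - a)) (4 * 1) * (\<bar>s - t\<bar> + 2 * \<delta> k)"
        using m by (simp add: abs_mult flip: right_diff_distrib)
      then show "\<bar>(\<integral>x. cts_step a b x \<partial>\<mu> k s) - (\<integral>x. cts_step a b x \<partial>\<mu> k t)\<bar>
          \<le> BB (1 / (b - a)) (4 * 1) / m * (\<bar>s - t\<bar> + 2 * \<delta> k)"
        using m by (simp add: pos_le_divide_eq mult.commute)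
    qed
  qed (use T rd tl in auto)
  \<comment> \<open>This is \<open>G0\<close> plus \<open>Mb\<close> times the Dirac mass at the
    origin, divided by \<open>m\<close>. Using this explicit measure at time 0, instead of an
    abstract weak limit, makes the solution start at \<open>G0\<close> as an equality of
    measures.\<close>
  define \<nu>0 where "\<nu>0 = density G0 (\<lambda>x. ennreal (if x = 0 then (a0 + Mb) / (a0 * m) else 1 / m))"
  have coef: "0 \<le> (a0 + Mb) / (a0 * m)" "0 \<le> 1 / m" using a0 Mb m by auto
  have rd0: "real_distribution \<nu>0"
    unfolding \<nu>0_def
  proof (rule real_distribution_density_atom[OF sets fin coef])
    have "1 / m * N + ((a0 + Mb) / (a0 * m) - 1 / m) * a0 = (N + Mb) / m"
      using a0(2) m by (simp add: field_simps)
    also have "\<dots> = 1" using m by (simp add: m_def)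
    finally show "1 / m * measure G0 UNIV + ((a0 + Mb) / (a0 * m) - 1 / m) * measure G0 {0} = 1"
      unfolding N a0(1) .
  qed
  have int0: "m * (\<integral>x. f x \<partial>\<nu>0) = (\<integral>x. f x \<partial>G0) + Mb * f 0" if "integrable G0 f" for f :: "real \<Rightarrow> real"
  proof -
    have "(\<integral>x. f x \<partial>\<nu>0) = 1 / m * (\<integral>x. f x \<partial>G0) + ((a0 + Mb) / (a0 * m) - 1 / m) * a0 * f 0"
      using integral_density_atom(2)[OF sets fin that coef] unfolding \<nu>0_def a0(1) .
    also have "((a0 + Mb) / (a0 * m) - 1 / m) * a0 = Mb / m" using a0(2) m by (simp add: field_simps)
    finally show ?thesis using m by (simp add: field_simps)
  qed
  have wc0: "weak_conv_m (\<lambda>k. \<mu> (r k) 0) \<nu>0"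
  proof (rule integral_cts_step_conv_imp_weak_conv[OF rd[OF T0] rd0])
    fix a b :: real assume ab: "a < b"
    note adm = adm_cts_step[OF ab]
    have c1: "\<bar>cts_step a b x\<bar> \<le> 1" for x using ab by (auto simp: cts_step_def divide_le_eq)
    have i: "integrable G0 (cts_step a b)"
    proof (rule G0.integrable_const_bound[of _ 1])
      show "cts_step a b \<in> borel_measurable G0" unfolding meas by (rule borel_measurable_adm[OF adm])
    qed (use c1 in simp)
    have eq: "m * (\<integral>x. cts_step a b x \<partial>\<mu> k 0) = (\<integral>x. cts_step a b (real (cell (h k) (K k) x) * h k) \<partial>G0) + Mb * cts_step a b 0" for k
      using S.mu_integral[OF Npos T0 borel_measurable_adm[OF adm], of k] unfolding Sm \<mu>_def
      by (simp add: S.wt_def S.W_0 dp)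
    have "(\<lambda>k. \<integral>x. cts_step a b (real (cell (h k) (K k) x) * h k) \<partial>G0) \<longlonglongrightarrow> (\<integral>x. cts_step a b x \<partial>G0)"
    proof (rule integral_dominated_convergence[where w="\<lambda>_. 1"])
      show "AE x in G0. (\<lambda>k. cts_step a b (real (cell (h k) (K k) x) * h k)) \<longlonglongrightarrow> cts_step a b x"
        using pos by eventually_elim (rule isCont_tendsto_compose[OF isCont_adm[OF adm] clim])
      show "(\<lambda>x. cts_step a b (real (cell (h k) (K k) x) * h k)) \<in> borel_measurable G0" for k by (rule cm)
      show "cts_step a b \<in> borel_measurable G0" using i by (rule borel_measurable_integrable)
      show "AE x in G0. norm (cts_step a b (real (cell (h k) (K k) x) * h k)) \<le> 1" for k using c1 by simp
    qed simp
    then have "(\<lambda>k. m * (\<integral>x. cts_step a b x \<partial>\<mu> k 0)) \<longlonglongrightarrow> m * (\<integral>x. cts_step a b x \<partial>\<nu>0)"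
      unfolding eq int0[OF i] by (intro tendsto_intros)
    then have "(\<lambda>k. (\<integral>x. cts_step a b x \<partial>\<mu> k 0)) \<longlonglongrightarrow> (\<integral>x. cts_step a b x \<partial>\<nu>0)"
      using m tendsto_mult_left_iff[of m] by auto
    from LIMSEQ_subseq_LIMSEQ[OF this r]
    show "(\<lambda>n. integral\<^sup>L (\<mu> (r n) 0) (cts_step a b)) \<longlonglongrightarrow> integral\<^sup>L \<nu>0 (cts_step a b)" by (simp add: o_def)
  qed
  define \<nu> where "\<nu> t = (if t = 0 then \<nu>0 else \<nu>' t)" for t
  have rd\<nu>: "real_distribution (\<nu> t)" if "t \<in> {0..T}" for t
    using rd0 rd'[OF that] by (simp add: \<nu>_def)
  have wc: "weak_conv_m (\<lambda>k. \<mu> (r k) t) (\<nu> t)" if "t \<in> {0..T}" for t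
    using wc0 wc'[OF that] by (simp add: \<nu>_def)
  have tl\<nu>: "tails \<eta> (\<nu> t)" if "t \<in> {0..T}" for t
    by (rule tails_weak_limit[OF rd[OF that] rd\<nu>[OF that] wc[OF that] tl[OF that]])
  note lin = weak_conv_integral_linear_growth[OF rd rd\<nu> wc tl \<eta>lim]
  have conv: "(\<lambda>k. m * (\<integral>x. \<phi> x \<partial>\<mu> (r k) t)) \<longlonglongrightarrow> m * (\<integral>x. \<phi> x \<partial>\<nu> t)" if "adm L C \<phi>" "t \<in> {0..T}" for \<phi> L C t
    by (intro tendsto_intros lin[OF that(2) that(2) that(2) that(2) isCont_adm[OF that(1)] adm_growth[OF that(1)]])
  have lip: "\<bar>m * (\<integral>x. \<phi> x \<partial>\<nu> s) - m * (\<integral>x. \<phi> x \<partial>\<nu> t)\<bar> \<le> BB L C * \<bar>s - t\<bar>"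
    if "adm L C \<phi>" "s \<in> {0..T}" "t \<in> {0..T}" for \<phi> L C s t
  proof (rule tendsto_le[OF _ _ tendsto_rabs[OF tendsto_diff[OF conv[OF that(1,2)] conv[OF that(1,3)]]]])
    have "(\<lambda>k. \<delta> (r k)) \<longlonglongrightarrow> 0" using LIMSEQ_subseq_LIMSEQ[OF \<delta>lim r] by (simp add: o_def)
    then have "(\<lambda>k. BB L C * (\<bar>s - t\<bar> + 2 * \<delta> (r k))) \<longlonglongrightarrow> BB L C * (\<bar>s - t\<bar> + 2 * 0)"
      by (intro tendsto_intros)
    then show "(\<lambda>k. BB L C * (\<bar>s - t\<bar> + 2 * \<delta> (r k))) \<longlonglongrightarrow> BB L C * \<bar>s - t\<bar>" by simp
  qed (use eqc[OF that] in auto)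
  have wcont: "weak_conv_m (\<lambda>n. \<nu> (s n)) (\<nu> t)"
    if s: "\<And>n. s n \<in> {0..T}" and t: "t \<in> {0..T}" and st: "s \<longlonglongrightarrow> t" for s t
  proof (rule integral_cts_step_conv_imp_weak_conv[OF rd\<nu>[OF s] rd\<nu>[OF t]])
    fix a b :: real assume ab: "a < b"
    note adm = adm_cts_step[OF ab]
    have "(\<lambda>n. m * (\<integral>x. cts_step a b x \<partial>\<nu> (s n))) \<longlonglongrightarrow> m * (\<integral>x. cts_step a b x \<partial>\<nu> t)"
    proof (rule LIM_zero_cancel, rule Lim_null_comparison)
      show "\<forall>\<^sub>F n in sequentially. norm (m * (\<integral>x. cts_step a b x \<partial>\<nu> (s n)) - m * (\<integral>x. cts_step a b x \<partial>\<nu> t))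
          \<le> BB (1 / (b - a)) (4 * 1) * \<bar>s n - t\<bar>"
        using lip[OF adm s t] by auto
      show "(\<lambda>n. BB (1 / (b - a)) (4 * 1) * \<bar>s n - t\<bar>) \<longlonglongrightarrow> 0"
        using st by (intro tendsto_mult_right_zero tendsto_rabs_zero LIM_zero)
    qed
    then show "(\<lambda>n. integral\<^sup>L (\<nu> (s n)) (cts_step a b)) \<longlonglongrightarrow> integral\<^sup>L (\<nu> t) (cts_step a b)"
      using m tendsto_mult_left_iff[of m] by auto
  qed
  have pos\<nu>: "AE x in \<nu> t. 0 \<le> x" if t: "t \<in> {0..T}" for t
  proof -
    interpret real_distribution "\<nu> t" by (rule rd\<nu>[OF t])
    \<comment> \<open>A bounded continuous function that is positive exactly on the negative
      half-line carries the support condition to the weak limit.\<close>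
    let ?f = "\<lambda>x::real. max 0 (min 1 (- x))"
    have f: "isCont ?f x" "\<bar>?f x\<bar> \<le> 1" for x by (auto intro!: continuous_intros)
    have "(\<lambda>k. integral\<^sup>L (\<mu> (r k) t) ?f) \<longlonglongrightarrow> integral\<^sup>L (\<nu> t) ?f"
      using weak_conv_imp_integral_bdd_continuous_conv[OF rd[OF t] rd\<nu>[OF t] wc[OF t], of ?f 1] f by auto
    moreover have "integral\<^sup>L (\<mu> k t) ?f = 0" for k
    proof (rule integral_eq_zero_AE)
      show "AE x in \<mu> k t. ?f x = 0"
        using S.mu_AE[OF Npos t, of k] unfolding \<mu>_def by eventually_elim auto
    qed
    ultimately have "integral\<^sup>L (\<nu> t) ?f = 0" by (simp add: LIMSEQ_const_iff)
    then have "AE x in \<nu> t. ?f x = 0"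
      by (subst (asm) integral_nonneg_eq_0_iff_AE[OF integrable_continuous_bounded[OF f]]) auto
    then show ?thesis by eventually_elim (auto simp: max_def split: if_splits)
  qed
  have en\<nu>: "m * (\<integral>x. x \<partial>\<nu> t) = E" if t: "t \<in> {0..T}" for t
  proof -
    have "(\<lambda>k. m * (\<integral>x. x \<partial>\<mu> (r k) t)) \<longlonglongrightarrow> m * (\<integral>x. x \<partial>\<nu> t)"
      by (intro tendsto_intros lin[OF t t t t, of "\<lambda>x. x" 1]) auto
    moreover have "(\<lambda>k. m * (\<integral>x. x \<partial>\<mu> k t)) \<longlonglongrightarrow> E"
    proof -
      have "m * (\<integral>x. x \<partial>\<mu> k t) = (\<integral>x. real (cell (h k) (K k) x) * h k \<partial>G0)" for k
        using S.mu_integral[OF Npos t, of "\<lambda>x. x" k] unfolding Sm \<mu>_def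
        by (simp add: S.wt_def S.energy_W dp)
      moreover have "(\<lambda>k. \<integral>x. real (cell (h k) (K k) x) * h k \<partial>G0) \<longlonglongrightarrow> E"
        unfolding E
      proof (rule integral_dominated_convergence[where w="\<lambda>x. \<bar>x\<bar>"])
        show "AE x in G0. (\<lambda>k. real (cell (h k) (K k) x) * h k) \<longlonglongrightarrow> x"
          using pos by eventually_elim (rule clim)
        show "AE x in G0. norm (real (cell (h k) (K k) x) * h k) \<le> \<bar>x\<bar>" for k
          using pos by eventually_elim (use cle h(1)[of k] in \<open>auto simp: less_imp_le\<close>)
        show "(\<lambda>x. real (cell (h k) (K k) x) * h k) \<in> borel_measurable G0" for k by (rule cm)
        show "integrable G0 (\<lambda>x. \<bar>x\<bar>)" using int by (rule integrable_abs)
        show "(\<lambda>x. x) \<in> borel_measurable G0" unfolding meas by simp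
      qed
      ultimately show ?thesis by simp
    qed
    from LIMSEQ_subseq_LIMSEQ[OF this r] have "(\<lambda>k. m * (\<integral>x. x \<partial>\<mu> (r k) t)) \<longlonglongrightarrow> E" by (simp add: o_def)
    ultimately show ?thesis using LIMSEQ_unique by blast
  qed
  have der: "((\<lambda>t. m * (\<integral>x. \<phi> x \<partial>\<nu> t)) has_real_derivative rate m \<phi> (\<nu> t)) (at t within {0..T})"
    if \<phi>: "tame \<phi>" and t: "t \<in> {0..T}" for \<phi> t
  proof -
    obtain L C where a: "adm L C \<phi>" using \<phi> unfolding tame_def by blast
    define q where "q k s = dQ (h k) (K k) (\<lambda>i. \<phi> (real i * h k)) (S.wt k s)" for k s
    \<comment> \<open>Continuity of the limiting rate will upgrade the integrated equation to
      differentiability at every time of \<open>{0..T}\<close>.\<close>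
    have rc: "continuous_on {0..T} (\<lambda>s. rate m \<phi> (\<nu> s))"
      unfolding continuous_on_sequentially o_def
    proof (intro allI ballI impI, elim conjE)
      fix s t assume "t \<in> {0..T}" "\<forall>n. s n \<in> {0..T}" "s \<longlonglongrightarrow> t"
      then show "(\<lambda>n. rate m \<phi> (\<nu> (s n))) \<longlonglongrightarrow> rate m \<phi> (\<nu> t)"
        by (intro rate_tendsto[OF _ _ _ _ \<eta>lim \<phi>] wcont rd\<nu> tl\<nu>) auto
    qed
    have qlim: "(\<lambda>k. q (r k) s) \<longlonglongrightarrow> rate m \<phi> (\<nu> s)" if s: "s \<in> {0..T}" for s
    proof -
      have 1: "(\<lambda>k. rate m \<phi> (\<mu> (r k) s)) \<longlonglongrightarrow> rate m \<phi> (\<nu> s)"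
        by (rule rate_tendsto[OF rd[OF s] rd\<nu>[OF s] wc[OF s] tl[OF s] \<eta>lim \<phi>])
      have "(\<lambda>k. q k s - rate m \<phi> (\<mu> k s)) \<longlonglongrightarrow> 0"
      proof (rule Lim_null_comparison)
        show "\<forall>\<^sub>F k in sequentially. norm (q k s - rate m \<phi> (\<mu> k s))
            \<le> 4 * L * Mb * E / real (Suc k) + 2 * L * (1 / real (Suc k)) * (Mb + E)"
        proof (intro always_eventually allI)
          fix k
          show "norm (q k s - rate m \<phi> (\<mu> k s)) \<le> 4 * L * Mb * E / real (Suc k) + 2 * L * (1 / real (Suc k)) * (Mb + E)"
            using S.mu_dQ[OF Npos s \<phi> a, of k] unfolding q_def \<mu>_def Sm Kh real_norm_def
            unfolding h_def .
        qed
        have "(\<lambda>k. 4 * L * Mb * E * (1 / real (Suc k)) + 2 * L * (1 / real (Suc k)) * (Mb + E)) \<longlonglongrightarrow> 4 * L * Mb * E * 0 + 2 * L * 0 * (Mb + E)"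
          by (intro tendsto_intros lim1)
        then show "(\<lambda>k. 4 * L * Mb * E / real (Suc k) + 2 * L * (1 / real (Suc k)) * (Mb + E)) \<longlonglongrightarrow> 0" by simp
      qed
      from LIMSEQ_subseq_LIMSEQ[OF this r]
      have "(\<lambda>k. q (r k) s - rate m \<phi> (\<mu> (r k) s)) \<longlonglongrightarrow> 0" by (simp add: o_def)
      from tendsto_add[OF this 1] show ?thesis by simp
    qed
    have F: "m * (\<integral>x. \<phi> x \<partial>\<nu> t) = m * (\<integral>x. \<phi> x \<partial>\<nu> 0) + integral {0..t} (\<lambda>s. rate m \<phi> (\<nu> s))"
      if t: "t \<in> {0..T}" for t
    proof -
      have "(\<lambda>k. integral {0..t} (q (r k))) \<longlonglongrightarrow> integral {0..t} (\<lambda>s. rate m \<phi> (\<nu> s))"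
      proof (rule dominated_convergence(2)[where h="\<lambda>_. BB L C"])
        show "q (r k) integrable_on {0..t}" for k
          using S.mu_evolution(1)[OF Npos t a, of "r k"] unfolding q_def[abs_def] .
        show "norm (q (r k) s) \<le> BB L C" if "s \<in> {0..t}" for k s
        proof -
          have "s \<in> {0..T}" using that t by auto
          from S.dQ_bnd[OF Npos this a, of "r k"] bnd[OF admD(2)[OF a], of "r k" C] show ?thesis
            by (simp add: q_def)
        qed
        show "(\<lambda>k. q (r k) s) \<longlonglongrightarrow> rate m \<phi> (\<nu> s)" if "s \<in> {0..t}" for s
          using that t by (intro qlim) auto
      qed auto
      then have 1: "(\<lambda>k. m * (\<integral>x. \<phi> x \<partial>\<mu> (r k) t) - m * (\<integral>x. \<phi> x \<partial>\<mu> (r k) 0) - integral {0..t} (q (r k)))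
          \<longlonglongrightarrow> m * (\<integral>x. \<phi> x \<partial>\<nu> t) - m * (\<integral>x. \<phi> x \<partial>\<nu> 0) - integral {0..t} (\<lambda>s. rate m \<phi> (\<nu> s))"
        by (intro tendsto_diff conv[OF a t] conv[OF a T0])
      have "(\<lambda>k. m * (\<integral>x. \<phi> x \<partial>\<mu> k t) - m * (\<integral>x. \<phi> x \<partial>\<mu> k 0) - integral {0..t} (q k)) \<longlonglongrightarrow> 0"
      proof (rule Lim_null_comparison)
        have "\<bar>m * (\<integral>x. \<phi> x \<partial>\<mu> k t) - m * (\<integral>x. \<phi> x \<partial>\<mu> k 0) - integral {0..t} (q k)\<bar> \<le> BB L C * \<delta> k" for k
        proof -
          have "S.bnd k L C * \<delta> k \<le> BB L C * \<delta> k"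
            using bnd[OF admD(2)[OF a]] \<delta>(1)[of k] by (intro mult_right_mono) auto
          with S.mu_evolution(2)[OF Npos t a, of k] show ?thesis
            unfolding q_def[abs_def] \<mu>_def Sm by linarith
        qed
        then show "\<forall>\<^sub>F k in sequentially. norm (m * (\<integral>x. \<phi> x \<partial>\<mu> k t) - m * (\<integral>x. \<phi> x \<partial>\<mu> k 0) - integral {0..t} (q k)) \<le> BB L C * \<delta> k"
          by auto
        show "(\<lambda>k. BB L C * \<delta> k) \<longlonglongrightarrow> 0" by (intro tendsto_mult_right_zero \<delta>lim)
      qed
      from LIMSEQ_subseq_LIMSEQ[OF this r]
      have "(\<lambda>k. m * (\<integral>x. \<phi> x \<partial>\<mu> (r k) t) - m * (\<integral>x. \<phi> x \<partial>\<mu> (r k) 0) - integral {0..t} (q (r k))) \<longlonglongrightarrow> 0"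
        by (simp add: o_def)
      from LIMSEQ_unique[OF 1 this] show ?thesis by simp
    qed
    have "((\<lambda>t. m * (\<integral>x. \<phi> x \<partial>\<nu> 0) + integral {0..t} (\<lambda>s. rate m \<phi> (\<nu> s))) has_real_derivative 0 + rate m \<phi> (\<nu> t)) (at t within {0..T})"
      by (intro DERIV_add DERIV_const integral_has_real_derivative[OF rc t])
    then have "((\<lambda>t. m * (\<integral>x. \<phi> x \<partial>\<nu> 0) + integral {0..t} (\<lambda>s. rate m \<phi> (\<nu> s))) has_real_derivative rate m \<phi> (\<nu> t)) (at t within {0..T})"
      by simp
    then show ?thesis
      by (rule has_field_derivative_transform_within[OF _ zero_less_one t]) (rule F[symmetric])
  qed
  show ?thesis
  proof (rule that[OF Mb rd\<nu> pos\<nu> tl\<nu> en\<nu>[unfolded m_def] _ wcont der[unfolded m_def]])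
    show "\<nu> 0 = density G0 (\<lambda>x. ennreal (if x = 0 then (a0 + Mb) / (a0 * (N + Mb)) else 1 / (N + Mb)))"
      unfolding \<nu>_def \<nu>0_def m_def if_P[OF refl] ..
  qed
qed

section \<open>A truncated power as test function\<close>

lemma powr_le_affine:
  assumes "0 \<le> \<theta>" "\<theta> \<le> 1" "0 \<le> (s::real)"
  shows "s powr \<theta> \<le> 1 + \<theta> * (s - 1)"
proof (cases "s = 0")
  case False
  then have "s powr \<theta> * 1 powr (1 - \<theta>) \<le> \<theta> * s + (1 - \<theta>) * 1"
    using assms by (intro Youngs_inequality_0) auto
  then show ?thesis by (simp add: algebra_simps)
qed (use assms in auto)

text \<open>The concave inequality is applied to \<open>s powr p\<close> with exponent
  \<open>1 / p\<close>, and the result is solved for \<open>s powr p\<close>.\<close>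

lemma powr_ge_affine:
  assumes "1 \<le> p" "0 \<le> (s::real)"
  shows "1 + p * (s - 1) \<le> s powr p"
proof -
  have "(s powr p) powr (1 / p) \<le> 1 + 1 / p * (s powr p - 1)"
    using assms by (intro powr_le_affine) auto
  also have "(s powr p) powr (1 / p) = s" using assms by (simp add: powr_powr)
  finally have "p * s \<le> p * (1 + 1 / p * (s powr p - 1))" using assms by (intro mult_left_mono) auto
  also have "\<dots> = p + s powr p - 1" using assms by (simp add: algebra_simps)
  finally show ?thesis by (simp add: algebra_simps)
qed

text \<open>Homogeneity reduces to \<open>t = y / x\<close>. The constant is the chord of the convex
  power between 1 and 2: it gives
  \<open>(1 + t) powr \<alpha> \<le> 1 + t * (2 powr \<alpha> - 1)\<close>, and
  \<open>(1 - t) powr \<alpha> \<le> 1 - t\<close>. Finally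
  \<open>t \<le> t powr (\<alpha> / 2)\<close>, because \<open>\<alpha> \<le> 2\<close>.\<close>

lemma Lam_powr_le_2:
  assumes "1 < (\<alpha> :: real)" "\<alpha> \<le> 2" "0 < y" "y \<le> x"
  shows "(x + y) powr \<alpha> + (x - y) powr \<alpha> - 2 * x powr \<alpha> \<le> (2 powr \<alpha> - 2) * (x * y) powr (\<alpha> / 2)"
proof -
  define t where "t = y / x"
  have x: "0 < x" and t: "0 < t" "t \<le> 1" using assms by (auto simp: t_def)
  have y: "y = t * x" using x by (simp add: t_def)
  have "(1 + t) powr \<alpha> \<le> (1 - t) * 1 powr \<alpha> + t * 2 powr \<alpha>"
    using convex_onD[OF powr_convex[of \<alpha>], of t 1 2] assms t by (simp add: add.commute)
  moreover have "(1 - t) powr \<alpha> \<le> (1 - t) powr 1"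
    using t assms by (intro powr_mono') auto
  ultimately have *: "(1 + t) powr \<alpha> + (1 - t) powr \<alpha> - 2 \<le> t * (2 powr \<alpha> - 2)"
    using t by (simp add: algebra_simps)
  have "t powr 1 \<le> t powr (\<alpha> / 2)" using t assms by (intro powr_mono') auto
  moreover have "2 powr 1 \<le> (2::real) powr \<alpha>" using assms by (intro powr_mono) auto
  ultimately have "t * (2 powr \<alpha> - 2) \<le> t powr (\<alpha> / 2) * (2 powr \<alpha> - 2)"
    using t by (intro mult_right_mono) auto
  with * have "x powr \<alpha> * ((1 + t) powr \<alpha> + (1 - t) powr \<alpha> - 2) \<le> x powr \<alpha> * (t powr (\<alpha> / 2) * (2 powr \<alpha> - 2))"
    by (intro mult_left_mono) auto
  moreover have "(x + y) powr \<alpha> = x powr \<alpha> * (1 + t) powr \<alpha>" "(x - y) powr \<alpha> = x powr \<alpha> * (1 - t) powr \<alpha>"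
    using x t unfolding y by (simp_all add: algebra_simps flip: powr_mult)
  moreover have "(x * y) powr (\<alpha> / 2) = x powr \<alpha> * t powr (\<alpha> / 2)"
    using x t unfolding y by (simp add: powr_mult flip: powr_add)
  ultimately show ?thesis by (simp add: algebra_simps)
qed

text \<open>The difference of the two sides vanishes at 0 together with its first derivative. Its
  second derivative is nonnegative because \<open>\<alpha> - 2\<close> lies between 0 and 1, so by
  concavity \<open>(1 + z) powr (\<alpha> - 2) + (1 - z) powr (\<alpha> - 2) \<le>
  2\<close>.\<close>

lemma powr_second_difference_le:
  assumes "2 < \<alpha>" "\<alpha> \<le> 3" "0 \<le> z" "z \<le> (1::real)"
  shows "(1 + z) powr \<alpha> + (1 - z) powr \<alpha> - 2 \<le> \<alpha> * (\<alpha> - 1) * z\<^sup>2"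
proof -
  define f where "f z = \<alpha> * (\<alpha> - 1) * z\<^sup>2 + 2 - (1 + z) powr \<alpha> - (1 - z) powr \<alpha>" for z :: real
  define g where "g z = 2 * \<alpha> * (\<alpha> - 1) * z - \<alpha> * (1 + z) powr (\<alpha> - 1) + \<alpha> * (1 - z) powr (\<alpha> - 1)" for z :: real
  have df: "(f has_real_derivative g z) (at z)" if "0 \<le> z" "z < 1" for z
  proof -
    have "((\<lambda>z. (1 + z) powr \<alpha>) has_real_derivative \<alpha> * (1 + z) powr (\<alpha> - 1) * 1) (at z)"
      by (rule DERIV_chain2[OF has_real_derivative_powr]) (use that in \<open>auto intro!: derivative_eq_intros\<close>)
    moreover have "((\<lambda>z. (1 - z) powr \<alpha>) has_real_derivative \<alpha> * (1 - z) powr (\<alpha> - 1) * (-1)) (at z)"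
      by (rule DERIV_chain2[OF has_real_derivative_powr]) (use that in \<open>auto intro!: derivative_eq_intros\<close>)
    ultimately have "((\<lambda>z. \<alpha> * (\<alpha> - 1) * z\<^sup>2 + 2 - (1 + z) powr \<alpha> - (1 - z) powr \<alpha>) has_real_derivative
        (\<alpha> * (\<alpha> - 1) * (2 * z) + 0 - \<alpha> * (1 + z) powr (\<alpha> - 1) * 1 - \<alpha> * (1 - z) powr (\<alpha> - 1) * (-1))) (at z)"
      by (intro DERIV_diff DERIV_add DERIV_const) (auto intro!: derivative_eq_intros)
    then show ?thesis by (simp add: f_def[abs_def] g_def algebra_simps)
  qed
  have dg: "(g has_real_derivative \<alpha> * (\<alpha> - 1) * (2 - (1 + z) powr (\<alpha> - 2) - (1 - z) powr (\<alpha> - 2))) (at z)"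
    if "0 \<le> z" "z < 1" for z
  proof -
    have "((\<lambda>z. (1 + z) powr (\<alpha> - 1)) has_real_derivative (\<alpha> - 1) * (1 + z) powr (\<alpha> - 1 - 1) * 1) (at z)"
      by (rule DERIV_chain2[OF has_real_derivative_powr]) (use that in \<open>auto intro!: derivative_eq_intros\<close>)
    moreover have "((\<lambda>z. (1 - z) powr (\<alpha> - 1)) has_real_derivative (\<alpha> - 1) * (1 - z) powr (\<alpha> - 1 - 1) * (-1)) (at z)"
      by (rule DERIV_chain2[OF has_real_derivative_powr]) (use that in \<open>auto intro!: derivative_eq_intros\<close>)
    ultimately have "((\<lambda>z. 2 * \<alpha> * (\<alpha> - 1) * z - \<alpha> * (1 + z) powr (\<alpha> - 1) + \<alpha> * (1 - z) powr (\<alpha> - 1)) has_real_derivative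
        (2 * \<alpha> * (\<alpha> - 1) * 1 - \<alpha> * ((\<alpha> - 1) * (1 + z) powr (\<alpha> - 1 - 1) * 1) + \<alpha> * ((\<alpha> - 1) * (1 - z) powr (\<alpha> - 1 - 1) * (-1)))) (at z)"
      by (intro DERIV_diff DERIV_add DERIV_cmult DERIV_ident)
    moreover have "\<alpha> - 1 - 1 = \<alpha> - 2" by simp
    ultimately show ?thesis by (simp add: g_def[abs_def] algebra_simps)
  qed
  have g0: "0 \<le> g z" if "0 \<le> z" "z < 1" for z
  proof -
    have "g 0 \<le> g z"
    proof (rule DERIV_nonneg_imp_nondecreasing[OF that(1)])
      fix u assume u: "0 \<le> u" "u \<le> z"
      have "(1 + u) powr (\<alpha> - 2) \<le> 1 + (\<alpha> - 2) * (1 + u - 1)" "(1 - u) powr (\<alpha> - 2) \<le> 1 + (\<alpha> - 2) * (1 - u - 1)"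
        using u that assms powr_le_affine[of "\<alpha> - 2" "1 + u"] powr_le_affine[of "\<alpha> - 2" "1 - u"]
        by simp_all
      then have "0 \<le> 2 - (1 + u) powr (\<alpha> - 2) - (1 - u) powr (\<alpha> - 2)" by (simp add: algebra_simps)
      then have "0 \<le> \<alpha> * (\<alpha> - 1) * (2 - (1 + u) powr (\<alpha> - 2) - (1 - u) powr (\<alpha> - 2))"
        using assms by (intro mult_nonneg_nonneg) auto
      moreover have "u < 1" using u that by simp
      ultimately show "\<exists>y. (g has_real_derivative y) (at u) \<and> 0 \<le> y" using dg u by blast
    qed
    then show ?thesis by (simp add: g_def)
  qed
  have "f 0 \<le> f z"
  \<comment> \<open>The derivative formulas are available only for \<open>z < 1\<close>; the end
    point \<open>z = 1\<close> is reached by continuity.\<close>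
  proof (rule DERIV_nonneg_imp_increasing_open[OF assms(3)])
    fix u assume "0 < u" "u < z"
    then have "0 \<le> u" "u < 1" using assms by auto
    then show "\<exists>y. (f has_real_derivative y) (at u) \<and> 0 \<le> y" using df g0 by blast
  next
    show "continuous_on {0..z} f"
      unfolding f_def using assms by (intro continuous_intros continuous_on_powr') auto
  qed
  then show ?thesis by (simp add: f_def)
qed

text \<open>After scaling, the quadratic bound is weakened by
  \<open>t powr 2 \<le> t powr (\<alpha> / 2)\<close> to obtain the symmetric form
  \<open>(x * y) powr (\<alpha> / 2)\<close>, which factorises in the double integral.\<close>

lemma Lam_powr_le_3:
  assumes "2 < (\<alpha> :: real)" "\<alpha> \<le> 3" "0 < y" "y \<le> x"
  shows "(x + y) powr \<alpha> + (x - y) powr \<alpha> - 2 * x powr \<alpha> \<le> \<alpha> * (\<alpha> - 1) * (x * y) powr (\<alpha> / 2)"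
proof -
  define t where "t = y / x"
  have x: "0 < x" and t: "0 < t" "t \<le> 1" using assms by (auto simp: t_def)
  have y: "y = t * x" using x by (simp add: t_def)
  have "t powr 2 \<le> t powr (\<alpha> / 2)" using t assms by (intro powr_mono') auto
  then have "t\<^sup>2 \<le> t powr (\<alpha> / 2)" using t by simp
  then have "\<alpha> * (\<alpha> - 1) * t\<^sup>2 \<le> \<alpha> * (\<alpha> - 1) * t powr (\<alpha> / 2)"
    using assms by (intro mult_left_mono) auto
  with powr_second_difference_le[OF assms(1,2), of t] t
  have "x powr \<alpha> * ((1 + t) powr \<alpha> + (1 - t) powr \<alpha> - 2) \<le> x powr \<alpha> * (\<alpha> * (\<alpha> - 1) * t powr (\<alpha> / 2))"
    by (intro mult_left_mono) auto
  moreover have "(x + y) powr \<alpha> = x powr \<alpha> * (1 + t) powr \<alpha>" "(x - y) powr \<alpha> = x powr \<alpha> * (1 - t) powr \<alpha>"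
    using x t unfolding y by (simp_all add: algebra_simps flip: powr_mult)
  moreover have "(x * y) powr (\<alpha> / 2) = x powr \<alpha> * t powr (\<alpha> / 2)"
    using x t unfolding y by (simp add: powr_mult flip: powr_add)
  ultimately show ?thesis by (simp add: algebra_simps)
qed

lemma C1alpha_pos: "1 < \<alpha> \<Longrightarrow> 0 < C1alpha \<alpha>"
proof -
  assume a: "1 < \<alpha>"
  have "2 powr 1 < (2::real) powr \<alpha>" using a by (intro powr_less_mono) auto
  then show ?thesis using a by (simp add: C1alpha_def)
qed

lemma Lam_powr_le:
  assumes "1 < \<alpha>" "\<alpha> \<le> 3" "0 < x" "0 < y"
  shows "Lam (\<lambda>x. x powr \<alpha>) x y \<le> C1alpha \<alpha> * (x * y) powr (\<alpha> / 2)"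
proof -
  have *: "(x + y) powr \<alpha> + (x - y) powr \<alpha> - 2 * x powr \<alpha> \<le> C1alpha \<alpha> * (x * y) powr (\<alpha> / 2)"
    if "0 < y" "y \<le> x" for x y
    using Lam_powr_le_2[of \<alpha> y x] Lam_powr_le_3[of \<alpha> y x] that assms(1,2) by (simp add: C1alpha_def)
  show ?thesis
    using *[of y x] *[of x y] assms(3,4) by (cases "y \<le> x") (simp_all add: Lam_def max_def algebra_simps)
qed

section \<open>A continuously differentiable continuation with linear growth\<close>

lemma DERIV_If_le:
  fixes f g :: "real \<Rightarrow> real"
  assumes f: "\<And>x. a \<le> x \<Longrightarrow> x \<le> R \<Longrightarrow> (f has_real_derivative f' x) (at x within {a..R})"
    and g: "\<And>x. R \<le> x \<Longrightarrow> (g has_real_derivative g' x) (at x within {R..})"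
    and eq: "f R = g R" "f' R = g' R" and aR: "a < R" and x: "a \<le> x"
  shows "((\<lambda>x. if x \<le> R then f x else g x) has_real_derivative (if x \<le> R then f' x else g' x)) (at x within {a..})"
proof -
  have cl: "closure {a..R} \<inter> closure {R<..} = {R}" using aR by auto
  have u: "{a..R} \<union> {R} = {a..R}" "{R<..} \<union> {R} = {R..}" "{a..} = {a..R} \<union> {R<..}" using aR by auto
  have "((\<lambda>x. if x \<in> {a..R} then f x else g x) has_vector_derivative (if x \<in> {a..R} then f' x else g' x)) (at x within {a..})"
  proof (rule has_vector_derivative_If_within_closures[of x "{a..R}" "{R<..}"])
    show "(f has_vector_derivative f' x) (at x within {a..R} \<union> (closure {a..R} \<inter> closure {R<..}))"
      if "x \<in> {a..R} \<union> (closure {a..R} \<inter> closure {R<..})"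
      using that f unfolding cl u by (auto simp: has_real_derivative_iff_has_vector_derivative)
    show "(g has_vector_derivative g' x) (at x within {R<..} \<union> (closure {a..R} \<inter> closure {R<..}))"
      if "x \<in> {R<..} \<union> (closure {a..R} \<inter> closure {R<..})"
      using that g unfolding cl u by (auto simp: has_real_derivative_iff_has_vector_derivative)
    show "f x = g x" "f' x = g' x" if "x \<in> closure {a..R}" "x \<in> closure {R<..}"
      using that eq aR by auto
  qed (use x aR in auto)
  then have "((\<lambda>x. if x \<in> {a..R} then f x else g x) has_real_derivative (if x \<le> R then f' x else g' x)) (at x within {a..})"
    using x by (simp add: has_real_derivative_iff_has_vector_derivative)
  then show ?thesis
    by (rule has_field_derivative_transform_within[OF _ zero_less_one]) (use x in auto)
qed

lemma DERIV_powr_nonneg: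
  assumes "1 < a" "0 \<le> x"
  shows "((\<lambda>x. x powr a) has_real_derivative a * x powr (a - 1)) (at x within {0..})"
proof (cases "x = 0")
  case True
  have "((\<lambda>y. y powr (a - 1)) \<longlongrightarrow> 0 powr (a - 1)) (at 0 within {0..})"
    using assms by (intro tendsto_powr2) (auto simp: eventually_at_filter intro!: tendsto_intros)
  moreover have "\<forall>\<^sub>F y in at (0::real) within {0..}. y powr (a - 1) = (y powr a - 0 powr a) / (y - 0)"
    unfolding eventually_at_filter by (auto simp: powr_diff)
  ultimately show ?thesis
    unfolding has_field_derivative_iff True using assms by (simp add: tendsto_cong)
next
  case False
  then show ?thesis
    by (intro has_field_derivative_at_within[OF has_real_derivative_powr]) (use assms in auto)
qed

locale truncated_power =
  fixes \<alpha> R :: real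
  assumes \<alpha>: "1 < \<alpha>" "\<alpha> \<le> 3" and R: "0 < R"
begin

text \<open>\<open>c\<close> is the factor in \<open>L0\<close> of the power, which equals
  \<open>c * x powr (\<alpha> + 1)\<close>. \<open>B\<close> is chosen so that \<open>L0\<close> of
  the continuation has the leading term \<open>c * R powr (\<alpha> - 1 / 2) * (x * sqrt x)\<close>,
  which matches that value at \<open>R\<close>; \<open>A\<close> and \<open>d\<close> are then
  forced by matching the slope and the value at \<open>R\<close>.\<close>

definition c where "c = (\<alpha> - 1) / (\<alpha> + 1)"
definition d where "d = \<alpha> - 1 - 3 * c / 2"
definition A where "A = (\<alpha> + 3 * c / 2) * R powr (\<alpha> - 1)"
definition B where "B = 3 * c * R powr (\<alpha> - 1 / 2)"

text \<open>The continuation beyond \<open>R\<close> grows linearly, with second derivative decaying like \<open>x powr (- 3/2)\<close>: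
  this is slow enough for \<open>L0 pw x / sqrt x\<close> to dominate \<open>x\<close> at infinity.\<close>

definition pw :: "real \<Rightarrow> real" where
  "pw x = (if x \<le> R then x powr \<alpha> else A * x - B * sqrt x - d * R powr \<alpha>)"

definition pw' :: "real \<Rightarrow> real" where
  "pw' x = (if x \<le> R then \<alpha> * x powr (\<alpha> - 1) else A - B / (2 * sqrt x))"

definition L0pw :: "real \<Rightarrow> real" where
  "L0pw x = (if x \<le> R then c * x powr (\<alpha> + 1)
     else c * R powr (\<alpha> - 1 / 2) * (x * sqrt x) + d * R powr \<alpha> * (x - R))"

lemma c: "0 < c" "c < 1" "c * (\<alpha> + 1) = \<alpha> - 1" "2 * c \<le> \<alpha> - 1"
proof -
  show 1: "0 < c" "c < 1" "c * (\<alpha> + 1) = \<alpha> - 1" using \<alpha> by (auto simp: c_def)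
  have "c * 2 \<le> c * (\<alpha> + 1)" using 1 \<alpha> by (intro mult_left_mono) auto
  then show "2 * c \<le> \<alpha> - 1" using 1 by simp
qed

lemma d_nonneg: "0 \<le> d"
  using c by (simp add: d_def)

lemma B_nonneg: "0 \<le> B"
  using c by (simp add: B_def)

lemma powr_R: "R powr (\<alpha> - 1) * R = R powr \<alpha>" "R powr (\<alpha> - 1 / 2) * sqrt R = R powr \<alpha>"
    "R powr (\<alpha> - 1 / 2) / sqrt R = R powr (\<alpha> - 1)"
  using R by (auto simp: powr_diff powr_half_sqrt)

lemma pw_R: "R powr \<alpha> = A * R - B * sqrt R - d * R powr \<alpha>"
proof -
  have "A * R = (\<alpha> + 3 * c / 2) * R powr \<alpha>" unfolding A_def mult.assoc powr_R ..
  moreover have "B * sqrt R = 3 * c * R powr \<alpha>" unfolding B_def mult.assoc powr_R ..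
  ultimately show ?thesis by (simp add: d_def algebra_simps)
qed

lemma pw'_R: "\<alpha> * R powr (\<alpha> - 1) = A - B / (2 * sqrt R)"
proof -
  have "B / (2 * sqrt R) = 3 * c / 2 * (R powr (\<alpha> - 1 / 2) / sqrt R)" by (simp add: B_def)
  then show ?thesis unfolding powr_R A_def by (simp add: algebra_simps)
qed

lemma pw_DERIV: "0 \<le> x \<Longrightarrow> (pw has_real_derivative pw' x) (at x within {0..})"
  unfolding pw_def[abs_def] pw'_def
proof (rule DERIV_If_le[where a=0 and R=R and x=x and f="\<lambda>x. x powr \<alpha>" and f'="\<lambda>x. \<alpha> * x powr (\<alpha> - 1)"
      and g="\<lambda>x. A * x - B * sqrt x - d * R powr \<alpha>" and g'="\<lambda>x. A - B / (2 * sqrt x)", OF _ _ pw_R pw'_R R])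
  show "((\<lambda>x. x powr \<alpha>) has_real_derivative \<alpha> * x powr (\<alpha> - 1)) (at x within {0..R})" if "0 \<le> x" for x
    by (rule DERIV_subset[OF DERIV_powr_nonneg]) (use \<alpha> that in auto)
  show "((\<lambda>x. A * x - B * sqrt x - d * R powr \<alpha>) has_real_derivative A - B / (2 * sqrt x)) (at x within {R..})" if "R \<le> x" for x
    using R that by (auto intro!: derivative_eq_intros simp: field_simps)
qed

lemma pw'_cont: "continuous_on {0..} pw'"
proof -
  have "continuous_on ({0..R} \<union> {R..}) (\<lambda>x. if x \<le> R then \<alpha> * x powr (\<alpha> - 1) else A - B / (2 * sqrt x))"
    using \<alpha> R pw'_R by (intro continuous_on_If) (auto intro!: continuous_intros continuous_on_powr')
  moreover have "{0..R} \<union> {R..} = {0..}" using R by auto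
  ultimately show ?thesis by (simp add: pw'_def[abs_def])
qed

lemma pw'_bounds: "0 \<le> x \<Longrightarrow> \<bar>pw' x\<bar> \<le> A"
proof (cases "x \<le> R")
  case True
  assume "0 \<le> x"
  then have "\<alpha> * x powr (\<alpha> - 1) \<le> \<alpha> * R powr (\<alpha> - 1)"
    using True \<alpha> by (intro mult_left_mono powr_mono2) auto
  also have "\<dots> \<le> A" unfolding A_def using c by (intro mult_right_mono) auto
  finally show ?thesis using True \<alpha> by (simp add: pw'_def)
next
  case False
  then have "B / (2 * sqrt x) \<le> B / (2 * sqrt R)"
    using R B_nonneg by (intro divide_left_mono) auto
  also have "\<dots> \<le> A" using pw'_R \<alpha> powr_ge_zero[of R "\<alpha> - 1"] mult_nonneg_nonneg[of \<alpha> "R powr (\<alpha> - 1)"] by linarith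
  finally show ?thesis using False B_nonneg R by (simp add: pw'_def)
qed

text \<open>Beyond \<open>R\<close> the negative square root term is absorbed by
  \<open>2 * sqrt (R * x) \<le> x + R\<close>, the inequality of arithmetic and geometric
  means.\<close>

lemma pw_bounds:
  assumes "0 \<le> x"
  shows "0 \<le> pw x"
proof (cases "x \<le> R")
  case False
  have "2 * (sqrt R * sqrt x) \<le> x + R"
    using False R sum_squares_bound[of "sqrt R" "sqrt x"] by simp
  then have "3 * c / 2 * R powr (\<alpha> - 1) * (2 * (sqrt R * sqrt x)) \<le> 3 * c / 2 * R powr (\<alpha> - 1) * (x + R)"
    using c by (intro mult_left_mono) auto
  moreover have "B * sqrt x = 3 * c / 2 * R powr (\<alpha> - 1) * (2 * (sqrt R * sqrt x))"
  proof -
    have "R powr (\<alpha> - 1 / 2) = R powr (\<alpha> - 1) * sqrt R"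
      using R by (simp add: powr_half_sqrt[symmetric] flip: powr_add)
    then show ?thesis by (simp add: B_def)
  qed
  moreover have "A * x = \<alpha> * (R powr (\<alpha> - 1) * x) + 3 * c / 2 * R powr (\<alpha> - 1) * x"
    by (simp add: A_def algebra_simps)
  moreover have "R powr (\<alpha> - 1) * R \<le> R powr (\<alpha> - 1) * x" using False by (intro mult_left_mono) auto
  then have "\<alpha> * (R powr (\<alpha> - 1) * R) \<le> \<alpha> * (R powr (\<alpha> - 1) * x)"
    by (rule mult_left_mono) (use \<alpha> in simp)
  then have "\<alpha> * R powr \<alpha> \<le> \<alpha> * (R powr (\<alpha> - 1) * x)" by (simp only: powr_R)
  moreover have "3 * c / 2 * R powr (\<alpha> - 1) * (x + R) = 3 * c / 2 * R powr (\<alpha> - 1) * x + 3 * c / 2 * R powr \<alpha>"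
    unfolding distrib_left mult.assoc powr_R ..
  moreover have "d * R powr \<alpha> = \<alpha> * R powr \<alpha> - R powr \<alpha> - 3 * c / 2 * R powr \<alpha>"
    by (simp add: d_def algebra_simps)
  moreover have "0 \<le> R powr \<alpha>" by simp
  ultimately have "0 \<le> A * x - B * sqrt x - d * R powr \<alpha>" by linarith
  then show ?thesis using False by (simp add: pw_def)
qed (simp add: pw_def)

text \<open>For a function vanishing at 0, differentiating \<open>x * \<phi> x\<close> minus twice
  the primitive gives \<open>x * \<phi>' x - \<phi> x\<close>. The closed form \<open>L0pw\<close>
  is checked against this identity on both pieces.\<close>

lemma L0pw_DERIV: "0 \<le> x \<Longrightarrow> (L0pw has_real_derivative x * pw' x - pw x) (at x within {0..})"
proof -
  assume x: "0 \<le> x"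
  have "(L0pw has_real_derivative (if x \<le> R then (\<alpha> - 1) * x powr \<alpha> else B / 2 * sqrt x + d * R powr \<alpha>)) (at x within {0..})"
    unfolding L0pw_def[abs_def]
  proof (rule DERIV_If_le[OF _ _ _ _ R x])
    show "((\<lambda>x. c * x powr (\<alpha> + 1)) has_real_derivative (\<alpha> - 1) * x powr \<alpha>) (at x within {0..R})" if "0 \<le> x" for x
    proof -
      have "((\<lambda>x. c * x powr (\<alpha> + 1)) has_real_derivative c * ((\<alpha> + 1) * x powr (\<alpha> + 1 - 1))) (at x within {0..R})"
        by (rule DERIV_cmult[OF DERIV_subset[OF DERIV_powr_nonneg]]) (use \<alpha> that in auto)
      moreover have "c * ((\<alpha> + 1) * x powr (\<alpha> + 1 - 1)) = (\<alpha> - 1) * x powr \<alpha>"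
        unfolding mult.assoc[symmetric] c by simp
      ultimately show ?thesis by (simp only:)
    qed
    show "((\<lambda>x. c * R powr (\<alpha> - 1 / 2) * (x * sqrt x) + d * R powr \<alpha> * (x - R)) has_real_derivative B / 2 * sqrt x + d * R powr \<alpha>) (at x within {R..})"
      if "R \<le> x" for x
    proof -
      have "((\<lambda>x. x * sqrt x) has_real_derivative 3 / 2 * sqrt x) (at x within {R..})"
        using R that by (auto intro!: derivative_eq_intros simp: field_simps)
      then have "((\<lambda>x. c * R powr (\<alpha> - 1 / 2) * (x * sqrt x) + d * R powr \<alpha> * (x - R)) has_real_derivative
          c * R powr (\<alpha> - 1 / 2) * (3 / 2 * sqrt x) + d * R powr \<alpha> * (1 - 0)) (at x within {R..})"
        by (intro DERIV_add DERIV_cmult DERIV_diff DERIV_ident DERIV_const)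
      then show ?thesis by (simp add: B_def algebra_simps)
    qed
    show "c * R powr (\<alpha> + 1) = c * R powr (\<alpha> - 1 / 2) * (R * sqrt R) + d * R powr \<alpha> * (R - R)"
      using R powr_R(2) by (simp add: powr_add algebra_simps)
    have "B / 2 * sqrt R = 3 * c / 2 * R powr \<alpha>"
      using powr_R(2) by (simp add: B_def)
    then show "(\<alpha> - 1) * R powr \<alpha> = B / 2 * sqrt R + d * R powr \<alpha>" by (simp add: d_def algebra_simps)
  qed
  moreover have "x * pw' x - pw x = (if x \<le> R then (\<alpha> - 1) * x powr \<alpha> else B / 2 * sqrt x + d * R powr \<alpha>)"
  proof (cases "x \<le> R")
    case True
    have "x * x powr (\<alpha> - 1) = x powr \<alpha>"
      using x by (cases "x = 0") (auto simp: powr_diff)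
    then show ?thesis using True by (simp add: pw_def pw'_def algebra_simps)
  next
    case False
    have "x * (B / (2 * sqrt x)) = B / 2 * (x / sqrt x)" by simp
    also have "x / sqrt x = sqrt x" using x by (rule real_div_sqrt)
    finally have "x * pw' x = A * x - B / 2 * sqrt x"
      using False by (simp only: pw'_def if_False right_diff_distrib mult.commute[of x A])
    then show ?thesis using False by (simp add: pw_def)
  qed
  ultimately show ?thesis by simp
qed

lemma L0_pw: "0 \<le> x \<Longrightarrow> L0 pw x = L0pw x"
proof -
  assume x: "0 \<le> x"
  \<comment> \<open>This is the definition of \<open>L0\<close> solved for the integral: if
    \<open>L0pw\<close> is correct, \<open>F\<close> must be the primitive of \<open>pw\<close>, and
    that can be verified by differentiation.\<close>
  define F where "F x = (x * pw x - L0pw x) / 2" for x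
  have "(pw has_integral F x - F 0) {0..x}"
  proof (rule fundamental_theorem_of_calculus[OF x])
    fix y assume y: "y \<in> {0..x}"
    have "(F has_real_derivative (1 * pw y + pw' y * y - (y * pw' y - pw y)) / 2) (at y within {0..})"
      unfolding F_def[abs_def]
      by (intro DERIV_cdivide DERIV_diff DERIV_mult DERIV_ident pw_DERIV L0pw_DERIV) (use y in auto)
    then have "(F has_real_derivative pw y) (at y within {0..})" by (simp add: algebra_simps)
    then have "(F has_real_derivative pw y) (at y within {0..x})"
      by (rule DERIV_subset) auto
    then show "(F has_vector_derivative pw y) (at y within {0..x})"
      by (simp add: has_real_derivative_iff_has_vector_derivative)
  qed
  moreover have "F 0 = 0" "pw 0 = 0" using R by (auto simp: F_def L0pw_def pw_def)
  ultimately show ?thesis by (simp add: L0_def integral_unique F_def field_simps)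
qed

lemma L0pw_le: "0 \<le> x \<Longrightarrow> \<bar>L0pw x\<bar> \<le> (c * R powr (\<alpha> - 1 / 2) + d * R powr \<alpha>) * (sqrt x * (1 + x))"
proof -
  assume x: "0 \<le> x"
  have 1: "0 \<le> c * R powr (\<alpha> - 1 / 2)" "0 \<le> d * R powr \<alpha>" using c d_nonneg by auto
  have 2: "sqrt x * x \<le> sqrt x * (1 + x)" using x by (intro mult_left_mono) auto
  show ?thesis
  proof (cases "x \<le> R")
    case True
    have "x powr (\<alpha> + 1) = x powr (\<alpha> - 1 / 2) * (sqrt x * x)"
      using x by (cases "x = 0") (auto simp: powr_half_sqrt[symmetric] powr_add[symmetric] powr_diff powr_add field_simps)
    also have "\<dots> \<le> R powr (\<alpha> - 1 / 2) * (sqrt x * x)"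
      using True x \<alpha> by (intro mult_right_mono powr_mono2) auto
    also have "\<dots> \<le> R powr (\<alpha> - 1 / 2) * (sqrt x * (1 + x))" by (rule mult_left_mono[OF 2]) simp
    finally have "c * x powr (\<alpha> + 1) \<le> c * (R powr (\<alpha> - 1 / 2) * (sqrt x * (1 + x)))"
      using c by (intro mult_left_mono) auto
    also have "\<dots> \<le> (c * R powr (\<alpha> - 1 / 2) + d * R powr \<alpha>) * (sqrt x * (1 + x))"
      using 1 x by (simp add: distrib_right)
    finally show ?thesis using True c by (simp add: L0pw_def)
  next
    case False
    have "c * R powr (\<alpha> - 1 / 2) * (x * sqrt x) \<le> c * R powr (\<alpha> - 1 / 2) * (sqrt x * (1 + x))"
      using 1 2 by (intro mult_left_mono) (auto simp: mult.commute)
    moreover have "d * R powr \<alpha> * (x - R) \<le> d * R powr \<alpha> * (sqrt x * (1 + x))"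
      using 1 R le_sqrt_mult[OF x] by (intro mult_left_mono) auto
    moreover have "0 \<le> c * R powr (\<alpha> - 1 / 2) * (x * sqrt x)" "0 \<le> d * R powr \<alpha> * (x - R)"
      using 1 x False by auto
    ultimately show ?thesis using False by (simp add: L0pw_def distrib_right)
  qed
qed

lemma pw_tame: "tame (\<lambda>x. pw (max 0 x))" "\<exists>L C. adm L C (\<lambda>x. pw (max 0 x))"
proof -
  have "0 \<le> c * R powr (\<alpha> - 1 / 2) + d * R powr \<alpha>" using c d_nonneg by simp
  note t = tame_max0[OF pw'_cont pw_DERIV pw'_bounds this]
  show "tame (\<lambda>x. pw (max 0 x))" "\<exists>L C. adm L C (\<lambda>x. pw (max 0 x))"
    using t L0pw_le L0_pw by auto
qed

text \<open>The excess of the power over \<open>pw\<close>. It is convex, so its own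
  \<open>Lam\<close> is nonnegative, and truncation can only lower \<open>Lam\<close> of the
  power.\<close>

definition u :: "real \<Rightarrow> real" where
  "u x = (if x \<le> R then 0 else x powr \<alpha> - A * x + B * sqrt x + d * R powr \<alpha>)"

definition u' :: "real \<Rightarrow> real" where
  "u' x = (if x \<le> R then 0 else \<alpha> * x powr (\<alpha> - 1) - A + B / (2 * sqrt x))"

lemma pw_u: "pw x = x powr \<alpha> - u x"
  by (simp add: pw_def u_def)

lemma u_DERIV: "(u has_real_derivative u' x) (at x)"
proof -
  define a where "a = min x R - 1"
  have a: "a < R" "a \<le> x" by (auto simp: a_def)
  have g: "((\<lambda>x. x powr \<alpha> - A * x + B * sqrt x + d * R powr \<alpha>) has_real_derivative \<alpha> * x powr (\<alpha> - 1) - A + B / (2 * sqrt x)) (at x within {R..})"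
    if "R \<le> x" for x
  proof -
    have "((\<lambda>x. x powr \<alpha>) has_real_derivative \<alpha> * x powr (\<alpha> - 1)) (at x within {R..})"
      by (rule has_field_derivative_at_within[OF has_real_derivative_powr]) (use that R in auto)
    moreover have "(sqrt has_real_derivative inverse (sqrt x) / 2) (at x within {R..})"
      by (rule has_field_derivative_at_within[OF DERIV_real_sqrt]) (use that R in auto)
    ultimately have "((\<lambda>x. x powr \<alpha> - A * x + B * sqrt x + d * R powr \<alpha>) has_real_derivative
       \<alpha> * x powr (\<alpha> - 1) - A * 1 + B * (inverse (sqrt x) / 2) + 0) (at x within {R..})"
      by (intro DERIV_add DERIV_diff DERIV_cmult DERIV_ident DERIV_const)
    then show ?thesis by (rule DERIV_cong) (simp add: inverse_eq_divide)
  qed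
  have "((\<lambda>x. if x \<le> R then 0 else x powr \<alpha> - A * x + B * sqrt x + d * R powr \<alpha>) has_real_derivative
     (if x \<le> R then 0 else \<alpha> * x powr (\<alpha> - 1) - A + B / (2 * sqrt x))) (at x within {a..})"
  proof (rule DERIV_If_le[where f="\<lambda>_. 0" and f'="\<lambda>_. 0" and R=R and a=a and x=x
        and g="\<lambda>x. x powr \<alpha> - A * x + B * sqrt x + d * R powr \<alpha>"
        and g'="\<lambda>x. \<alpha> * x powr (\<alpha> - 1) - A + B / (2 * sqrt x)", OF DERIV_const g _ _ a])
    show "0 = R powr \<alpha> - A * R + B * sqrt R + d * R powr \<alpha>" using pw_R by simp
    show "0 = \<alpha> * R powr (\<alpha> - 1) - A + B / (2 * sqrt R)" using pw'_R by simp
  qed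
  then have "(u has_real_derivative u' x) (at x within {a..})" by (simp add: u_def[abs_def] u'_def)
  moreover have "at x within {a..} = at x" by (rule at_within_interior) (simp add: a_def)
  ultimately show ?thesis by simp
qed

text \<open>Beyond \<open>R\<close> the second derivative of \<open>u\<close> is \<open>\<alpha> *
  (\<alpha> - 1) * z powr (\<alpha> - 2) - B / (4 * z * sqrt z)\<close>. Its sign reduces to
  \<open>3 / 4 * c \<le> \<alpha> * (\<alpha> - 1)\<close>, which follows from
  \<open>2 * c \<le> \<alpha> - 1\<close>.\<close>

lemma u'_mono:
  assumes "x \<le> y"
  shows "u' x \<le> u' y"
proof -
  have *: "\<alpha> * x powr (\<alpha> - 1) + B / (2 * sqrt x) \<le> \<alpha> * y powr (\<alpha> - 1) + B / (2 * sqrt y)"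
    if "R \<le> x" "x \<le> y" for x y
  proof (rule DERIV_nonneg_imp_nondecreasing[OF that(2)])
    fix z assume z: "x \<le> z" "z \<le> y"
    have z0: "0 < z" "R \<le> z" using z that R by auto
    have "((\<lambda>x. \<alpha> * x powr (\<alpha> - 1)) has_real_derivative \<alpha> * ((\<alpha> - 1) * z powr (\<alpha> - 1 - 1))) (at z)"
      by (intro DERIV_cmult has_real_derivative_powr z0)
    moreover have "((\<lambda>x. B / (2 * sqrt x)) has_real_derivative - (B / (4 * (z * sqrt z)))) (at z)"
    proof -
      have "((\<lambda>x. B / (2 * sqrt x)) has_real_derivative (0 * (2 * sqrt z) - B * (2 * (inverse (sqrt z) / 2))) / ((2 * sqrt z) * (2 * sqrt z))) (at z)"
        by (intro DERIV_divide DERIV_const DERIV_cmult DERIV_real_sqrt z0) (use z0 in auto)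
      moreover have "(0 * (2 * sqrt z) - B * (2 * (inverse (sqrt z) / 2))) / ((2 * sqrt z) * (2 * sqrt z)) = - (B / (4 * (z * sqrt z)))"
        using z0 by (simp add: field_simps)
      ultimately show ?thesis by simp
    qed
    ultimately have D: "((\<lambda>x. \<alpha> * x powr (\<alpha> - 1) + B / (2 * sqrt x)) has_real_derivative
        \<alpha> * ((\<alpha> - 1) * z powr (\<alpha> - 1 - 1)) + - (B / (4 * (z * sqrt z)))) (at z)" by (rule DERIV_add)
    have "B / 4 = 3 / 4 * c * R powr (\<alpha> - 1 / 2)" by (simp add: B_def)
    also have "\<dots> \<le> (\<alpha> * (\<alpha> - 1)) * z powr (\<alpha> - 1 / 2)"
    proof (rule mult_mono)
      have "3 / 4 * c \<le> 1 * (\<alpha> - 1)" using c(1,4) by simp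
      also have "\<dots> \<le> \<alpha> * (\<alpha> - 1)" by (rule mult_right_mono) (use \<alpha> in auto)
      finally show "3 / 4 * c \<le> \<alpha> * (\<alpha> - 1)" .
      show "R powr (\<alpha> - 1 / 2) \<le> z powr (\<alpha> - 1 / 2)" using \<alpha> z0 R by (intro powr_mono2) auto
    qed (use \<alpha> in auto)
    finally have "B / 4 / (z * sqrt z) \<le> (\<alpha> * (\<alpha> - 1)) * z powr (\<alpha> - 1 / 2) / (z * sqrt z)"
      using z0 by (intro divide_right_mono) auto
    also have "\<dots> = \<alpha> * ((\<alpha> - 1) * z powr (\<alpha> - 1 - 1))"
    proof -
      have "sqrt z * (z * sqrt z) = z\<^sup>2"
        using z0 by (simp add: power2_eq_square mult.left_commute)
      then show ?thesis using z0 by (simp add: powr_diff powr_half_sqrt)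
    qed
    finally show "\<exists>y. ((\<lambda>x. \<alpha> * x powr (\<alpha> - 1) + B / (2 * sqrt x)) has_real_derivative y) (at z) \<and> 0 \<le> y"
      using D by (intro exI conjI) auto
  qed
  show ?thesis
    using *[of R y] *[of x y] assms pw'_R by (auto simp: u'_def)
qed

lemma u_convex: "convex_on UNIV u"
  by (rule convex_on_realI[of _ _ u']) (use u_DERIV u'_mono in auto)

lemma u_nonneg: "0 \<le> u x"
proof (cases "x \<le> R")
  case False
  have "u R \<le> u x"
  proof (rule DERIV_nonneg_imp_nondecreasing[where f=u])
    fix z assume "R \<le> z" "z \<le> x"
    then have "0 \<le> u' z" using u'_mono[of R z] by (simp add: u'_def)
    then show "\<exists>y. (u has_real_derivative y) (at z) \<and> 0 \<le> y" using u_DERIV by blast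
  qed (use False in simp)
  then show ?thesis by (simp add: u_def)
qed (simp add: u_def)

lemma pw_le: "pw x \<le> x powr \<alpha>"
  using u_nonneg[of x] by (simp add: pw_u)

text \<open>\<open>max x y\<close> is the midpoint of \<open>x + y\<close> and
  \<open>\<bar>x - y\<bar>\<close>, so convexity of \<open>u\<close> gives
  \<open>Lam pw \<le> Lam\<close> of the power. Division by \<open>sqrt (x * y)\<close> lowers the
  exponent from \<open>\<alpha> / 2\<close> to \<open>(\<alpha> - 1) / 2\<close>.\<close>

lemma kap_pw_le:
  assumes "0 \<le> x" "0 \<le> y"
  shows "kap pw x y \<le> C1alpha \<alpha> * (x powr ((\<alpha> - 1) / 2) * y powr ((\<alpha> - 1) / 2))"
proof (cases "0 < x \<and> 0 < y")
  case True
  have "u (max x y) \<le> (u (x + y) + u \<bar>x - y\<bar>) / 2"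
  proof -
    have "max x y = (1 - 1/2) *\<^sub>R (x + y) + (1/2) *\<^sub>R \<bar>x - y\<bar>" by (auto simp: max_def abs_if field_simps)
    then show ?thesis using convex_onD[OF u_convex, of "1/2" "x + y" "\<bar>x - y\<bar>"] by simp
  qed
  then have "Lam pw x y \<le> Lam (\<lambda>x. x powr \<alpha>) x y" by (simp add: Lam_def pw_u)
  also have "\<dots> \<le> C1alpha \<alpha> * (x * y) powr (\<alpha> / 2)" using True \<alpha> by (intro Lam_powr_le) auto
  finally have "kap pw x y \<le> C1alpha \<alpha> * (x * y) powr (\<alpha> / 2) / sqrt (x * y)"
    using True by (simp add: kap_def divide_right_mono)
  also have "(x * y) powr (\<alpha> / 2) / sqrt (x * y) = (x * y) powr ((\<alpha> - 1) / 2)"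
    using True by (simp add: powr_half_sqrt[symmetric] diff_divide_distrib powr_diff)
  then have "C1alpha \<alpha> * (x * y) powr (\<alpha> / 2) / sqrt (x * y) = C1alpha \<alpha> * (x powr ((\<alpha> - 1) / 2) * y powr ((\<alpha> - 1) / 2))"
    using True by (simp add: powr_mult flip: times_divide_eq_right)
  finally show ?thesis .
next
  case False
  then show ?thesis using C1alpha_pos[OF \<alpha>(1)] by (auto simp: kap_def)
qed

text \<open>Up to \<open>R\<close> this is the tangent at \<open>M\<close> to the convex function
  \<open>x powr (\<alpha> + 1 / 2)\<close>. Beyond \<open>R\<close>, \<open>psi pw\<close> still
  grows at least with slope \<open>c * R powr (\<alpha> - 1 / 2)\<close>, which by assumption is no
  less than the slope of the tangent. So truncation does not spoil the tangent inequality.\<close>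

lemma psi_pw_ge:
  assumes x: "0 \<le> x" and M: "0 < M" "(\<alpha> + 1 / 2) * M powr (\<alpha> - 1 / 2) \<le> R powr (\<alpha> - 1 / 2)"
  shows "c * ((\<alpha> + 1 / 2) * M powr (\<alpha> - 1 / 2) * x - (\<alpha> - 1 / 2) * M powr (\<alpha> + 1 / 2)) \<le> psi pw x"
proof -
  let ?p = "\<alpha> + 1 / 2"
  have aff: "?p * M powr (\<alpha> - 1 / 2) * x - (\<alpha> - 1 / 2) * M powr ?p \<le> x powr ?p"
  proof -
    have "M powr ?p * (1 + ?p * (x / M - 1)) \<le> M powr ?p * (x / M) powr ?p"
      using x M \<alpha> by (intro mult_left_mono powr_ge_affine) auto
    also have "\<dots> = x powr ?p" using x M by (simp add: powr_divide)
    finally have "M powr ?p * (1 + ?p * (x / M - 1)) \<le> x powr ?p" .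
    moreover have "M powr (\<alpha> - 1 / 2) = M powr ?p / M"
    proof -
      have "M powr (\<alpha> - 1 / 2) = M powr (?p - 1)" by simp
      then show ?thesis using M by (simp only: powr_diff) simp
    qed
    moreover have "M powr ?p * (1 + ?p * (x / M - 1)) = ?p * (M powr ?p / M) * x - (\<alpha> - 1 / 2) * M powr ?p"
      using M by (simp add: field_simps)
    ultimately show ?thesis by simp
  qed
  show ?thesis
  proof (cases "x = 0")
    case True
    then show ?thesis using c \<alpha> by (simp add: psi_def)
  next
    case False
    with x have x0: "0 < x" by simp
    have ps: "psi pw x = L0pw x / sqrt x" using x0 by (simp add: psi_def L0_pw)
    show ?thesis
    proof (cases "x \<le> R")
      case True
      have "psi pw x = c * x powr ?p"
      proof -
        have "x powr (\<alpha> + 1) = x powr ?p * sqrt x"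
          using x0 by (simp add: powr_half_sqrt[symmetric] add.commute flip: powr_add)
        then show ?thesis unfolding ps using True x0 by (simp add: L0pw_def)
      qed
      then show ?thesis using aff c by (simp add: mult_left_mono)
    next
      case False
      have "c * (?p * M powr (\<alpha> - 1 / 2) * x - (\<alpha> - 1 / 2) * M powr ?p) \<le> c * (R powr (\<alpha> - 1 / 2) * x)"
      proof (intro mult_left_mono)
        have "?p * M powr (\<alpha> - 1 / 2) * x \<le> R powr (\<alpha> - 1 / 2) * x" using M x0 by (intro mult_right_mono) auto
        moreover have "0 \<le> (\<alpha> - 1 / 2) * M powr ?p" using \<alpha> by simp
        ultimately show "?p * M powr (\<alpha> - 1 / 2) * x - (\<alpha> - 1 / 2) * M powr ?p \<le> R powr (\<alpha> - 1 / 2) * x" by linarith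
      qed (use c in simp)
      also have "\<dots> = c * R powr (\<alpha> - 1 / 2) * (x * sqrt x) / sqrt x" using x0 by simp
      also have "\<dots> \<le> L0pw x / sqrt x"
        using False d_nonneg x0 by (intro divide_right_mono) (auto simp: L0pw_def)
      finally show ?thesis unfolding ps .
    qed
  qed
qed

end

section \<open>The change of time\<close>

text \<open>\<open>n\<close> may be discontinuous, but \<open>n\<close> plus a linear function is
  monotone, hence Borel measurable. Clamping the argument to the interval extends the monotonicity
  to the whole line.\<close>

lemma integrable_mono_plus_linear:
  fixes n :: "real \<Rightarrow> real"
  assumes mono: "\<And>s t. a \<le> s \<Longrightarrow> s \<le> t \<Longrightarrow> t \<le> b \<Longrightarrow> n s + C * s \<le> n t + C * t"
    and low: "0 < c" "\<And>s. a \<le> s \<Longrightarrow> s \<le> b \<Longrightarrow> c \<le> n s" and ab: "a \<le> b"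
  shows "(\<lambda>s. 1 / n s) integrable_on {a..b}"
proof -
  define cl where "cl s = max a (min s b)" for s
  have cl: "a \<le> cl s" "cl s \<le> b" "s \<le> t \<Longrightarrow> cl s \<le> cl t" for s t
    using ab by (auto simp: cl_def)
  have "mono (\<lambda>s. n (cl s) + C * cl s)"
    by (intro monoI mono cl)
  then have "(\<lambda>s. n (cl s) + C * cl s) \<in> borel_measurable borel" by (rule borel_measurable_mono)
  moreover have "(\<lambda>s. C * cl s) \<in> borel_measurable borel" unfolding cl_def by measurable
  ultimately have "(\<lambda>s. n (cl s) + C * cl s - C * cl s) \<in> borel_measurable borel"
    by (rule borel_measurable_diff)
  then have "(\<lambda>s. n (cl s)) \<in> borel_measurable borel" by simp
  then have meas: "(\<lambda>s. 1 / n (cl s)) \<in> borel_measurable borel" by simp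
  have "set_integrable lborel {a..b} (\<lambda>s. 1 / n (cl s))"
    unfolding set_integrable_def
  proof (rule integrableI_bounded_set_indicator[where B="1 / c"])
    show "AE x in lborel. x \<in> {a..b} \<longrightarrow> norm (1 / n (cl x)) \<le> 1 / c"
    proof (intro AE_I2 impI)
      fix x
      have "c \<le> n (cl x)" by (intro low(2) cl)
      then show "norm (1 / n (cl x)) \<le> 1 / c" using low(1) by (simp add: frac_le)
    qed
  qed (use meas ab in auto)
  then have "(\<lambda>s. 1 / n (cl s)) integrable_on {a..b}"
    by (rule set_borel_integral_eq_integral(1))
  then show ?thesis
    by (rule integrable_eq) (auto simp: cl_def)
qed

text \<open>The new time is \<open>t = \<integral> 1 / n\<close>; it exhausts \<open>[0,\<infinity>)\<close> because \<open>n s \<le> C (S - s)\<close>.\<close>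

lemma time_change:
  fixes n :: "real \<Rightarrow> real" and S C N :: real
  assumes S: "0 < S" and C: "0 < C" and N: "0 < N"
    and mono: "\<And>s t. 0 \<le> s \<Longrightarrow> s \<le> t \<Longrightarrow> t < S \<Longrightarrow> n s + C * s \<le> n t + C * t"
    and low: "\<And>t. 0 \<le> t \<Longrightarrow> t < S \<Longrightarrow> \<exists>c>0. \<forall>s\<in>{0..t}. c \<le> n s"
    and upp: "\<And>t. 0 \<le> t \<Longrightarrow> t < S \<Longrightarrow> n t \<le> N" "\<And>t. 0 \<le> t \<Longrightarrow> t < S \<Longrightarrow> n t \<le> C * (S - t)"
  obtains \<theta> X where "\<theta> 0 = 0" "\<And>t. 0 \<le> t \<Longrightarrow> 0 \<le> \<theta> t" "\<And>t. 0 \<le> t \<Longrightarrow> \<theta> t < S"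
    "\<And>s t. 0 \<le> s \<Longrightarrow> s \<le> t \<Longrightarrow> \<theta> s \<le> \<theta> t"
    "\<And>s t. 0 \<le> s \<Longrightarrow> s \<le> t \<Longrightarrow> \<theta> t - \<theta> s \<le> N * (t - s)"
    "(\<theta> \<longlongrightarrow> S) at_top" "countable X"
    "\<And>t. 0 < t \<Longrightarrow> t \<notin> X \<Longrightarrow> (\<theta> has_real_derivative n (\<theta> t)) (at t)"
proof -
  define f where "f s = 1 / n s" for s
  define F where "F \<tau> = integral {0..\<tau>} f" for \<tau>
  have npos: "0 < n s" if "0 \<le> s" "s < S" for s
    using low[OF that] that by (meson atLeastAtMost_iff less_le_trans order_refl)
  have int: "f integrable_on {a..b}" if ab: "0 \<le> a" "b < S" for a b
  proof (cases "a \<le> b")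
    case True
    obtain c where "0 < c" "\<And>s. s \<in> {0..b} \<Longrightarrow> c \<le> n s" using low[of b] ab True by auto
    then show ?thesis unfolding f_def[abs_def] using ab True
      by (intro integrable_mono_plus_linear[where C=C and c=c] mono) auto
  qed auto
  have Fdiff: "F b - F a = integral {a..b} f" if "0 \<le> a" "a \<le> b" "b < S" for a b
    using Henstock_Kurzweil_Integration.integral_combine[of 0 a b f] int[of 0 b] that by (simp add: F_def)
  have Flow: "(b - a) / N \<le> F b - F a" if ab: "0 \<le> a" "a \<le> b" "b < S" for a b
  proof -
    have "integral {a..b} (\<lambda>_. 1 / N) \<le> integral {a..b} f"
    proof (rule integral_le)
      fix x assume "x \<in> {a..b}"
      then show "1 / N \<le> f x" unfolding f_def
        using npos[of x] upp(1)[of x] ab by (intro divide_left_mono) auto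
    qed (use ab int in auto)
    then show ?thesis using Fdiff[OF ab] ab by simp
  qed
  have F0: "F 0 = 0" by (simp add: F_def)
  have Fstrict: "F a < F b" if "0 \<le> a" "a < b" "b < S" for a b
  proof -
    have "0 < (b - a) / N" using that N by simp
    then show ?thesis using Flow[of a b] that by linarith
  qed
  have Fcont: "continuous_on {0..b} F" if "b < S" for b
    unfolding F_def using int[of 0 b] that by (intro indefinite_integral_continuous_1) auto
  \<comment> \<open>Comparison with the primitive of \<open>1 / (C * (S - s))\<close>, whose
    logarithmic divergence at \<open>S\<close> makes the new time unbounded.\<close>
  have Flog: "ln (S / (S - \<tau>)) / C \<le> F \<tau>" if \<tau>: "0 \<le> \<tau>" "\<tau> < S" for \<tau>
  proof -
    have "((\<lambda>s. 1 / (C * (S - s))) has_integral (- ln (S - \<tau>) / C - (- ln (S - 0) / C))) {0..\<tau>}"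
    proof (rule fundamental_theorem_of_calculus[OF \<tau>(1)])
      fix s assume "s \<in> {0..\<tau>}"
      then show "((\<lambda>s. - ln (S - s) / C) has_vector_derivative 1 / (C * (S - s))) (at s within {0..\<tau>})"
        using \<tau> C unfolding has_real_derivative_iff_has_vector_derivative[symmetric]
        by (auto intro!: derivative_eq_intros simp: field_simps)
    qed
    moreover have "(f has_integral F \<tau>) {0..\<tau>}"
      unfolding F_def using int[of 0 \<tau>] \<tau> by (intro integrable_integral) auto
    ultimately have "- ln (S - \<tau>) / C - (- ln (S - 0) / C) \<le> F \<tau>"
    proof (rule has_integral_le)
      fix s assume "s \<in> {0..\<tau>}"
      then show "1 / (C * (S - s)) \<le> f s" unfolding f_def
        using npos[of s] upp(2)[of s] \<tau> C by (intro divide_left_mono) auto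
    qed
    moreover have "ln (S / (S - \<tau>)) = ln S - ln (S - \<tau>)" using S \<tau> by (simp add: ln_div)
    ultimately show ?thesis by (simp add: diff_divide_distrib)
  qed
  have ex: "\<exists>\<tau>. 0 \<le> \<tau> \<and> \<tau> < S \<and> F \<tau> = t" if t: "0 \<le> t" for t
  proof -
    \<comment> \<open>The point where the logarithmic lower bound equals \<open>t\<close>, so that
      the intermediate value theorem applies on \<open>{0..b}\<close>.\<close>
    define b where "b = S - S * exp (- (C * t))"
    have e: "0 < exp (- (C * t))" "exp (- (C * t)) \<le> 1" using t C by auto
    have b: "0 \<le> b" "b < S" using S e by (auto simp: b_def)
    have "S / (S - b) = exp (C * t)" using S by (simp add: b_def exp_minus field_simps)
    then have "t \<le> F b" using Flog[OF b] C by simp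
    then obtain x where "0 \<le> x" "x \<le> b" "F x = t"
      using IVT'[of F 0 t b] t b F0 Fcont[OF b(2)] by auto
    then show ?thesis using b by auto
  qed
  define \<theta> where "\<theta> t = (SOME \<tau>. 0 \<le> \<tau> \<and> \<tau> < S \<and> F \<tau> = t)" for t
  have \<theta>: "0 \<le> \<theta> t" "\<theta> t < S" "F (\<theta> t) = t" if "0 \<le> t" for t
    using someI_ex[OF ex[OF that]] unfolding \<theta>_def by auto
  have \<theta>mono: "\<theta> s \<le> \<theta> t" if "0 \<le> s" "s \<le> t" for s t
  proof (rule ccontr)
    assume "\<not> \<theta> s \<le> \<theta> t"
    then have "F (\<theta> t) < F (\<theta> s)" using \<theta>[of s] \<theta>[of t] that by (intro Fstrict) auto
    then show False using \<theta>[of s] \<theta>[of t] that by simp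
  qed
  have \<theta>lip: "\<theta> t - \<theta> s \<le> N * (t - s)" if "0 \<le> s" "s \<le> t" for s t
    using Flow[of "\<theta> s" "\<theta> t"] \<theta>[of s] \<theta>[of t] \<theta>mono[OF that] that N by (simp add: pos_divide_le_eq mult.commute)
  have \<theta>F: "\<theta> (F \<tau>) = \<tau>" "0 \<le> F \<tau>" if "0 \<le> \<tau>" "\<tau> < S" for \<tau>
  proof -
    show F: "0 \<le> F \<tau>" using Fstrict[of 0 \<tau>] F0 that by (cases "\<tau> = 0") auto
    show "\<theta> (F \<tau>) = \<tau>"
      using Fstrict[of "\<theta> (F \<tau>)" \<tau>] Fstrict[of \<tau> "\<theta> (F \<tau>)"] \<theta>[OF F] that
      by (cases "\<theta> (F \<tau>)" \<tau> rule: linorder_cases) auto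
  qed
  have lim: "(\<theta> \<longlongrightarrow> S) at_top"
  proof (rule order_tendstoI)
    fix a assume "a < S"
    define b where "b = max 0 ((a + S) / 2)"
    have "a < (a + S) / 2" "(a + S) / 2 < S" using \<open>a < S\<close> by auto
    then have b: "0 \<le> b" "b < S" "a < b" using S unfolding b_def by linarith+
    show "\<forall>\<^sub>F t in at_top. a < \<theta> t"
      using eventually_ge_at_top[of "F b"]
    proof eventually_elim
      fix t assume "F b \<le> t"
      then have "\<theta> (F b) \<le> \<theta> t" using \<theta>F[OF b(1,2)] by (intro \<theta>mono)
      then show "a < \<theta> t" using \<theta>F[OF b(1,2)] b by simp
    qed
  next
    fix a assume "S < a"
    show "\<forall>\<^sub>F t in at_top. \<theta> t < a"
      using eventually_ge_at_top[of 0] by eventually_elim (use \<theta>(2) \<open>S < a\<close> in force)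
  qed
  \<comment> \<open>A monotone function has countably many discontinuities. \<open>X\<close>
    collects their images in the new time; outside it \<open>F\<close> has derivative
    \<open>1 / n\<close>, and the inverse function theorem applies.\<close>
  define g where "g s = n s + C * s" for s
  have gm: "mono_on {0<..<S} g" unfolding g_def by (rule mono_onI) (use mono in auto)
  define X where "X = F ` {s \<in> {0<..<S}. \<not> isCont g s}"
  have X: "countable X" unfolding X_def
    by (intro countable_image mono_on_ctble_discont_open gm) auto
  have der: "(\<theta> has_real_derivative n (\<theta> t)) (at t)" if t: "0 < t" "t \<notin> X" for t
  proof -
    define \<tau> where "\<tau> = \<theta> t"
    have \<tau>: "0 \<le> \<tau>" "\<tau> < S" "F \<tau> = t" using \<theta>[of t] t by (auto simp: \<tau>_def)
    have \<tau>0: "0 < \<tau>" using \<tau> t F0 by (cases "\<tau> = 0") auto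
    have "isCont g \<tau>"
    proof (rule ccontr)
      assume "\<not> isCont g \<tau>"
      then have "F \<tau> \<in> X" unfolding X_def using \<tau>0 \<tau> by (intro imageI) auto
      then show False using \<tau> t by simp
    qed
    then have "isCont (\<lambda>s. g s - C * s) \<tau>" by (intro continuous_intros)
    then have "isCont n \<tau>" by (simp add: g_def)
    then have fc: "isCont f \<tau>" unfolding f_def using npos[OF \<tau>(1,2)] by (intro continuous_intros) auto
    define b where "b = (\<tau> + S) / 2"
    have b: "\<tau> < b" "b < S" using \<tau> by (auto simp: b_def)
    have "((\<lambda>u. integral {0..u} f) has_vector_derivative f \<tau>) (at \<tau> within ({0..b} - {}))"
      by (rule integral_has_vector_derivative_continuous_at)
        (use int[of 0 b] b \<tau> fc in \<open>auto intro: continuous_at_imp_continuous_at_within\<close>)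
    moreover have "at \<tau> within ({0..b} - {}) = at \<tau>" by (rule at_within_interior) (use \<tau>0 b in auto)
    ultimately have "(F has_real_derivative f \<tau>) (at \<tau>)"
      by (simp add: F_def[abs_def] has_real_derivative_iff_has_vector_derivative)
    moreover have "isCont \<theta> t"
    proof -
      have lip: "\<bar>\<theta> s - \<theta> t\<bar> \<le> N * \<bar>s - t\<bar>" if "0 \<le> s" for s
        using \<theta>lip[of s t] \<theta>lip[of t s] \<theta>mono[of s t] \<theta>mono[of t s] that t
        by (cases "s \<le> t") auto
      have "((\<lambda>s. \<theta> s - \<theta> t) \<longlongrightarrow> 0) (at t)"
      proof (rule Lim_null_comparison)
        have "\<forall>\<^sub>F s in nhds t. s \<in> {0<..}" using t by (intro eventually_nhds_in_open) auto
        then have "\<forall>\<^sub>F s in at t. s \<in> {0<..}" by (simp add: eventually_at_filter eventually_mono)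
        then show "\<forall>\<^sub>F s in at t. norm (\<theta> s - \<theta> t) \<le> N * \<bar>s - t\<bar>"
          by eventually_elim (use lip in auto)
        show "((\<lambda>s. N * \<bar>s - t\<bar>) \<longlongrightarrow> 0) (at t)" by (auto intro!: tendsto_eq_intros)
      qed
      then show ?thesis unfolding isCont_def by (rule LIM_zero_cancel)
    qed
    ultimately have "(\<theta> has_real_derivative inverse (f \<tau>)) (at t)"
      using npos[OF \<tau>(1,2)] t \<theta>(3)
      by (intro DERIV_inverse_function[where f=F and a=0 and b="t + 1"]) (auto simp: \<tau>_def f_def)
    then show ?thesis by (simp add: f_def \<tau>_def inverse_eq_divide)
  qed
  have "\<theta> 0 = 0" using \<theta>F(1)[of 0] F0 S by simp
  then show ?thesis by (rule that[OF _ \<theta>(1,2) \<theta>mono \<theta>lip lim X der])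
qed

text \<open>Off a countable set the difference quotients \<open>D k\<close> converge to
  \<open>v\<close>, so Fatou's lemma leaves only their integrals to be bounded. \<open>D k\<close>
  is the derivative of the moving average \<open>F k\<close> of \<theta> over length
  \<open>1 / Suc k\<close>; this average tends to \<open>S\<close> and at \<open>t0\<close> is at
  least \<open>\<theta> t0\<close>.\<close>

lemma nn_integral_derivative_le:
  fixes \<theta> v :: "real \<Rightarrow> real"
  assumes mono: "\<And>s t. 0 \<le> s \<Longrightarrow> s \<le> t \<Longrightarrow> \<theta> s \<le> \<theta> t"
    and lip: "\<And>s t. 0 \<le> s \<Longrightarrow> s \<le> t \<Longrightarrow> \<theta> t - \<theta> s \<le> N * (t - s)" and N: "0 \<le> N"
    and lim: "(\<theta> \<longlongrightarrow> S) at_top" and X: "countable X"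
    and der: "\<And>t. 0 < t \<Longrightarrow> t \<notin> X \<Longrightarrow> (\<theta> has_real_derivative v t) (at t)" and t0: "0 < t0"
  shows "(\<integral>\<^sup>+t\<in>{t0..}. ennreal (v t) \<partial>lborel) \<le> ennreal (S - \<theta> t0)"
proof -
  have cont0: "continuous_on {0..} \<theta>"
  proof (rule lipschitz_on_continuous_on, rule lipschitz_onI)
    fix s t :: real assume "s \<in> {0..}" "t \<in> {0..}"
    then show "dist (\<theta> s) (\<theta> t) \<le> N * dist s t"
      using lip[of s t] lip[of t s] mono[of s t] mono[of t s] by (cases "s \<le> t") (auto simp: dist_real_def)
  qed (rule N)
  define h where "h t = \<theta> (max 0 t)" for t
  have hc: "continuous_on UNIV h"
    unfolding h_def by (rule continuous_on_compose2[OF cont0]) (auto intro!: continuous_intros)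
  have hm: "h \<in> borel_measurable borel" using hc by (rule borel_measurable_continuous_onI)
  define D where "D k t = real (Suc k) * (h (t + 1 / real (Suc k)) - h t)" for k :: nat and t
  have Dm: "D k \<in> borel_measurable borel" for k
    unfolding D_def using measurable_compose[OF _ hm] by measurable
  define H where "H t = integral {0..t} h" for t
  have Hder: "(H has_real_derivative h t) (at t)" if "0 < t" for t
  proof -
    have "(H has_real_derivative h t) (at t within {0..t+1})"
      unfolding H_def[abs_def] using that hc by (intro integral_has_real_derivative) (auto intro: continuous_on_subset)
    moreover have "at t within {0..t+1} = at t" by (rule at_within_interior) (use that in auto)
    ultimately show ?thesis by simp
  qed
  define F where "F k t = real (Suc k) * (H (t + 1 / real (Suc k)) - H t)" for k :: nat and t
  have F: "\<exists>z. t < z \<and> z < t + 1 / real (Suc k) \<and> F k t = h z" if "0 < t" for k t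
  proof -
    have "\<exists>z. t < z \<and> z < t + 1 / real (Suc k) \<and> H (t + 1 / real (Suc k)) - H t = (t + 1 / real (Suc k) - t) * h z"
      by (rule MVT2) (use that Hder in \<open>auto simp del: of_nat_Suc\<close>)
    then show ?thesis by (auto simp: F_def simp del: of_nat_Suc)
  qed
  have int: "(\<integral>\<^sup>+t\<in>{t0..}. ennreal (D k t) \<partial>lborel) \<le> ennreal (S - \<theta> t0)" for k
  proof -
    have "(\<integral>\<^sup>+t. ennreal (D k t) * indicator {t0..} t \<partial>lborel) = ennreal (S - F k t0)"
    proof (rule nn_integral_FTC_atLeast[OF Dm])
      fix t assume t: "t0 \<le> t"
      have p: "0 < 1 / real (Suc k)" by simp
      have "0 < t + 1 / real (Suc k)" using t t0 p by linarith
      then have "((\<lambda>t. H (t + 1 / real (Suc k))) has_real_derivative h (t + 1 / real (Suc k)) * 1) (at t)"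
        by (rule DERIV_chain2[OF Hder]) (auto intro!: derivative_eq_intros simp del: of_nat_Suc)
      then have "(F k has_real_derivative real (Suc k) * (h (t + 1 / real (Suc k)) * 1 - h t)) (at t)"
        unfolding F_def[abs_def] using t t0 by (intro DERIV_cmult DERIV_diff Hder) auto
      then show "(F k has_real_derivative D k t) (at t)" by (simp add: D_def)
      show "0 \<le> D k t" unfolding D_def h_def using t t0 p
        by (intro mult_nonneg_nonneg) (auto intro!: mono simp del: of_nat_Suc)
    next
      show "(F k \<longlongrightarrow> S) at_top"
      proof (rule tendsto_sandwich)
        show "\<forall>\<^sub>F t in at_top. \<theta> t \<le> F k t"
          using eventually_gt_at_top[of 0]
        proof eventually_elim
          fix t :: real assume t: "0 < t"
          then obtain z where "t < z" "F k t = h z" using F by blast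
          then show "\<theta> t \<le> F k t" using mono[of t z] t by (simp add: h_def)
        qed
        show "\<forall>\<^sub>F t in at_top. F k t \<le> \<theta> (t + 1)"
          using eventually_gt_at_top[of 0]
        proof eventually_elim
          fix t :: real assume t: "0 < t"
          then obtain z where z: "t < z" "z < t + 1 / real (Suc k)" "F k t = h z" using F by blast
          have "1 / real (Suc k) \<le> 1" by simp
          then have "z \<le> t + 1" using z(2) by linarith
          then show "F k t \<le> \<theta> (t + 1)" using mono[of z "t + 1"] z t by (simp add: h_def)
        qed
        show "((\<lambda>t. \<theta> (t + 1)) \<longlongrightarrow> S) at_top"
          by (rule filterlim_compose[OF lim]) real_asymp
      qed (rule lim)
    qed
    also have "\<dots> \<le> ennreal (S - \<theta> t0)"
    proof (rule ennreal_leI)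
      obtain z where "t0 < z" "F k t0 = h z" using F t0 by blast
      then show "S - F k t0 \<le> S - \<theta> t0" using mono[of t0 z] t0 by (simp add: h_def)
    qed
    finally show ?thesis .
  qed
  have conv: "(\<lambda>k. D k t) \<longlonglongrightarrow> v t" if t: "0 < t" "t \<notin> X" for t
  proof -
    have "((\<lambda>e. (\<theta> (t + e) - \<theta> t) / e) \<longlongrightarrow> v t) (at 0)" using der[OF t] by (simp add: DERIV_def)
    moreover have "filterlim (\<lambda>k. 1 / real (Suc k)) (at 0) sequentially"
      unfolding filterlim_at using LIMSEQ_inverse_real_of_nat by (auto simp: inverse_eq_divide)
    ultimately have "(\<lambda>k. (\<theta> (t + 1 / real (Suc k)) - \<theta> t) / (1 / real (Suc k))) \<longlonglongrightarrow> v t"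
      by (rule filterlim_compose)
    moreover have "D k t = (\<theta> (t + 1 / real (Suc k)) - \<theta> t) / (1 / real (Suc k))" for k
    proof -
      have "0 \<le> t + 1 / real (Suc k)" using t by (intro add_nonneg_nonneg) auto
      then show ?thesis using t by (simp add: D_def h_def mult.commute del: of_nat_Suc)
    qed
    ultimately show ?thesis by simp
  qed
  have "AE t in lborel. t \<notin> X" using X by (rule AE_not_in[OF countable_imp_null_set_lborel])
  then have "(\<integral>\<^sup>+t\<in>{t0..}. ennreal (v t) \<partial>lborel)
      = (\<integral>\<^sup>+t. liminf (\<lambda>k. ennreal (D k t) * indicator {t0..} t) \<partial>lborel)"
  proof (intro nn_integral_cong_AE, eventually_elim)
    fix t assume t: "t \<notin> X"
    show "ennreal (v t) * indicator {t0..} t = liminf (\<lambda>k. ennreal (D k t) * indicator {t0..} t)"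
    proof (cases "t0 \<le> t")
      case True
      then have "(\<lambda>k. ennreal (D k t)) \<longlonglongrightarrow> ennreal (v t)" using conv t t0 by (intro tendsto_ennrealI) auto
      then have "liminf (\<lambda>k. ennreal (D k t)) = ennreal (v t)" by (intro lim_imp_Liminf) auto
      then show ?thesis using True by simp
    qed (simp add: Liminf_const)
  qed
  also have "\<dots> \<le> liminf (\<lambda>k. \<integral>\<^sup>+t. ennreal (D k t) * indicator {t0..} t \<partial>lborel)"
    by (rule nn_integral_liminf) (use Dm in measurable)
  also have "\<dots> \<le> limsup (\<lambda>k. \<integral>\<^sup>+t. ennreal (D k t) * indicator {t0..} t \<partial>lborel)"
    by (rule Liminf_le_Limsup) simp
  also have "\<dots> \<le> ennreal (S - \<theta> t0)"
    by (rule Limsup_bounded) (use int in auto)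
  finally show ?thesis .
qed

section \<open>The condensate in the rescaled time\<close>

lemma increment_ge:
  fixes f f' :: "real \<Rightarrow> real"
  assumes f: "\<And>x. x \<in> {0..T} \<Longrightarrow> (f has_real_derivative f' x) (at x within {0..T})"
    and st: "0 \<le> s" "s \<le> t" "t \<le> T" and ge: "\<And>x. s < x \<Longrightarrow> x < t \<Longrightarrow> k \<le> f' x"
  shows "k * (t - s) \<le> f t - f s"
proof -
  have "f s - k * s \<le> f t - k * t"
  proof (rule DERIV_nonneg_imp_increasing_open[where f="\<lambda>x. f x - k * x", OF st(2)])
    fix x assume x: "s < x" "x < t"
    have "at x within {0..T} = at x" by (rule at_within_interior) (use x st in auto)
    then have "(f has_real_derivative f' x) (at x)" using f[of x] x st by simp
    then have "((\<lambda>x. f x - k * x) has_real_derivative f' x - k * 1) (at x)"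
      by (intro DERIV_diff DERIV_cmult DERIV_ident)
    then show "\<exists>y. ((\<lambda>x. f x - k * x) has_real_derivative y) (at x) \<and> 0 \<le> y"
      using ge[OF x] by (intro exI conjI) auto
  next
    have "continuous_on {0..T} f"
      unfolding continuous_on_eq_continuous_within using DERIV_continuous[OF f] by blast
    then show "continuous_on {s..t} (\<lambda>x. f x - k * x)"
      using st by (intro continuous_intros) (auto intro: continuous_on_subset)
  qed
  then show ?thesis by (simp add: algebra_simps)
qed

text \<open>These functions decrease to the indicator of the origin as \<open>e\<close> tends to 0.
  The square makes them continuously differentiable, as \<open>tame_bounded\<close> requires, and
  keeps them convex and nonincreasing on the half-line.\<close>

definition hat :: "real \<Rightarrow> real \<Rightarrow> real" where
  "hat e x = (if x \<le> e then (1 - x / e)\<^sup>2 else 0)"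

lemma hat_tame:
  assumes e: "0 < e"
  shows "tame (\<lambda>x. hat e (max 0 x))"
proof (rule tame_bounded)
  define \<phi>' where "\<phi>' x = (if x \<le> e then - 2 / e * (1 - x / e) else 0)" for x
  have e1: "- 2 / e * (1 - e / e) = 0" using e by simp
  show "(hat e has_real_derivative \<phi>' x) (at x within {0..})" if "0 \<le> x" for x
    unfolding hat_def[abs_def] \<phi>'_def
  proof (rule DERIV_If_le[where f="\<lambda>x. (1 - x / e)\<^sup>2" and f'="\<lambda>x. - 2 / e * (1 - x / e)" and g="\<lambda>_. 0" and g'="\<lambda>_. 0"
        and a=0 and R=e and x=x, OF _ _ _ _ e that])
    show "((\<lambda>x. (1 - x / e)\<^sup>2) has_real_derivative - 2 / e * (1 - x / e)) (at x within {0..e})" for x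
    proof -
      have "((\<lambda>x. 1 - x / e) has_real_derivative 0 - 1 / e) (at x within {0..e})"
        by (intro DERIV_diff DERIV_const DERIV_cdivide DERIV_ident)
      from DERIV_power[OF this, of 2] show ?thesis by (rule DERIV_cong) simp
    qed
  qed (use e in auto)
  have "continuous_on ({0..e} \<union> {e..}) \<phi>'"
    unfolding \<phi>'_def[abs_def] using e1 e by (intro continuous_on_If) (auto intro!: continuous_intros)
  moreover have "{0..e} \<union> {e..} = {0..}" using e by auto
  ultimately show "continuous_on {0..} \<phi>'" by simp
  show "\<bar>\<phi>' x\<bar> \<le> 2 / e" if "0 \<le> x" for x
  proof (cases "x \<le> e")
    case True
    then have "0 \<le> 1 - x / e" "1 - x / e \<le> 1" using that e by auto
    then have "2 / e * (1 - x / e) \<le> 2 / e * 1" using e by (intro mult_left_mono) auto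
    moreover have "0 \<le> 2 / e * (1 - x / e)" using \<open>0 \<le> 1 - x / e\<close> e by (intro mult_nonneg_nonneg) auto
    moreover have "\<phi>' x = - (2 / e * (1 - x / e))" using True by (simp add: \<phi>'_def)
    ultimately show ?thesis by simp
  qed (use e in \<open>auto simp: \<phi>'_def\<close>)
  show "\<bar>hat e y\<bar> \<le> 1" if "0 \<le> y" for y
    unfolding hat_def using that e by (auto intro!: power_le_one)
qed

lemma hat_bounds:
  assumes "0 < e" "0 \<le> x"
  shows "0 \<le> hat e x" "hat e x \<le> 1" "x \<le> y \<Longrightarrow> hat e y \<le> hat e x"
proof -
  show "0 \<le> hat e x" by (simp add: hat_def)
  show "hat e x \<le> 1" unfolding hat_def using assms by (auto intro!: power_le_one)
  assume xy: "x \<le> y"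
  show "hat e y \<le> hat e x"
  proof (cases "y \<le> e")
    case True
    have "(1 - y / e)\<^sup>2 \<le> (1 - x / e)\<^sup>2"
      using True xy assms by (intro power_mono) (auto simp: divide_right_mono)
    then show ?thesis using True xy by (simp add: hat_def)
  qed (simp add: hat_def)
qed

text \<open>\<open>hat e\<close> is the square of a positive part, hence convex. The auxiliary
  inequality is its second difference; when \<open>a < b\<close> only one term survives, and it
  dominates because \<open>a + b > 2 * a\<close>.\<close>

lemma kap_hat_nonneg:
  assumes e: "0 < e"
  shows "0 \<le> kap (hat e) x y"
proof -
  have h: "hat e z = (max 0 (1 - z / e))\<^sup>2" for z using e by (auto simp: hat_def max_def)
  have p: "2 * (max 0 a)\<^sup>2 \<le> (max 0 (a - b))\<^sup>2 + (max 0 (a + b))\<^sup>2" if "0 \<le> b" for a b :: real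
  proof (cases "a \<le> 0")
    case False
    have "2 * a\<^sup>2 \<le> (a + b)\<^sup>2" if "a < b"
    proof -
      have "(2 * a)\<^sup>2 \<le> (a + b)\<^sup>2" using that False by (intro power_mono) auto
      moreover have "(2 * a)\<^sup>2 = 4 * a\<^sup>2" "0 \<le> a\<^sup>2" by auto
      ultimately show ?thesis by linarith
    qed
    moreover have "(a - b)\<^sup>2 + (a + b)\<^sup>2 = 2 * a\<^sup>2 + 2 * b\<^sup>2" by (simp add: power2_eq_square algebra_simps)
    ultimately show ?thesis using False that by (auto simp: max_def)
  qed simp
  have *: "0 \<le> Lam (hat e) x y" if "0 < y" "y \<le> x" for x y
  proof -
    have "2 * hat e x \<le> hat e (x + y) + hat e (x - y)"
      using p[of "y / e" "1 - x / e"] that e by (simp add: h diff_divide_distrib add_divide_distrib algebra_simps)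
    then show ?thesis using that by (simp add: Lam_def max_def)
  qed
  have "Lam (hat e) x y = Lam (hat e) y x"
    by (simp add: Lam_def max.commute add.commute abs_minus_commute)
  then have "0 \<le> Lam (hat e) x y" if "0 < x" "0 < y"
    using *[of y x] *[of x y] that by (cases "y \<le> x") auto
  then show ?thesis by (simp add: kap_def)
qed

text \<open>Since \<open>hat e\<close> is nonincreasing, its integral over \<open>{0..x}\<close> is
  at least \<open>x * hat e x\<close>, which leaves
  \<open>L0 (hat e) x \<le> x * (1 - hat e x)\<close>.\<close>

lemma psi_hat_le:
  assumes e: "0 < e" and x: "0 \<le> x"
  shows "psi (hat e) x \<le> sqrt x"
proof (cases "0 < x")
  case True
  have "continuous_on {0..} (\<lambda>x. hat e (max 0 x))"
    using hat_tame[OF e] admD(1) unfolding tame_def by (meson continuous_on_subset subset_UNIV)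
  then have "continuous_on {0..} (hat e)" by (rule continuous_on_eq) auto
  then have i: "hat e integrable_on {0..x}"
    by (intro integrable_continuous_real) (auto intro: continuous_on_subset)
  have "integral {0..x} (\<lambda>_. hat e x) \<le> integral {0..x} (hat e)"
    by (intro integral_le i) (use hat_bounds(3)[OF e] in auto)
  then have "x * hat e x \<le> integral {0..x} (hat e)" using x by simp
  moreover have "0 \<le> x * hat e x" using x hat_bounds(1)[OF e x] by simp
  moreover have "hat e 0 = 1" using e by (simp add: hat_def)
  ultimately have "L0 (hat e) x \<le> x" unfolding L0_def by (simp add: algebra_simps)
  then have "psi (hat e) x \<le> x / sqrt x" using True by (simp add: psi_def divide_right_mono)
  then show ?thesis using x by (simp add: real_div_sqrt)
qed (use x in \<open>simp add: psi_def\<close>)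

section \<open>Evolution of the atom and of the truncated moment\<close>

locale rescaled = truncated_power \<alpha> R for \<alpha> R :: real +
  fixes \<nu> :: "real \<Rightarrow> real measure" and N E Mb T :: real and \<eta> :: "real \<Rightarrow> real"
  assumes N: "0 < N" and E: "0 < E" and Mb: "0 < Mb" and T: "0 < T"
    and rd: "\<And>t. t \<in> {0..T} \<Longrightarrow> real_distribution (\<nu> t)"
    and pos: "\<And>t. t \<in> {0..T} \<Longrightarrow> AE x in \<nu> t. 0 \<le> x"
    and tl: "\<And>t. t \<in> {0..T} \<Longrightarrow> tails \<eta> (\<nu> t)"
    and en: "\<And>t. t \<in> {0..T} \<Longrightarrow> (N + Mb) * (\<integral>x. x \<partial>\<nu> t) = E"
    and wc: "\<And>s t. (\<And>n. s n \<in> {0..T}) \<Longrightarrow> t \<in> {0..T} \<Longrightarrow> s \<longlonglongrightarrow> t \<Longrightarrow> weak_conv_m (\<lambda>n. \<nu> (s n)) (\<nu> t)"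
    and der: "\<And>\<phi> t. tame \<phi> \<Longrightarrow> t \<in> {0..T} \<Longrightarrow>
       ((\<lambda>t. (N + Mb) * (\<integral>x. \<phi> x \<partial>\<nu> t)) has_real_derivative rate (N + Mb) \<phi> (\<nu> t)) (at t within {0..T})"
begin

definition m where "m = N + Mb"
text \<open>The atom at the origin after removal of the artificial Dirac mass \<open>Mb\<close>; it
  may be negative.\<close>

definition n where "n t = m * measure (\<nu> t) {0} - Mb"
definition C0 where "C0 = m + E"

lemma m_pos: "0 < m" and C0_pos: "0 < C0"
  using N Mb E by (auto simp: m_def C0_def)

lemma sets_nu: "t \<in> {0..T} \<Longrightarrow> sets (\<nu> t) = sets borel"
  using rd[of t] by (simp add: real_distribution_def real_distribution_axioms_def)

lemma integrable_growth:
  assumes "t \<in> {0..T}" "f \<in> borel_measurable borel" "\<And>x. 0 \<le> x \<Longrightarrow> \<bar>f x\<bar> \<le> C * (1 + x)"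
  shows "integrable (\<nu> t) (f :: real \<Rightarrow> real)"
proof -
  interpret real_distribution "\<nu> t" by (rule rd[OF assms(1)])
  have "integrable (\<nu> t) (\<lambda>x. C * (1 + x))" using tl[OF assms(1)] unfolding tails_def by auto
  then show ?thesis
  proof (rule Bochner_Integration.integrable_bound)
    show "f \<in> borel_measurable (\<nu> t)" using assms(2) measurable_cong_sets[OF sets_nu[OF assms(1)] refl] by blast
    show "AE x in \<nu> t. norm (f x) \<le> norm (C * (1 + x))"
      using pos[OF assms(1)]
    proof eventually_elim
      fix x :: real assume "0 \<le> x"
      from order_trans[OF assms(3)[OF this] abs_ge_self] show "norm (f x) \<le> norm (C * (1 + x))" by simp
    qed
  qed
qed

lemma integral_growth_le:
  assumes "t \<in> {0..T}" "f \<in> borel_measurable borel" "\<And>x. 0 \<le> x \<Longrightarrow> \<bar>f x\<bar> \<le> C * (1 + x)"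
  shows "\<bar>m * (\<integral>x. f x \<partial>\<nu> t)\<bar> \<le> C * (m + E)"
proof -
  interpret real_distribution "\<nu> t" by (rule rd[OF assms(1)])
  have i: "integrable (\<nu> t) (\<lambda>x. x)" using tl[OF assms(1)] unfolding tails_def by auto
  have "\<bar>\<integral>x. f x \<partial>\<nu> t\<bar> \<le> (\<integral>x. \<bar>f x\<bar> \<partial>\<nu> t)" by (rule integral_abs_bound)
  also have "\<dots> \<le> (\<integral>x. C * (1 + x) \<partial>\<nu> t)"
    by (rule integral_mono_AE) (use i integrable_growth[OF assms] assms(3) pos[OF assms(1)] in auto)
  also have "\<dots> = C * (1 + (\<integral>x. x \<partial>\<nu> t))"
    using i prob_space by (simp add: Bochner_Integration.integral_add)
  finally have "m * \<bar>\<integral>x. f x \<partial>\<nu> t\<bar> \<le> m * (C * (1 + (\<integral>x. x \<partial>\<nu> t)))"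
    using m_pos by (intro mult_left_mono) auto
  also have "\<dots> = C * (m + m * (\<integral>x. x \<partial>\<nu> t))" by (simp add: algebra_simps)
  finally show ?thesis using en[OF assms(1)] m_pos by (simp add: abs_mult m_def)
qed

lemma measurable_tame: "tame \<phi> \<Longrightarrow> \<phi> \<in> borel_measurable borel"
  unfolding tame_def using borel_measurable_adm by blast

lemma measurable_psi: "tame \<phi> \<Longrightarrow> psi \<phi> \<in> borel_measurable borel"
  unfolding tame_def by (elim conjE exE) (rule isCont_borel_measurable[OF refl isCont_psi])

lemma rate_bounded:
  assumes "tame \<phi>"
  shows "\<exists>B. \<forall>t\<in>{0..T}. \<bar>rate m \<phi> (\<nu> t)\<bar> \<le> B"
proof -
  obtain L C where a: "adm L C \<phi>" using assms unfolding tame_def by blast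
  show ?thesis
  proof (intro exI[of _ "m * m * (2 * L) + C * (m + E)"] ballI)
    fix t assume t: "t \<in> {0..T}"
    interpret real_distribution "\<nu> t" by (rule rd[OF t])
    have p1: "measure (\<nu> t) UNIV = 1" using prob_space by simp
    have b: "\<bar>\<integral>y. kap \<phi> x y \<partial>\<nu> t\<bar> \<le> 2 * L" for x
    proof -
      have "\<bar>\<integral>y. kap \<phi> x y \<partial>\<nu> t\<bar> \<le> (\<integral>y. 2 * L \<partial>\<nu> t)"
        using Bochner_Integration.integral_norm_bound_integral[of "\<nu> t" "kap \<phi> x" "\<lambda>_. 2 * L"]
          integrable_continuous_bounded[OF isCont_kap_right[OF assms] kap_le[OF a]] kap_le[OF a] by simp
      then show ?thesis by (simp add: p1)
    qed
    have "\<bar>\<integral>x. \<integral>y. kap \<phi> x y \<partial>\<nu> t \<partial>\<nu> t\<bar> \<le> 2 * L"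
    proof (cases "integrable (\<nu> t) (\<lambda>x. \<integral>y. kap \<phi> x y \<partial>\<nu> t)")
      case True
      have "\<bar>\<integral>x. \<integral>y. kap \<phi> x y \<partial>\<nu> t \<partial>\<nu> t\<bar> \<le> (\<integral>x. 2 * L \<partial>\<nu> t)"
        using Bochner_Integration.integral_norm_bound_integral[OF True, of "\<lambda>_. 2 * L"] b by simp
      then show ?thesis by (simp add: p1)
    qed (use admD(2)[OF a] in \<open>simp add: not_integrable_integral_eq\<close>)
    then have "\<bar>m * m * (\<integral>x. \<integral>y. kap \<phi> x y \<partial>\<nu> t \<partial>\<nu> t)\<bar> \<le> m * m * (2 * L)"
      unfolding abs_mult abs_of_pos[OF m_pos] using m_pos by (intro mult_left_mono) auto
    moreover have "\<bar>m * (\<integral>x. psi \<phi> x \<partial>\<nu> t)\<bar> \<le> C * (m + E)"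
      by (rule integral_growth_le[OF t measurable_psi[OF assms] psi_le[OF a]])
    ultimately show "\<bar>rate m \<phi> (\<nu> t)\<bar> \<le> m * m * (2 * L) + C * (m + E)"
      unfolding rate_def by linarith
  qed
qed

lemma continuous_pairing:
  assumes f: "\<And>x. isCont f x" "\<And>x. \<bar>f x\<bar> \<le> b"
  shows "continuous_on {0..T} (\<lambda>t. \<integral>x. f x \<partial>\<nu> t :: real)"
  unfolding continuous_on_sequentially o_def
proof (intro allI ballI impI, elim conjE)
  fix s t assume t: "t \<in> {0..T}" and s: "\<forall>n. s n \<in> {0..T}" and st: "s \<longlonglongrightarrow> t"
  show "(\<lambda>n. \<integral>x. f x \<partial>\<nu> (s n)) \<longlonglongrightarrow> (\<integral>x. f x \<partial>\<nu> t)"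
    using weak_conv_imp_integral_bdd_continuous_conv[of "\<lambda>n. \<nu> (s n)" "\<nu> t" f b] rd s t wc[OF _ t st] f by auto
qed

lemma n_le: "t \<in> {0..T} \<Longrightarrow> n t \<le> N"
proof -
  assume t: "t \<in> {0..T}"
  interpret real_distribution "\<nu> t" by (rule rd[OF t])
  have "m * measure (\<nu> t) {0} \<le> m * 1" using m_pos by (intro mult_left_mono) auto
  then show ?thesis by (simp add: n_def m_def)
qed

text \<open>Tested with a convex decreasing function, the quadratic part only produces mass at the
  origin, so \<open>n\<close> decreases at most at rate \<open>\<integral> \<surd>x\<close>.\<close>

lemma rate_hat_ge:
  assumes t: "t \<in> {0..T}" and e: "0 < e"
  shows "- C0 \<le> rate m (\<lambda>x. hat e (max 0 x)) (\<nu> t)"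
proof -
  have tm: "tame (\<lambda>x. hat e (max 0 x))" by (rule hat_tame[OF e])
  interpret real_distribution "\<nu> t" by (rule rd[OF t])
  have 1: "0 \<le> m * m * (\<integral>x. \<integral>y. kap (hat e) x y \<partial>\<nu> t \<partial>\<nu> t)"
    using m_pos kap_hat_nonneg[OF e] by (intro mult_nonneg_nonneg Bochner_Integration.integral_nonneg) auto
  obtain L C where a: "adm L C (\<lambda>x. hat e (max 0 x))" using tm unfolding tame_def by blast
  have ip: "integrable (\<nu> t) (psi (hat e))"
    using integrable_growth[OF t measurable_psi[OF tm] psi_le[OF a]] unfolding psi_max0 .
  have s: "sqrt \<in> borel_measurable borel" by (intro borel_measurable_continuous_onI continuous_on_real_sqrt continuous_on_id)
  have sb: "\<bar>sqrt x\<bar> \<le> 1 * (1 + x)" if "0 \<le> x" for x :: real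
    using that by (auto intro!: real_le_lsqrt simp: power2_eq_square algebra_simps)
  have "(\<integral>x. psi (hat e) x \<partial>\<nu> t) \<le> (\<integral>x. sqrt x \<partial>\<nu> t)"
    by (rule integral_mono_AE[OF ip integrable_growth[OF t s sb]])
      (use pos[OF t] psi_hat_le[OF e] in auto)
  then have "m * (\<integral>x. psi (hat e) x \<partial>\<nu> t) \<le> m * (\<integral>x. sqrt x \<partial>\<nu> t)"
    using m_pos by simp
  also have "\<dots> \<le> C0" using integral_growth_le[OF t s sb] by (simp add: C0_def)
  finally show ?thesis using 1 unfolding rate_def kap_max0 psi_max0 by linarith
qed

text \<open>The differential inequality for \<open>hat e\<close> is integrated first, with a
  constant independent of \<open>e\<close>; afterwards \<open>e\<close> tends to 0 by dominated
  convergence. Only this one-sided bound survives, since no estimate from above is uniform in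
  \<open>e\<close>.\<close>

lemma n_mono:
  assumes st: "0 \<le> s" "s \<le> t" "t \<le> T"
  shows "n s + C0 * s \<le> n t + C0 * t"
proof -
  define e where "e k = 1 / real (Suc k)" for k
  have e: "0 < e k" for k by (simp add: e_def)
  have elim: "e \<longlonglongrightarrow> 0" unfolding e_def using LIMSEQ_inverse_real_of_nat by (simp add: inverse_eq_divide)
  have lim: "(\<lambda>k. m * (\<integral>x. hat (e k) (max 0 x) \<partial>\<nu> t)) \<longlonglongrightarrow> m * measure (\<nu> t) {0}" if t: "t \<in> {0..T}" for t
  proof -
    interpret real_distribution "\<nu> t" by (rule rd[OF t])
    have "(\<lambda>k. \<integral>x. hat (e k) (max 0 x) \<partial>\<nu> t) \<longlonglongrightarrow> (\<integral>x. indicator {0} x \<partial>\<nu> t)"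
    proof (rule integral_dominated_convergence[where w="\<lambda>_. 1"])
      show "AE x in \<nu> t. (\<lambda>k. hat (e k) (max 0 x)) \<longlonglongrightarrow> indicator {0} x"
        using pos[OF t]
      proof eventually_elim
        fix x :: real assume x: "0 \<le> x"
        show "(\<lambda>k. hat (e k) (max 0 x)) \<longlonglongrightarrow> indicator {0} x"
        proof (cases "x = 0")
          case True
          then have "(\<lambda>k. hat (e k) (max 0 x)) = (\<lambda>k. 1)" using e by (auto simp: hat_def fun_eq_iff less_imp_le)
          then show ?thesis using True by simp
        next
          case False
          then have "\<forall>\<^sub>F k in sequentially. e k < x" using order_tendstoD(2)[OF elim] x by auto
          then have "\<forall>\<^sub>F k in sequentially. 0 = hat (e k) (max 0 x)"
            by eventually_elim (use x in \<open>auto simp: hat_def\<close>)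
          then have "(\<lambda>k. hat (e k) (max 0 x)) \<longlonglongrightarrow> 0" by (rule Lim_transform_eventually[OF tendsto_const])
          then show ?thesis using False by simp
        qed
      qed
      show "(\<lambda>x. hat (e k) (max 0 x)) \<in> borel_measurable (\<nu> t)" for k
        using measurable_tame[OF hat_tame[OF e]] measurable_cong_sets[OF sets_nu[OF t] refl] by blast
      show "AE x in \<nu> t. norm (hat (e k) (max 0 x)) \<le> 1" for k
        using hat_bounds(1,2)[OF e] by (intro AE_I2) simp
    qed auto
    then have "(\<lambda>k. \<integral>x. hat (e k) (max 0 x) \<partial>\<nu> t) \<longlonglongrightarrow> measure (\<nu> t) {0}" by simp
    then show ?thesis by (intro tendsto_intros)
  qed
  have sT: "s \<in> {0..T}" and tT: "t \<in> {0..T}" using st by auto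
  have "- C0 * (t - s) \<le> m * measure (\<nu> t) {0} - m * measure (\<nu> s) {0}"
  proof (rule tendsto_lowerbound[OF tendsto_diff[OF lim[OF tT] lim[OF sT]]])
    show "\<forall>\<^sub>F k in sequentially. - C0 * (t - s)
        \<le> m * (\<integral>x. hat (e k) (max 0 x) \<partial>\<nu> t) - m * (\<integral>x. hat (e k) (max 0 x) \<partial>\<nu> s)"
    proof (intro always_eventually allI)
      fix k
      show "- C0 * (t - s) \<le> m * (\<integral>x. hat (e k) (max 0 x) \<partial>\<nu> t) - m * (\<integral>x. hat (e k) (max 0 x) \<partial>\<nu> s)"
        by (rule increment_ge[OF der[OF hat_tame[OF e], folded m_def] st])
          (use rate_hat_ge[OF _ e] st in auto)
    qed
  qed simp
  then show ?thesis by (simp add: n_def algebra_simps)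
qed

text \<open>The guaranteed rate of decrease of \<open>P\<close>; its reciprocal is
  \<open>CNEa N E \<alpha>\<close>.\<close>

definition \<kappa> where "\<kappa> = c * E powr (\<alpha> + 1 / 2) * N powr (1 / 2 - \<alpha>) - C1alpha \<alpha> * N powr (3 - \<alpha>) * E powr (\<alpha> - 1)"

definition P where "P t = m * (\<integral>x. pw (max 0 x) \<partial>\<nu> t)"

text \<open>Both parts are estimated by tangents at the mean energy \<open>E / N\<close>: a concave
  power of order \<open>(\<alpha> - 1) / 2\<close> from above and the convex power of order
  \<open>\<alpha> + 1 / 2\<close> from below. The mass on the open half-line is
  \<open>N - n t\<close>; \<open>0 \<le> n t\<close> is needed to replace it by \<open>N\<close> in
  both, where it enters with the favourable sign.\<close>

lemma rate_pw_le:
  assumes t: "t \<in> {0..T}" and nt: "0 \<le> n t"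
    and large: "(\<alpha> + 1 / 2) * (E / N) powr (\<alpha> - 1 / 2) \<le> R powr (\<alpha> - 1 / 2)"
  shows "rate m (\<lambda>x. pw (max 0 x)) (\<nu> t) \<le> - \<kappa>"
proof -
  interpret real_distribution "\<nu> t" by (rule rd[OF t])
  define M where "M = E / N"
  have M: "0 < M" using N E by (simp add: M_def)
  define b where "b = (\<alpha> - 1) / 2"
  have b: "0 < b" "b \<le> 1" using \<alpha> by (auto simp: b_def)
  have ix: "integrable (\<nu> t) (\<lambda>x. x)" using tl[OF t] unfolding tails_def by auto
  have i0: "integrable (\<nu> t) (indicator {0} :: real \<Rightarrow> real)" by (intro integrable_real_indicator) (auto simp: emeasure_eq_measure)
  \<comment> \<open>The factor \<open>1 - indicator {0} x\<close> removes the origin, where the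
    artificial Dirac mass sits, so affine functions are integrated against the true measure on the
    open half-line.\<close>
  have aff: "m * (\<integral>x. q * (1 - indicator {0} x) + p * x \<partial>\<nu> t) = q * (N - n t) + p * E" for p q :: real
  proof -
    have "(\<integral>x. q * (1 - indicator {0} x) + p * x \<partial>\<nu> t) = q * (1 - measure (\<nu> t) {0}) + p * (\<integral>x. x \<partial>\<nu> t)"
      using ix i0 prob_space by simp
    then have "m * (\<integral>x. q * (1 - indicator {0} x) + p * x \<partial>\<nu> t) = m * (q * (1 - measure (\<nu> t) {0}) + p * (\<integral>x. x \<partial>\<nu> t))"
      by (simp only:)
    also have "\<dots> = q * (m - m * measure (\<nu> t) {0}) + p * (m * (\<integral>x. x \<partial>\<nu> t))"
      by (simp add: algebra_simps)
    also have "\<dots> = q * (N - n t) + p * E"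
      using en[OF t] by (simp add: m_def n_def)
    finally show ?thesis .
  qed
  have iaff: "integrable (\<nu> t) (\<lambda>x. q * (1 - indicator {0} x) + p * x)" for p q :: real
    using ix i0 by auto
  have pb: "(\<lambda>x. x powr b) \<in> borel_measurable borel" by measurable
  have yb: "x powr b \<le> (1 - b) * M powr b * (1 - indicator {0} x) + b * M powr (b - 1) * x" if "0 \<le> x" for x
  proof (cases "x = 0")
    case False
    have "M powr b * (x / M) powr b \<le> M powr b * (1 + b * (x / M - 1))"
      using b that M by (intro mult_left_mono powr_le_affine) auto
    moreover have "M powr b * (x / M) powr b = x powr b" using that M by (simp add: powr_divide)
    moreover have "M powr b * (1 + b * (x / M - 1)) = (1 - b) * M powr b + b * M powr (b - 1) * x"
      using M by (simp add: powr_diff field_simps)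
    ultimately show ?thesis using False by simp
  qed (use b in simp)
  have ib: "integrable (\<nu> t) (\<lambda>x. x powr b)"
  proof (rule integrable_growth[OF t pb])
    fix x :: real assume "0 \<le> x"
    then have "x powr b \<le> 1 + b * (x - 1)" using b by (intro powr_le_affine) auto
    also have "\<dots> \<le> 1 * (1 + x)" using b \<open>0 \<le> x\<close> mult_right_mono[of b 1 x] by (simp add: algebra_simps)
    finally show "\<bar>x powr b\<bar> \<le> 1 * (1 + x)" by simp
  qed
  define I where "I = (\<integral>x. x powr b \<partial>\<nu> t)"
  have I0: "0 \<le> I" unfolding I_def by (intro Bochner_Integration.integral_nonneg) auto
  have mI: "m * I \<le> M powr b * N"
  proof -
    have "I \<le> (\<integral>x. (1 - b) * M powr b * (1 - indicator {0} x) + b * M powr (b - 1) * x \<partial>\<nu> t)"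
      unfolding I_def by (rule integral_mono_AE[OF ib iaff]) (use pos[OF t] yb in auto)
    then have "m * I \<le> (1 - b) * M powr b * (N - n t) + b * M powr (b - 1) * E"
      using m_pos by (subst aff[symmetric]) simp
    also have "\<dots> \<le> (1 - b) * M powr b * N + b * M powr (b - 1) * E"
      using b nt by (intro add_right_mono mult_left_mono) auto
    also have "M powr (b - 1) * E = M powr b * N"
    proof -
      have "E = M * N" using N by (simp add: M_def)
      then show ?thesis using M by (simp add: powr_diff)
    qed
    then have "(1 - b) * M powr b * N + b * M powr (b - 1) * E = M powr b * N"
      by (simp add: algebra_simps)
    finally show ?thesis .
  qed
  obtain L C where a: "adm L C (\<lambda>x. pw (max 0 x))" using pw_tame(2) by blast
  note tm = pw_tame(1)
  have ik: "integrable (\<nu> t) (kap pw x)" for x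
    using integrable_continuous_bounded[OF isCont_kap_right[OF tm] kap_le[OF a]] unfolding kap_max0 .
  have inner: "(\<integral>y. kap pw x y \<partial>\<nu> t) \<le> C1alpha \<alpha> * (x powr b) * I" if "0 \<le> x" for x
  proof -
    have "(\<integral>y. kap pw x y \<partial>\<nu> t) \<le> (\<integral>y. C1alpha \<alpha> * x powr b * (y powr b) \<partial>\<nu> t)"
      by (rule integral_mono_AE[OF ik]) (use pos[OF t] kap_pw_le[OF that] ib in \<open>auto simp: b_def mult.assoc\<close>)
    then show ?thesis by (simp add: I_def)
  qed
  have "(\<integral>x. \<integral>y. kap pw x y \<partial>\<nu> t \<partial>\<nu> t) \<le> (\<integral>x. C1alpha \<alpha> * I * (x powr b) \<partial>\<nu> t)"
  \<comment> \<open>If the inner integral is not integrable in \<open>x\<close>, the outer one is 0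
    by convention, and the right-hand side is nonnegative anyway.\<close>
  proof (cases "integrable (\<nu> t) (\<lambda>x. \<integral>y. kap pw x y \<partial>\<nu> t)")
    case True
    show ?thesis
      by (rule integral_mono_AE[OF True]) (use pos[OF t] inner ib in \<open>auto simp: mult_ac\<close>)
  next
    case False
    have "0 \<le> (\<integral>x. C1alpha \<alpha> * I * (x powr b) \<partial>\<nu> t)"
      using C1alpha_pos[OF \<alpha>(1)] I0 by (intro Bochner_Integration.integral_nonneg) auto
    then show ?thesis using False by (simp add: not_integrable_integral_eq)
  qed
  also have "\<dots> = C1alpha \<alpha> * (I * I)" by (simp add: I_def)
  finally have "m * m * (\<integral>x. \<integral>y. kap pw x y \<partial>\<nu> t \<partial>\<nu> t) \<le> m * m * (C1alpha \<alpha> * (I * I))"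
    using m_pos by (intro mult_left_mono) auto
  also have "\<dots> = C1alpha \<alpha> * ((m * I) * (m * I))" by (simp add: mult_ac)
  also have "\<dots> \<le> C1alpha \<alpha> * ((M powr b * N) * (M powr b * N))"
    using C1alpha_pos[OF \<alpha>(1)] I0 m_pos by (intro mult_left_mono[OF mult_mono'[OF mI mI]]) auto
  also have "(M powr b * N) * (M powr b * N) = N powr (3 - \<alpha>) * E powr (\<alpha> - 1)"
  proof -
    have "(M powr b * N) * (M powr b * N) = (M powr b * M powr b) * (N * N)" by (simp add: mult_ac)
    also have "M powr b * M powr b = M powr (\<alpha> - 1)" unfolding powr_add[symmetric] b_def by simp
    also have "M powr (\<alpha> - 1) * (N * N) = E powr (\<alpha> - 1) * (N powr 2 / N powr (\<alpha> - 1))"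
      using N E by (simp add: M_def powr_divide power2_eq_square)
    also have "N powr 2 / N powr (\<alpha> - 1) = N powr (3 - \<alpha>)" unfolding powr_diff[symmetric] by simp
    finally show ?thesis by (simp add: mult.commute)
  qed
  finally have k: "m * m * (\<integral>x. \<integral>y. kap pw x y \<partial>\<nu> t \<partial>\<nu> t) \<le> C1alpha \<alpha> * N powr (3 - \<alpha>) * E powr (\<alpha> - 1)"
    by (simp add: mult.assoc)
  have ip: "integrable (\<nu> t) (psi pw)"
    using integrable_growth[OF t measurable_psi[OF tm] psi_le[OF a]] unfolding psi_max0 .
  define p q where "p = c * ((\<alpha> + 1 / 2) * M powr (\<alpha> - 1 / 2))" and "q = c * ((\<alpha> - 1 / 2) * M powr (\<alpha> + 1 / 2))"
  have "m * (\<integral>x. (- q) * (1 - indicator {0} x) + p * x \<partial>\<nu> t) \<le> m * (\<integral>x. psi pw x \<partial>\<nu> t)"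
  proof (rule mult_left_mono[OF integral_mono_AE[OF iaff ip]])
    show "AE x in \<nu> t. - q * (1 - indicator {0} x) + p * x \<le> psi pw x"
      using pos[OF t]
    proof eventually_elim
      fix x :: real assume x: "0 \<le> x"
      show "- q * (1 - indicator {0} x) + p * x \<le> psi pw x"
      proof (cases "x = 0")
        case False
        have "p * x - q \<le> psi pw x"
          using psi_pw_ge[OF x M] large unfolding M_def p_def q_def by (simp add: algebra_simps)
        then show ?thesis using False by simp
      qed (simp add: psi_def)
    qed
  qed (use m_pos in simp)
  then have "- q * (N - n t) + p * E \<le> m * (\<integral>x. psi pw x \<partial>\<nu> t)" unfolding aff .
  moreover have "q * (N - n t) \<le> q * N" unfolding q_def using c \<alpha> nt by (intro mult_left_mono) auto
  moreover have "p * E - q * N = c * E powr (\<alpha> + 1 / 2) * N powr (1 / 2 - \<alpha>)"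
  proof -
    have "M powr (\<alpha> - 1 / 2) * E = M powr (\<alpha> + 1 / 2) * N"
    proof -
      have "M powr (\<alpha> + 1 / 2) = M powr (\<alpha> - 1 / 2) * M powr 1" unfolding powr_add[symmetric] by (simp add: add.commute)
      moreover have "M * N = E" using N by (simp add: M_def)
      ultimately show ?thesis using M by simp
    qed
    then have "p * E = c * ((\<alpha> + 1 / 2) * (M powr (\<alpha> + 1 / 2) * N))" by (simp add: p_def mult.assoc)
    then have "p * E - q * N = c * (M powr (\<alpha> + 1 / 2) * N)" by (simp add: q_def algebra_simps)
    moreover have "M powr (\<alpha> + 1 / 2) * N = E powr (\<alpha> + 1 / 2) * N powr (1 / 2 - \<alpha>)"
    proof -
      have "M powr (\<alpha> + 1 / 2) * N = E powr (\<alpha> + 1 / 2) * (N powr 1 / N powr (\<alpha> + 1 / 2))"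
        using N E by (simp add: M_def powr_divide)
      also have "N powr 1 / N powr (\<alpha> + 1 / 2) = N powr (1 / 2 - \<alpha>)" unfolding powr_diff[symmetric] by simp
      finally show ?thesis .
    qed
    ultimately show ?thesis by simp
  qed
  ultimately have "c * E powr (\<alpha> + 1 / 2) * N powr (1 / 2 - \<alpha>) \<le> m * (\<integral>x. psi pw x \<partial>\<nu> t)" by linarith
  then show ?thesis using k unfolding rate_def kap_max0 psi_max0 \<kappa>_def by linarith
qed

end

section \<open>Recovering the solution measure and its collision term\<close>

lemma kap_pair:
  assumes M: "finite_measure M" "sets M = sets borel" and \<phi>: "tame \<phi>"
  shows "integrable M (\<lambda>x. \<integral>y. kap \<phi> x y \<partial>M)"
    "(\<integral>p. kap \<phi> (fst p) (snd p) \<partial>(M \<Otimes>\<^sub>M M)) = (\<integral>x. \<integral>y. kap \<phi> x y \<partial>M \<partial>M)"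
proof -
  obtain L C where a: "adm L C \<phi>" using \<phi> unfolding tame_def by blast
  interpret M: finite_measure M by fact
  interpret pair_sigma_finite M M ..
  interpret MM: finite_measure "M \<Otimes>\<^sub>M M" by (rule finite_measure_pair_measure) (rule M)+
  have "(\<lambda>p. kap \<phi> (fst p) (snd p)) \<in> borel_measurable borel"
    using isCont_kap[OF \<phi>] by (intro borel_measurable_continuous_onI continuous_at_imp_continuous_on) auto
  moreover have "sets (M \<Otimes>\<^sub>M M) = sets (borel :: (real \<times> real) measure)"
    using sets_pair_measure_cong[OF M(2) M(2)] unfolding borel_prod .
  ultimately have "(\<lambda>p. kap \<phi> (fst p) (snd p)) \<in> borel_measurable (M \<Otimes>\<^sub>M M)"
    using measurable_cong_sets[OF _ refl] by blast
  then have i: "integrable (M \<Otimes>\<^sub>M M) (\<lambda>p. kap \<phi> (fst p) (snd p))"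
    using kap_le[OF a] by (intro MM.integrable_const_bound[where B="2 * L"]) auto
  show "integrable M (\<lambda>x. \<integral>y. kap \<phi> x y \<partial>M)" using integrable_fst'[OF i] by simp
  show "(\<integral>p. kap \<phi> (fst p) (snd p) \<partial>(M \<Otimes>\<^sub>M M)) = (\<integral>x. \<integral>y. kap \<phi> x y \<partial>M \<partial>M)"
    using integral_fst'[OF i] by simp
qed

lemma Q3_2_kap: "Q3_2 \<phi> G = (\<integral>p. kap \<phi> (fst p) (snd p) \<partial>(G \<Otimes>\<^sub>M G))"
  unfolding Q3_2_def set_lebesgue_integral_def
  by (intro Bochner_Integration.integral_cong) (auto simp: kap_def indicator_def)

lemma Q3_1_psi: "Q3_1 \<phi> G = (\<integral>x. psi \<phi> x \<partial>G)"
  unfolding Q3_1_def set_lebesgue_integral_def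
  by (intro Bochner_Integration.integral_cong) (auto simp: psi_def indicator_def)

context rescaled
begin

text \<open>The true measure \<open>m\<close> times \<open>\<nu> t\<close> minus \<open>Mb\<close>
  times the Dirac mass, written as a density. The value at the origin turns the atom of
  \<open>\<nu> t\<close> into \<open>n t\<close>, so the formula is meaningful as long as
  \<open>n t > 0\<close>.\<close>

definition Gm :: "real \<Rightarrow> real measure" where
  "Gm t = density (\<nu> t) (\<lambda>x. ennreal (if x = 0 then n t / measure (\<nu> t) {0} else m))"

context
  fixes t assumes t: "t \<in> {0..T}" and nt: "0 < n t"
begin

lemma nu0_pos: "0 < measure (\<nu> t) {0}"
proof -
  have "0 < m * measure (\<nu> t) {0}" using nt Mb by (simp add: n_def)
  then show ?thesis using m_pos by (simp add: zero_less_mult_iff)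
qed

lemma finite_measure_nu: "finite_measure (\<nu> t)"
  using rd[OF t] by (simp add: real_distribution_def prob_space_def)

lemma
  assumes "integrable (\<nu> t) f"
  shows integrable_Gm: "integrable (Gm t) (f :: real \<Rightarrow> real)"
    and integral_Gm: "(\<integral>x. f x \<partial>Gm t) = m * (\<integral>x. f x \<partial>\<nu> t) - Mb * f 0"
proof -
  have p: "0 \<le> n t / measure (\<nu> t) {0}" "0 \<le> m" using nt nu0_pos m_pos by auto
  note * = integral_density_atom[OF sets_nu[OF t] finite_measure_nu assms p, folded Gm_def]
  show "integrable (Gm t) f" by (rule *(1))
  have "(n t / measure (\<nu> t) {0} - m) * measure (\<nu> t) {0} = n t - m * measure (\<nu> t) {0}"
    using nu0_pos by (simp add: left_diff_distrib)
  also have "\<dots> = - Mb" by (simp add: n_def)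
  finally have "(n t / measure (\<nu> t) {0} - m) * measure (\<nu> t) {0} = - Mb" .
  then show "(\<integral>x. f x \<partial>Gm t) = m * (\<integral>x. f x \<partial>\<nu> t) - Mb * f 0" using *(2) by simp
qed

lemma sets_Gm: "sets (Gm t) = sets borel"
  using sets_nu[OF t] by (simp add: Gm_def)

lemma space_Gm: "space (Gm t) = UNIV"
  using sets_eq_imp_space_eq[OF sets_Gm] by simp

lemma measurable_Gm: "f \<in> borel_measurable borel \<Longrightarrow> f \<in> borel_measurable (Gm t)"
  using measurable_cong_sets[OF sets_Gm refl] by blast

lemma weight_measurable: "(\<lambda>x. ennreal (if x = 0 then n t / measure (\<nu> t) {0} else m)) \<in> borel_measurable (\<nu> t)"
proof -
  have "(\<lambda>x::real. ennreal (if x = 0 then n t / measure (\<nu> t) {0} else m)) \<in> borel_measurable borel" by measurable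
  then show ?thesis using measurable_cong_sets[OF sets_nu[OF t] refl] by blast
qed

lemma AE_Gm: "AE x in Gm t. 0 \<le> x"
  unfolding Gm_def AE_density[OF weight_measurable] using pos[OF t] by eventually_elim simp

lemma nn_integral_Gm:
  assumes "integrable (\<nu> t) f" "\<And>x. 0 \<le> x \<Longrightarrow> 0 \<le> f x"
  shows "(\<integral>\<^sup>+x. ennreal (f x) \<partial>Gm t) = ennreal (m * (\<integral>x. f x \<partial>\<nu> t) - Mb * f 0)"
proof -
  have "AE x in Gm t. 0 \<le> f x" using AE_Gm by eventually_elim (rule assms)
  from nn_integral_eq_integral[OF integrable_Gm[OF assms(1)] this] show ?thesis
    by (simp add: integral_Gm[OF assms(1)])
qed

lemma integrable_nu_id: "integrable (\<nu> t) (\<lambda>x. x)"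
  using tl[OF t] by (simp add: tails_def)

lemma emeasure_Gm: "emeasure (Gm t) UNIV = ennreal N"
proof -
  interpret real_distribution "\<nu> t" by (rule rd[OF t])
  have p1: "measure (\<nu> t) UNIV = 1" using prob_space by simp
  have "(\<integral>\<^sup>+x. ennreal 1 \<partial>Gm t) = ennreal (m * (\<integral>x. 1 \<partial>\<nu> t) - Mb * 1)"
    by (rule nn_integral_Gm) auto
  then show ?thesis by (simp add: space_Gm m_def p1)
qed

lemma nn_integral_id_Gm: "(\<integral>\<^sup>+x. ennreal x \<partial>Gm t) = ennreal E"
  using nn_integral_Gm[OF integrable_nu_id] en[OF t] by (simp add: m_def)

lemma Mom0_Gm: "Mom (Gm t) 0 = ennreal N"
proof -
  have "Mom (Gm t) 0 = (\<integral>\<^sup>+x. 1 \<partial>Gm t)"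
    unfolding Mom_def by (rule nn_integral_cong) auto
  then show ?thesis by (simp add: space_Gm emeasure_Gm)
qed

lemma Mom1_Gm: "Mom (Gm t) 1 = ennreal E"
proof -
  have "Mom (Gm t) 1 = (\<integral>\<^sup>+x. ennreal x \<partial>Gm t)"
    unfolding Mom_def by (rule nn_integral_cong_AE) (use AE_Gm in auto)
  then show ?thesis by (simp add: nn_integral_id_Gm)
qed

lemma nn_integral_one_plus_Gm: "(\<integral>\<^sup>+x. ennreal (1 + x) \<partial>Gm t) = ennreal (N + E)"
proof -
  interpret real_distribution "\<nu> t" by (rule rd[OF t])
  have p1: "measure (\<nu> t) UNIV = 1" using prob_space by simp
  have "(\<integral>\<^sup>+x. ennreal (1 + x) \<partial>Gm t) = ennreal (m * (\<integral>x. 1 + x \<partial>\<nu> t) - Mb * (1 + 0))"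
    by (rule nn_integral_Gm) (use integrable_nu_id in auto)
  also have "m * (\<integral>x. 1 + x \<partial>\<nu> t) - Mb * (1 + 0) = N + E"
    using integrable_nu_id en[OF t] by (simp add: Bochner_Integration.integral_add p1 m_def distrib_left)
  finally show ?thesis .
qed

lemma Mplus_Gm: "Mplus (Gm t)"
  unfolding Mplus_def
proof (intro conjI sets_Gm)
  have "AE x in Gm t. x \<notin> {..<0}" using AE_Gm by eventually_elim auto
  then have "{..<0} \<in> null_sets (Gm t)"
    by (subst AE_iff_null_sets) (auto simp: sets_Gm)
  then show "emeasure (Gm t) {..<0} = 0" by auto
qed (simp add: emeasure_Gm)

lemma M1plus_Gm: "M1plus (Gm t)"
  unfolding M1plus_def by (simp add: Mplus_Gm Mom1_Gm)

lemma finite_measure_Gm: "finite_measure (Gm t)"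
  by (rule finite_measureI) (simp add: space_Gm emeasure_Gm)

lemma atom0_Gm: "atom0 (Gm t) = n t"
proof -
  interpret real_distribution "\<nu> t" by (rule rd[OF t])
  interpret G: finite_measure "Gm t" by (rule finite_measure_Gm)
  have "integrable (\<nu> t) (indicator {0} :: real \<Rightarrow> real)"
    by (intro integrable_real_indicator) (auto simp: emeasure_eq_measure)
  from integral_Gm[OF this] show ?thesis
    by (simp add: atom0_def n_def sets_Gm space_Gm)
qed

lemma pairing_Gm:
  assumes "integrable (\<nu> t) (\<lambda>x. \<phi> (max 0 x))" "(\<lambda>x. \<phi> (max 0 x)) \<in> borel_measurable borel"
  shows "pairing (Gm t) \<phi> = m * (\<integral>x. \<phi> (max 0 x) \<partial>\<nu> t) - Mb * \<phi> 0"
proof -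
  have "(\<lambda>x. indicator {0..} x *\<^sub>R \<phi> x) = (\<lambda>x. indicator {0..} x *\<^sub>R \<phi> (max 0 x))"
    by (auto simp: indicator_def fun_eq_iff)
  then have "pairing (Gm t) \<phi> = (\<integral>x. indicator {0..} x *\<^sub>R \<phi> (max 0 x) \<partial>Gm t)"
    unfolding pairing_def set_lebesgue_integral_def by simp
  also have "\<dots> = (\<integral>x. \<phi> (max 0 x) \<partial>Gm t)"
  proof (rule integral_cong_AE)
    show "(\<lambda>x. indicator {0..} x *\<^sub>R \<phi> (max 0 x)) \<in> borel_measurable (Gm t)"
      by (intro measurable_Gm borel_measurable_scaleR assms(2) borel_measurable_indicator) simp
    show "(\<lambda>x. \<phi> (max 0 x)) \<in> borel_measurable (Gm t)" by (rule measurable_Gm[OF assms(2)])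
    show "AE x in Gm t. indicator {0..} x *\<^sub>R \<phi> (max 0 x) = \<phi> (max 0 x)"
      using AE_Gm by eventually_elim simp
  qed
  finally show ?thesis using integral_Gm[OF assms(1)] by simp
qed

lemma Q3_Gm:
  assumes \<phi>: "tame (\<lambda>x. \<phi> (max 0 x))"
  shows "Q3 \<phi> (Gm t) = rate m (\<lambda>x. \<phi> (max 0 x)) (\<nu> t)"
proof -
  interpret real_distribution "\<nu> t" by (rule rd[OF t])
  obtain L C where a: "adm L C (\<lambda>x. \<phi> (max 0 x))" using \<phi> unfolding tame_def by blast
  have kap_0: "kap \<phi> 0 = (\<lambda>_. 0)" by (auto simp: kap_def)
  have "integrable (\<nu> t) (psi \<phi>)"
    using integrable_growth[OF t measurable_psi[OF \<phi>] psi_le[OF a]] unfolding psi_max0 .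
  from integral_Gm[OF this] have 1: "Q3_1 \<phi> (Gm t) = m * (\<integral>x. psi \<phi> x \<partial>\<nu> t)"
    unfolding Q3_1_psi by (simp add: psi_def[of _ 0])
  have "integrable (\<nu> t) (kap \<phi> x)" for x
    using integrable_continuous_bounded[OF isCont_kap_right[OF \<phi>] kap_le[OF a]] unfolding kap_max0 .
  from integral_Gm[OF this] have inner: "(\<integral>y. kap \<phi> x y \<partial>Gm t) = m * (\<integral>y. kap \<phi> x y \<partial>\<nu> t)" for x
    by (simp add: kap_def[of _ _ 0])
  have i: "integrable (\<nu> t) (\<lambda>x. m * (\<integral>y. kap \<phi> x y \<partial>\<nu> t))"
    using kap_pair(1)[OF finite_measure_nu sets_nu[OF t] \<phi>] unfolding kap_max0 by simp
  have "Q3_2 \<phi> (Gm t) = (\<integral>x. \<integral>y. kap \<phi> x y \<partial>Gm t \<partial>Gm t)"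
    unfolding Q3_2_kap using kap_pair(2)[OF finite_measure_Gm sets_Gm \<phi>] unfolding kap_max0 .
  also have "\<dots> = m * (\<integral>x. m * (\<integral>y. kap \<phi> x y \<partial>\<nu> t) \<partial>\<nu> t)"
    unfolding inner integral_Gm[OF i] by (simp add: kap_0)
  finally have "Q3_2 \<phi> (Gm t) = m * m * (\<integral>x. \<integral>y. kap \<phi> x y \<partial>\<nu> t \<partial>\<nu> t)" by simp
  with 1 show ?thesis by (simp add: Q3_def rate_def kap_max0 psi_max0)
qed

text \<open>The truncated power lies below the power, and it vanishes at 0, so the artificial Dirac
  mass does not contribute to \<open>P\<close>. No finiteness of the moment is involved.\<close>

lemma P_le_Mom: "ennreal (P t) \<le> Mom (Gm t) \<alpha>"
proof -
  obtain L C where a: "adm L C (\<lambda>x. pw (max 0 x))" using pw_tame(2) by blast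
  have i: "integrable (\<nu> t) (\<lambda>x. pw (max 0 x))"
    by (rule tails_integrable[OF rd[OF t] tl[OF t] isCont_adm[OF a] adm_growth[OF a]])
  have "pw 0 = 0" using R by (simp add: pw_def)
  then have "ennreal (P t) = (\<integral>\<^sup>+x. ennreal (pw (max 0 x)) \<partial>Gm t)"
    using nn_integral_Gm[OF i] pw_bounds by (simp add: P_def)
  also have "\<dots> \<le> Mom (Gm t) \<alpha>"
    unfolding Mom_def
    by (rule nn_integral_mono_AE) (use AE_Gm pw_le \<alpha> in \<open>auto intro!: ennreal_leI simp: max_def\<close>)
  finally show ?thesis .
qed

end

lemma P_nonneg: "0 \<le> P t"
  unfolding P_def using m_pos pw_bounds by (intro mult_nonneg_nonneg Bochner_Integration.integral_nonneg) auto

end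

text \<open>\<open>large\<close> is the slope condition of \<open>psi_pw_ge\<close> at
  \<open>M = E / N\<close>. The condition on \<open>P 0\<close> says that the horizon
  \<open>T\<close> is too long for \<open>P\<close> to decrease at rate \<kappa> throughout and stay
  nonnegative.\<close>

locale rescaled_decay = rescaled +
  assumes large: "(\<alpha> + 1 / 2) * (E / N) powr (\<alpha> - 1 / 2) \<le> R powr (\<alpha> - 1 / 2)"
    and \<kappa>: "0 < \<kappa>" and n0: "0 < n 0" and P0: "P 0 < \<kappa> * T"
begin

lemma P_decrease:
  assumes "0 \<le> s" "s \<le> t" "t \<le> T" "\<And>x. s < x \<Longrightarrow> x < t \<Longrightarrow> 0 \<le> n x"
  shows "\<kappa> * (t - s) \<le> P s - P t"
proof -
  have "\<kappa> * (t - s) \<le> - P t - - P s"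
  proof (rule increment_ge[OF _ assms(1-3)])
    show "((\<lambda>t. - P t) has_real_derivative - rate m (\<lambda>x. pw (max 0 x)) (\<nu> x)) (at x within {0..T})"
      if "x \<in> {0..T}" for x
      unfolding P_def by (rule DERIV_minus[OF der[OF pw_tame(1) that, folded m_def]])
    show "\<kappa> \<le> - rate m (\<lambda>x. pw (max 0 x)) (\<nu> x)" if "s < x" "x < t" for x
      using rate_pw_le[OF _ assms(4)[OF that] large] that assms by auto
  qed
  then show ?thesis by simp
qed

text \<open>The end \<open>S\<close> of the rescaled time is where \<open>n\<close> or its left limit vanishes for the first time.\<close>

definition Z where "Z = {t \<in> {0..T}. \<forall>e>0. \<exists>s\<in>{0..t}. n s < e}"
definition S where "S = Inf Z"

text \<open>Otherwise \<open>n\<close> would have a positive lower bound on \<open>{0..T}\<close>,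
  and \<open>P\<close> would lose at least \<open>\<kappa> * T\<close>, more than it had.\<close>

lemma T_in_Z: "T \<in> Z"
proof (rule ccontr)
  assume "T \<notin> Z"
  then have "\<not> (\<forall>e>0. \<exists>s\<in>{0..T}. n s < e)" using T by (simp add: Z_def)
  then obtain e where "0 < e" "\<And>s. s \<in> {0..T} \<Longrightarrow> e \<le> n s" by (meson not_less)
  then have "\<kappa> * (T - 0) \<le> P 0 - P T" using T by (intro P_decrease) (auto intro: order_trans[OF less_imp_le])
  then show False using P_nonneg[of T] P0 by simp
qed

lemma bdd_Z: "bdd_below Z" by (rule bdd_belowI[of _ 0]) (auto simp: Z_def)

lemma S_le_T: "S \<le> T" unfolding S_def by (rule cInf_lower[OF T_in_Z bdd_Z])

text \<open>By \<open>n_mono\<close> the atom loses at most \<open>C0\<close> per unit time, so it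
  stays above \<open>n 0 / 2\<close> before the time \<open>n 0 / (2 * C0)\<close>.\<close>

lemma S_pos: "0 < S"
proof -
  have "n 0 / (2 * C0) \<le> S" unfolding S_def
  proof (rule cInf_greatest)
    fix t assume t: "t \<in> Z"
    show "n 0 / (2 * C0) \<le> t"
    proof (rule ccontr)
      assume "\<not> ?thesis"
      then have c: "C0 * t < n 0 / 2" using C0_pos by (simp add: not_le pos_less_divide_eq mult_ac)
      obtain s where s: "s \<in> {0..t}" "n s < n 0 / 2" using t n0 half_gt_zero unfolding Z_def by blast
      have "n 0 + C0 * 0 \<le> n s + C0 * s" using s t by (intro n_mono) (auto simp: Z_def)
      moreover have "C0 * s \<le> C0 * t" using s C0_pos by (intro mult_left_mono) auto
      ultimately show False using s c by simp
    qed
  qed (use T_in_Z in auto)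
  moreover have "0 < n 0 / (2 * C0)" using n0 C0_pos by simp
  ultimately show ?thesis by linarith
qed

lemma n_lower: "0 \<le> t \<Longrightarrow> t < S \<Longrightarrow> \<exists>e>0. \<forall>s\<in>{0..t}. e \<le> n s"
proof -
  assume t: "0 \<le> t" "t < S"
  have "t \<notin> Z" using cInf_lower[OF _ bdd_Z, of t] t by (auto simp: S_def)
  then have "\<not> (\<forall>e>0. \<exists>s\<in>{0..t}. n s < e)" using t S_le_T by (simp add: Z_def)
  then show ?thesis by (meson not_less)
qed

lemma n_pos: "0 \<le> t \<Longrightarrow> t < S \<Longrightarrow> 0 < n t"
  using n_lower[of t] by (meson atLeastAtMost_iff less_le_trans order_refl)

text \<open>An atom exceeding \<open>C0 * (S - t)\<close> by \<delta> cannot be used up by time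
  \<open>S\<close>: by \<open>n_mono\<close> it stays at least \<open>\<delta> / 2\<close> until
  \<open>S + \<delta> / (2 * C0)\<close>. With the lower bound before \<open>t\<close>, this
  contradicts a point of \<open>Z\<close> just beyond \<open>S\<close>, and such points exist
  because \<open>S\<close> is the infimum.\<close>

lemma n_upper:
  assumes t: "0 \<le> t" "t < S"
  shows "n t \<le> C0 * (S - t)"
proof (rule ccontr)
  assume "\<not> ?thesis"
  define \<delta> where "\<delta> = n t - C0 * (S - t)"
  have \<delta>: "0 < \<delta>" using \<open>\<not> n t \<le> C0 * (S - t)\<close> by (simp add: \<delta>_def)
  obtain e where e: "0 < e" "\<And>s. s \<in> {0..t} \<Longrightarrow> e \<le> n s" using n_lower[OF t] by blast
  have "Inf Z < S + \<delta> / (2 * C0)" using \<delta> C0_pos by (simp add: S_def)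
  then obtain z where z: "z \<in> Z" "z < S + \<delta> / (2 * C0)"
    using cInf_less_iff[OF _ bdd_Z] T_in_Z by blast
  have zT: "z \<le> T" using z by (simp add: Z_def)
  have "min e (\<delta> / 2) \<le> n s" if s: "s \<in> {0..z}" for s
  proof (cases "s \<le> t")
    case True
    then show ?thesis using e(2)[of s] s by auto
  next
    case False
    have "n t + C0 * t \<le> n s + C0 * s" using False s t zT by (intro n_mono) auto
    moreover have "C0 * s \<le> C0 * (S + \<delta> / (2 * C0))" using s z C0_pos by (intro mult_left_mono) auto
    moreover have "C0 * (S + \<delta> / (2 * C0)) = C0 * S + \<delta> / 2" using C0_pos by (simp add: distrib_left)
    moreover have "n t = \<delta> + (C0 * S - C0 * t)" by (simp add: \<delta>_def right_diff_distrib)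
    ultimately have "\<delta> / 2 \<le> n s" by linarith
    then show ?thesis by simp
  qed
  moreover obtain s where "s \<in> {0..z}" "n s < min e (\<delta> / 2)"
  proof -
    have "0 < min e (\<delta> / 2)" using e \<delta> by simp
    then show ?thesis using z(1) that unfolding Z_def by blast
  qed
  ultimately show False using not_le by blast
qed

lemma S_minus_le: "0 \<le> s \<Longrightarrow> s < S \<Longrightarrow> S - s \<le> P s / \<kappa>"
proof -
  assume s: "0 \<le> s" "s < S"
  have "\<kappa> * (t - s) \<le> P s" if "s < t" "t < S" for t
  proof -
    have "\<kappa> * (t - s) \<le> P s - P t"
      using s that S_le_T by (intro P_decrease) (auto intro!: less_imp_le[OF n_pos])
    then show ?thesis using P_nonneg[of t] by linarith
  qed
  then have "t \<le> s + P s / \<kappa>" if "s < t" "t < S" for t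
  proof -
    have "t - s \<le> P s / \<kappa>" using that \<open>\<And>t. s < t \<Longrightarrow> t < S \<Longrightarrow> \<kappa> * (t - s) \<le> P s\<close> \<kappa>
      by (simp add: pos_le_divide_eq mult.commute)
    then show ?thesis by simp
  qed
  then have "S \<le> s + P s / \<kappa>" by (rule dense_le_bounded[OF s(2)])
  then show ?thesis by simp
qed

end

section \<open>The solution in the original time\<close>

context rescaled_decay
begin

lemma pairing_C1b:
  assumes "C1b \<phi>" "t \<in> {0..T}" "0 < n t"
  shows "pairing (Gm t) \<phi> = m * (\<integral>x. \<phi> (max 0 x) \<partial>\<nu> t) - Mb * \<phi> 0"
proof (rule pairing_Gm[OF assms(2,3)])
  obtain L C where a: "adm L C (\<lambda>x. \<phi> (max 0 x))" using C1b_tame[OF assms(1)] unfolding tame_def by blast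
  show "integrable (\<nu> t) (\<lambda>x. \<phi> (max 0 x))"
    by (rule tails_integrable[OF rd[OF assms(2)] tl[OF assms(2)] isCont_adm[OF a] adm_growth[OF a]])
  show "(\<lambda>x. \<phi> (max 0 x)) \<in> borel_measurable borel" by (rule borel_measurable_adm[OF a])
qed

lemma exists_solution:
  "\<exists>G. weak_radial_solution \<infinity> G \<and> (\<forall>t\<ge>0. M1plus (G t)) \<and> narrow_continuous_on {0..} G \<and>
     G 0 = Gm 0 \<and> (\<forall>t\<ge>0. Mom (G t) 0 = ennreal N \<and> Mom (G t) 1 = ennreal E) \<and>
     (\<forall>t0>0. (\<integral>\<^sup>+ t\<in>{t0..}. ennreal (atom0 (G t)) \<partial>lborel) \<le> Mom (G t0) \<alpha> * ennreal (1 / \<kappa>)) \<and>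
     ((\<lambda>t. atom0 (G t)) \<longlongrightarrow> 0) at_top"
proof -
  obtain \<theta> X where \<theta>0: "\<theta> 0 = 0" and \<theta>: "\<And>t. 0 \<le> t \<Longrightarrow> 0 \<le> \<theta> t" "\<And>t. 0 \<le> t \<Longrightarrow> \<theta> t < S"
    and \<theta>mono: "\<And>s t. 0 \<le> s \<Longrightarrow> s \<le> t \<Longrightarrow> \<theta> s \<le> \<theta> t"
    and \<theta>lip: "\<And>s t. 0 \<le> s \<Longrightarrow> s \<le> t \<Longrightarrow> \<theta> t - \<theta> s \<le> N * (t - s)"
    and \<theta>lim: "(\<theta> \<longlongrightarrow> S) at_top" and X: "countable X"
    and \<theta>der: "\<And>t. 0 < t \<Longrightarrow> t \<notin> X \<Longrightarrow> (\<theta> has_real_derivative n (\<theta> t)) (at t)"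
    by (rule time_change[OF S_pos C0_pos N _ n_lower n_le n_upper]) (use S_le_T in \<open>auto intro!: n_mono\<close>)
  define G where "G t = Gm (\<theta> t)" for t
  have inT: "\<theta> t \<in> {0..T}" if "0 \<le> t" for t using \<theta>[OF that] S_le_T by auto
  have np: "0 < n (\<theta> t)" if "0 \<le> t" for t by (rule n_pos[OF \<theta>[OF that]])
  have lip: "\<bar>\<theta> s - \<theta> t\<bar> \<le> N * \<bar>s - t\<bar>" if "0 \<le> s" "0 \<le> t" for s t
    using \<theta>lip[of s t] \<theta>lip[of t s] \<theta>mono[of s t] \<theta>mono[of t s] that by (cases "s \<le> t") auto
  have \<theta>cont: "continuous_on {0..} \<theta>"
    by (rule lipschitz_on_continuous_on[of N], rule lipschitz_onI) (use lip N in \<open>auto simp: dist_real_def\<close>)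
  have M1: "M1plus (G t)" if "0 \<le> t" for t
    unfolding G_def by (rule M1plus_Gm[OF inT[OF that] np[OF that]])
  have atom: "atom0 (G t) = n (\<theta> t)" if "0 \<le> t" for t
    unfolding G_def by (rule atom0_Gm[OF inT[OF that] np[OF that]])
  define \<Phi> where "\<Phi> \<phi> \<tau> = m * (\<integral>x. \<phi> (max 0 x) \<partial>\<nu> \<tau>) - Mb * \<phi> 0" for \<phi> :: "real \<Rightarrow> real" and \<tau>
  have pair: "pairing (G t) \<phi> = \<Phi> \<phi> (\<theta> t)" if "0 \<le> t" "C1b \<phi>" for t \<phi>
    unfolding G_def \<Phi>_def by (rule pairing_C1b[OF that(2) inT[OF that(1)] np[OF that(1)]])
  have \<Phi>der: "(\<Phi> \<phi> has_real_derivative rate m (\<lambda>x. \<phi> (max 0 x)) (\<nu> \<tau>)) (at \<tau> within {0..T})"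
    if "C1b \<phi>" "\<tau> \<in> {0..T}" for \<phi> \<tau>
  proof -
    have "(\<Phi> \<phi> has_real_derivative rate m (\<lambda>x. \<phi> (max 0 x)) (\<nu> \<tau>) - 0) (at \<tau> within {0..T})"
      unfolding \<Phi>_def[abs_def]
      by (intro DERIV_diff DERIV_const der[OF C1b_tame[OF that(1)] that(2), folded m_def])
    then show ?thesis by simp
  qed
  have sol: "weak_radial_solution \<infinity> G"
    unfolding weak_radial_solution_def
  proof (intro conjI allI impI)
    show "M1plus (G t)" if "0 \<le> t \<and> ereal t < \<infinity>" for t using M1 that by simp
    show "(SUP t\<in>{t. 0 \<le> t \<and> ereal t < T'}. \<integral>\<^sup>+ x. ennreal (1 + x) \<partial>(G t)) < \<infinity>" for T'
    proof -
      have "(SUP t\<in>{t. 0 \<le> t \<and> ereal t < T'}. \<integral>\<^sup>+ x. ennreal (1 + x) \<partial>(G t)) \<le> ennreal (N + E)"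
        by (rule SUP_least) (use nn_integral_one_plus_Gm[OF inT np] in \<open>auto simp: G_def\<close>)
      also have "\<dots> < \<infinity>" by simp
      finally show ?thesis .
    qed
    fix \<phi> and T' :: real assume \<phi>: "C1b \<phi>"
    obtain B where B: "\<And>t. t \<in> {0..T} \<Longrightarrow> \<bar>rate m (\<lambda>x. \<phi> (max 0 x)) (\<nu> t)\<bar> \<le> B"
      using rate_bounded[OF C1b_tame[OF \<phi>]] by blast
    have "0 \<le> B" using B[of 0] T by auto
    show "\<exists>L. lipschitz_on L {0..T'} (\<lambda>t. pairing (G t) \<phi>)"
    proof (intro exI lipschitz_onI)
      fix s t assume st: "s \<in> {0..T'}" "t \<in> {0..T'}"
      have "norm (\<Phi> \<phi> (\<theta> s) - \<Phi> \<phi> (\<theta> t)) \<le> B * norm (\<theta> s - \<theta> t)"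
        by (rule field_differentiable_bound[of "{0..T}"]) (use \<Phi>der[OF \<phi>] B inT st in auto)
      also have "\<dots> \<le> B * (N * \<bar>s - t\<bar>)" using lip[of s t] st \<open>0 \<le> B\<close> by (intro mult_left_mono) auto
      finally show "dist (pairing (G s) \<phi>) (pairing (G t) \<phi>) \<le> (B * N) * dist s t"
        using st \<phi> by (simp add: pair dist_real_def)
    qed (use \<open>0 \<le> B\<close> N in simp)
  next
    \<comment> \<open>The exceptional set comes from the change of time alone, so it is the same for
      all test functions. Outside it the chain rule supplies the factor
      \<open>n (\<theta> t)\<close>, which is the atom in the equation.\<close>
    have "AE t in lborel. t \<notin> X" using X by (rule AE_not_in[OF countable_imp_null_set_lborel])
    then show "AE t in lborel. 0 < t \<and> ereal t < \<infinity> \<longrightarrow>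
        (\<forall>\<phi>. C1b \<phi> \<longrightarrow> ((\<lambda>s. pairing (G s) \<phi>) has_real_derivative (atom0 (G t) * Q3 \<phi> (G t))) (at t))"
    proof (eventually_elim, intro impI allI, elim conjE)
      fix t \<phi> assume t: "t \<notin> X" "0 < t" and \<phi>: "C1b \<phi>"
      have t0: "0 \<le> t" using t by simp
      have w: "at t within {0<..} = at t" using t by (intro at_within_open) auto
      have "(\<Phi> \<phi> has_real_derivative rate m (\<lambda>x. \<phi> (max 0 x)) (\<nu> (\<theta> t))) (at (\<theta> t) within \<theta> ` {0<..})"
        by (rule DERIV_subset[OF \<Phi>der[OF \<phi> inT[OF t0]]], rule image_subsetI, rule inT) simp
      moreover have "(\<theta> has_real_derivative n (\<theta> t)) (at t within {0<..})"
        using \<theta>der[OF t(2,1)] w by simp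
      ultimately have "(\<Phi> \<phi> \<circ> \<theta> has_real_derivative rate m (\<lambda>x. \<phi> (max 0 x)) (\<nu> (\<theta> t)) * n (\<theta> t)) (at t within {0<..})"
        by (rule DERIV_image_chain)
      then have "(\<Phi> \<phi> \<circ> \<theta> has_real_derivative atom0 (G t) * Q3 \<phi> (G t)) (at t within {0<..})"
        using Q3_Gm[OF inT[OF t0] np[OF t0] C1b_tame[OF \<phi>]] atom[OF t0] by (simp add: G_def mult.commute)
      then have "((\<lambda>s. pairing (G s) \<phi>) has_real_derivative atom0 (G t) * Q3 \<phi> (G t)) (at t within {0<..})"
        by (rule has_field_derivative_transform_within[OF _ t(2)]) (use t \<phi> in \<open>auto simp: pair\<close>)
      then show "((\<lambda>s. pairing (G s) \<phi>) has_real_derivative atom0 (G t) * Q3 \<phi> (G t)) (at t)" by (simp only: w)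
    qed
  qed
  have nar: "narrow_continuous_on {0..} G"
    unfolding narrow_continuous_on_def
  proof (intro allI impI)
    fix \<phi> assume \<phi>: "Cb \<phi>"
    have c: "isCont (\<lambda>x. \<phi> (max 0 x)) x" for x
      using continuous_max0[of \<phi>] \<phi> by (simp add: Cb_def continuous_on_eq_continuous_at)
    obtain B where B: "\<And>x. 0 \<le> x \<Longrightarrow> \<bar>\<phi> x\<bar> \<le> B" using \<phi> by (auto simp: Cb_def bounded_iff)
    have b: "\<bar>\<phi> (max 0 x)\<bar> \<le> B" for x by (rule B) simp
    have "pairing (G t) \<phi> = m * (\<integral>x. \<phi> (max 0 x) \<partial>\<nu> (\<theta> t)) - Mb * \<phi> 0" if t: "0 \<le> t" for t
      unfolding G_def
    proof (rule pairing_Gm[OF inT[OF t] np[OF t]])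
      interpret real_distribution "\<nu> (\<theta> t)" by (rule rd[OF inT[OF t]])
      show "integrable (\<nu> (\<theta> t)) (\<lambda>x. \<phi> (max 0 x))" by (rule integrable_continuous_bounded[OF c b])
      show "(\<lambda>x. \<phi> (max 0 x)) \<in> borel_measurable borel" by (rule isCont_borel_measurable[OF refl c])
    qed
    moreover have "continuous_on {0..} (\<lambda>t. m * (\<integral>x. \<phi> (max 0 x) \<partial>\<nu> (\<theta> t)) - Mb * \<phi> 0)"
    proof (intro continuous_on_diff continuous_on_mult continuous_on_const)
      show "continuous_on {0..} (\<lambda>t. \<integral>x. \<phi> (max 0 x) \<partial>\<nu> (\<theta> t))"
        by (rule continuous_on_compose2[OF continuous_pairing[OF c b] \<theta>cont], rule image_subsetI, rule inT) simp
    qed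
    ultimately show "continuous_on {0..} (\<lambda>t. pairing (G t) \<phi>)"
      by (subst continuous_on_cong[OF refl]) auto
  qed
  have bound: "(\<integral>\<^sup>+ t\<in>{t0..}. ennreal (atom0 (G t)) \<partial>lborel) \<le> Mom (G t0) \<alpha> * ennreal (1 / \<kappa>)" if t0: "0 < t0" for t0
  proof -
    have t0': "0 \<le> t0" using t0 by simp
    have "(\<integral>\<^sup>+ t\<in>{t0..}. ennreal (atom0 (G t)) \<partial>lborel) = (\<integral>\<^sup>+ t\<in>{t0..}. ennreal (n (\<theta> t)) \<partial>lborel)"
      by (rule nn_integral_cong) (use atom t0 in \<open>auto simp: indicator_def\<close>)
    also have "\<dots> \<le> ennreal (S - \<theta> t0)"
      by (rule nn_integral_derivative_le[OF \<theta>mono \<theta>lip _ \<theta>lim X \<theta>der t0]) (use N in auto)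
    also have "\<dots> \<le> ennreal (P (\<theta> t0) * (1 / \<kappa>))"
      using S_minus_le[OF \<theta>[OF t0']] by (intro ennreal_leI) simp
    also have "\<dots> = ennreal (P (\<theta> t0)) * ennreal (1 / \<kappa>)"
      using P_nonneg \<kappa> by (intro ennreal_mult) auto
    also have "\<dots> \<le> Mom (G t0) \<alpha> * ennreal (1 / \<kappa>)"
      unfolding G_def by (rule mult_right_mono[OF P_le_Mom[OF inT[OF t0'] np[OF t0']]]) simp
    finally show ?thesis .
  qed
  have lim0: "((\<lambda>t. atom0 (G t)) \<longlongrightarrow> 0) at_top"
  proof (rule tendsto_sandwich)
    show "\<forall>\<^sub>F t in at_top. 0 \<le> atom0 (G t)"
      by (simp add: atom0_def)
    show "\<forall>\<^sub>F t in at_top. atom0 (G t) \<le> C0 * (S - \<theta> t)"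
      using eventually_ge_at_top[of 0] by eventually_elim (use atom n_upper \<theta> in auto)
    have "((\<lambda>t. C0 * (S - \<theta> t)) \<longlongrightarrow> C0 * (S - S)) at_top" by (intro tendsto_intros \<theta>lim)
    then show "((\<lambda>t. C0 * (S - \<theta> t)) \<longlongrightarrow> 0) at_top" by simp
  qed simp
  have mom: "Mom (G t) 0 = ennreal N \<and> Mom (G t) 1 = ennreal E" if "0 \<le> t" for t
    unfolding G_def using Mom0_Gm Mom1_Gm inT[OF that] np[OF that] by blast
  have "G 0 = Gm 0" by (simp add: G_def \<theta>0)
  then show ?thesis using sol M1 nar bound lim0 mom by (intro exI[of _ G]) blast
qed

end

text \<open>Raised to the power \<open>3/2\<close>, the threshold reads
  \<open>C1alpha \<alpha> * N powr (5/2) < c * E powr (3/2)\<close>. Multiplication by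
  \<open>N powr (1/2 - \<alpha>) * E powr (\<alpha> - 1)\<close> gives the two terms of the decay
  rate.\<close>

lemma decay_rate_pos:
  assumes "0 < N" "0 < E" "1 < \<alpha>" "\<alpha> \<le> 3" "E > Calpha \<alpha> * N powr (5/3)"
  shows "C1alpha \<alpha> * N powr (3 - \<alpha>) * E powr (\<alpha> - 1)
     < (\<alpha> - 1) / (\<alpha> + 1) * E powr (\<alpha> + 1/2) * N powr (1/2 - \<alpha>)"
proof -
  define c where "c = (\<alpha> - 1) / (\<alpha> + 1)"
  have c: "0 < c" using assms by (simp add: c_def)
  have C1: "0 < C1alpha \<alpha>" by (rule C1alpha_pos[OF assms(3)])
  have Ca: "Calpha \<alpha> = (C1alpha \<alpha> / c) powr (2/3)"
    using assms(3) by (auto simp: Calpha_def C1alpha_def c_def)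
  have "(Calpha \<alpha> * N powr (5/3)) powr (3/2) < E powr (3/2)"
    using assms by (intro powr_less_mono2) (auto simp: Ca)
  moreover have "(Calpha \<alpha> * N powr (5/3)) powr (3/2) = C1alpha \<alpha> / c * N powr (5/2)"
    using C1 c assms(1) by (simp add: Ca powr_mult powr_powr)
  ultimately have "C1alpha \<alpha> * N powr (5/2) < c * E powr (3/2)"
    using c by (simp add: pos_divide_less_eq mult.commute)
  then have "C1alpha \<alpha> * N powr (5/2) * (N powr (1/2 - \<alpha>) * E powr (\<alpha> - 1))
      < c * E powr (3/2) * (N powr (1/2 - \<alpha>) * E powr (\<alpha> - 1))"
    using assms by (intro mult_strict_right_mono) auto
  moreover have e1: "N powr (3 - \<alpha>) = N powr (5/2) * N powr (1/2 - \<alpha>)" unfolding powr_add[symmetric] by simp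
  moreover have e2: "E powr (\<alpha> + 1/2) = E powr (3/2) * E powr (\<alpha> - 1)" unfolding powr_add[symmetric] by (simp add: add.commute)
  ultimately show ?thesis unfolding c_def[symmetric] e1 e2 by (simp only: mult_ac)
qed

theorem mainTheorem5:
  fixes G0 :: "real measure" and \<alpha> N E :: real
  assumes "M1plus G0"
    and "emeasure G0 {0} > 0"
    and "N = enn2real (Mom G0 0)"
    and "E = enn2real (Mom G0 1)"
    and "1 < \<alpha>" and "\<alpha> \<le> 3"
    and "E > Calpha \<alpha> * N powr (5/3)"
  shows "\<exists>G :: real \<Rightarrow> real measure.
     weak_radial_solution \<infinity> G \<and>
     (\<forall>t\<ge>0. M1plus (G t)) \<and> narrow_continuous_on {0..} G \<and>
     G 0 = G0 \<and>
     (\<forall>t\<ge>0. Mom (G t) 0 = Mom G0 0 \<and> Mom (G t) 1 = Mom G0 1) \<and>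
     (\<forall>t0>0. (\<integral>\<^sup>+ t\<in>{t0..}. ennreal (atom0 (G t)) \<partial>lborel)
               \<le> Mom (G t0) \<alpha> * ennreal (CNEa N E \<alpha>)) \<and>
     ((\<lambda>t. atom0 (G t)) \<longlongrightarrow> 0) at_top"
proof -
  have sets: "sets G0 = sets borel" and neg: "emeasure G0 {..<0} = 0" and fin: "emeasure G0 UNIV < \<infinity>"
    and mom: "Mom G0 1 < \<infinity>"
    using assms(1) by (auto simp: M1plus_def Mplus_def)
  have sp: "space G0 = UNIV" using sets_eq_imp_space_eq[OF sets] by simp
  have fm: "finite_measure G0" by (rule finite_measureI) (use fin sp in auto)
  interpret G0: finite_measure G0 by (rule fm)
  have mI: "f \<in> borel_measurable borel \<Longrightarrow> f \<in> borel_measurable G0" for f :: "real \<Rightarrow> real"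
    using measurable_cong_sets[OF sets refl] by blast
  have pos: "AE x in G0. 0 \<le> x"
  proof -
    have "{..<0} \<in> null_sets G0" using neg sets by auto
    then have "AE x in G0. x \<notin> {..<0}" by (rule AE_not_in)
    then show ?thesis by eventually_elim auto
  qed
  have mom0: "Mom G0 0 = emeasure G0 UNIV"
  proof -
    have "Mom G0 0 = (\<integral>\<^sup>+x. 1 \<partial>G0)" unfolding Mom_def by (rule nn_integral_cong) auto
    then show ?thesis by (simp add: sp)
  qed
  have mom1: "Mom G0 1 = (\<integral>\<^sup>+x. ennreal x \<partial>G0)"
    unfolding Mom_def by (rule nn_integral_cong_AE) (use pos in auto)
  have int: "integrable G0 (\<lambda>x. x)"
    by (rule integrableI_nonneg) (use pos mom mom1 in \<open>auto intro: mI\<close>)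
  have N: "N = measure G0 UNIV" using assms(3) by (simp add: mom0 measure_def)
  have E: "E = (\<integral>x. x \<partial>G0)"
    using assms(4) nn_integral_eq_integral[OF int pos] integral_nonneg_AE[OF pos] by (simp add: mom1)
  have momN: "Mom G0 0 = ennreal N" and momE: "Mom G0 1 = ennreal E"
    using assms(3,4) mom fin by (auto simp: mom0 less_top)
  define a0 where "a0 = measure G0 {0}"
  have a0: "0 < a0" using assms(2) by (simp add: a0_def G0.emeasure_eq_measure)
  have "a0 \<le> N" unfolding a0_def N using G0.bounded_measure[of "{0}"] sp by simp
  then have Npos: "0 < N" using a0 by simp
  have "0 \<le> Calpha \<alpha> * N powr (5/3)" by (simp add: Calpha_def)
  then have Epos: "0 < E" using assms(7) by linarith
  \<comment> \<open>The truncation level for which the slope condition \<open>large\<close> holds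
    with equality.\<close>
  define R where "R = ((\<alpha> + 1 / 2) * (E / N) powr (\<alpha> - 1 / 2)) powr (1 / (\<alpha> - 1 / 2))"
  have R: "0 < R" using Npos Epos assms(5) by (simp add: R_def)
  have large: "(\<alpha> + 1 / 2) * (E / N) powr (\<alpha> - 1 / 2) \<le> R powr (\<alpha> - 1 / 2)"
    using Npos Epos assms(5) by (simp add: R_def powr_powr)
  interpret TP: truncated_power \<alpha> R by unfold_locales (use assms R in auto)
  define k where "k = TP.c * E powr (\<alpha> + 1 / 2) * N powr (1 / 2 - \<alpha>) - C1alpha \<alpha> * N powr (3 - \<alpha>) * E powr (\<alpha> - 1)"
  have k: "0 < k" using decay_rate_pos[OF Npos Epos assms(5-7)] by (simp add: k_def TP.c_def)
  have kC: "CNEa N E \<alpha> = 1 / k"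
    by (simp add: CNEa_def k_def TP.c_def add_divide_distrib diff_divide_distrib)
  obtain L C where adm: "adm L C (\<lambda>x. TP.pw (max 0 x))" using TP.pw_tame(2) by blast
  define P0 where "P0 = (\<integral>x. TP.pw (max 0 x) \<partial>G0)"
  have P0: "0 \<le> P0" unfolding P0_def using TP.pw_bounds by (intro Bochner_Integration.integral_nonneg) auto
  \<comment> \<open>\<open>P0 / k\<close> bounds the rescaled time that the atom can survive, and
    the summand 1 makes the inequality strict. \<open>P0\<close> is computed from \<open>G0\<close>
    alone, so \<open>T\<close> can be fixed before \<open>Mb\<close> and \<nu>, which depend on
    it.\<close>
  define T where "T = P0 / k + 1"
  have T: "0 < T" "P0 < k * T" using k P0 by (auto simp: T_def distrib_left add_nonneg_pos)
  show ?thesis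
  proof (rule rescaled_solution[OF sets fm pos int a0_def a0 N E T(1)])
    fix Mb \<eta> \<nu>
    assume Mb: "0 < Mb"
      and rd: "\<And>t. t \<in> {0..T} \<Longrightarrow> real_distribution (\<nu> t)"
      and p\<nu>: "\<And>t. t \<in> {0..T} \<Longrightarrow> AE x in \<nu> t. 0 \<le> x"
      and tl: "\<And>t. t \<in> {0..T} \<Longrightarrow> tails \<eta> (\<nu> t)"
      and en: "\<And>t. t \<in> {0..T} \<Longrightarrow> (N + Mb) * (\<integral>x. x \<partial>\<nu> t) = E"
      and \<nu>0: "\<nu> 0 = density G0 (\<lambda>x. ennreal (if x = 0 then (a0 + Mb) / (a0 * (N + Mb)) else 1 / (N + Mb)))"
      and wc: "\<And>s t. (\<And>n. s n \<in> {0..T}) \<Longrightarrow> t \<in> {0..T} \<Longrightarrow> s \<longlonglongrightarrow> t \<Longrightarrow> weak_conv_m (\<lambda>n. \<nu> (s n)) (\<nu> t)"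
      and der: "\<And>\<phi> t. tame \<phi> \<Longrightarrow> t \<in> {0..T} \<Longrightarrow>
         ((\<lambda>t. (N + Mb) * (\<integral>x. \<phi> x \<partial>\<nu> t)) has_real_derivative rate (N + Mb) \<phi> (\<nu> t)) (at t within {0..T})"
    interpret r: rescaled \<alpha> R \<nu> N E Mb T \<eta>
      by (intro rescaled.intro rescaled_axioms.intro TP.truncated_power_axioms Npos Epos Mb T(1) rd p\<nu> tl en wc der)
    have \<kappa>: "r.\<kappa> = k" by (simp add: r.\<kappa>_def k_def)
    have mpos: "0 < N + Mb" using Npos Mb by simp
    have coef: "0 \<le> (a0 + Mb) / (a0 * (N + Mb))" "0 \<le> 1 / (N + Mb)" using a0 Mb mpos by auto
    have c0: "(a0 + Mb) / (a0 * (N + Mb)) - 1 / (N + Mb) = Mb / (a0 * (N + Mb))"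
    proof -
      have "1 / (N + Mb) = a0 / (a0 * (N + Mb))" using a0 by simp
      then show ?thesis by (simp only: diff_divide_distrib[symmetric] add_diff_cancel_left')
    qed
    have int0: "(N + Mb) * (\<integral>x. f x \<partial>\<nu> 0) = (\<integral>x. f x \<partial>G0) + Mb * f 0" if "integrable G0 f" for f :: "real \<Rightarrow> real"
    proof -
      have e: "Mb / (a0 * (N + Mb)) * a0 = Mb / (N + Mb)" using a0 by simp
      have e': "(N + Mb) * (1 / (N + Mb) * u + Mb / (N + Mb) * v) = u + Mb * v" for u v
      proof -
        have "(N + Mb) * (1 / (N + Mb) * u) = u" "(N + Mb) * (Mb / (N + Mb) * v) = Mb * v"
          using mpos by simp_all
        then show ?thesis by (simp only: distrib_left)
      qed
      have "(\<integral>x. f x \<partial>\<nu> 0) = 1 / (N + Mb) * (\<integral>x. f x \<partial>G0) + Mb / (a0 * (N + Mb)) * a0 * f 0"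
        unfolding \<nu>0 integral_density_atom(2)[OF sets fm that coef] c0 a0_def[symmetric]
        by simp
      then show ?thesis by (simp only: e e')
    qed
    have i0: "integrable G0 (indicator {0} :: real \<Rightarrow> real)"
      by (intro integrable_real_indicator) (auto simp: sets G0.emeasure_eq_measure)
    have meas0: "(N + Mb) * measure (\<nu> 0) {0} = a0 + Mb"
    proof -
      have "space (\<nu> 0) = UNIV" unfolding \<nu>0 by (simp add: sp)
      then show ?thesis using int0[OF i0] by (simp add: a0_def sp)
    qed
    have n0: "r.n 0 = a0" using meas0 by (simp add: r.n_def r.m_def)
    have P00: "r.P 0 = P0"
    proof -
      have "integrable G0 (\<lambda>x. (\<bar>TP.pw (max 0 0)\<bar> + L) * (1 + \<bar>x\<bar>))" using int by auto
      then have "integrable G0 (\<lambda>x. TP.pw (max 0 x))"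
      proof (rule Bochner_Integration.integrable_bound)
        show "AE x in G0. norm (TP.pw (max 0 x)) \<le> norm ((\<bar>TP.pw (max 0 0)\<bar> + L) * (1 + \<bar>x\<bar>))"
          using order_trans[OF adm_growth[OF adm] abs_ge_self] by (intro AE_I2) simp
      qed (intro mI borel_measurable_adm[OF adm])
      moreover have "TP.pw 0 = 0" using R by (simp add: TP.pw_def)
      ultimately show ?thesis using int0[of "\<lambda>x. TP.pw (max 0 x)"] by (simp add: r.P_def r.m_def P0_def)
    qed
    interpret d: rescaled_decay \<alpha> R \<nu> N E Mb T \<eta>
      by (intro rescaled_decay.intro rescaled_decay_axioms.intro r.rescaled_axioms large)
        (simp_all add: \<kappa> k n0 a0 P00 T(2))
    have Gm0: "r.Gm 0 = G0"
    proof -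
      have wm: "(\<lambda>x. ennreal (if x = 0 then p else q)) \<in> borel_measurable G0" for p q :: real
      proof -
        have "(\<lambda>x::real. ennreal (if x = 0 then p else q)) \<in> borel_measurable borel" by measurable
        then show ?thesis using measurable_cong_sets[OF sets refl] by blast
      qed
      have m0: "measure (\<nu> 0) {0} = (a0 + Mb) / (N + Mb)" using meas0 mpos by (simp add: eq_divide_eq mult.commute)
      \<comment> \<open>One density adds the Dirac mass and normalises, the other undoes both; their
        product is 1 at every point.\<close>
      have "r.Gm 0 = density G0 (\<lambda>x. ennreal (if x = 0 then (a0 + Mb) / (a0 * (N + Mb)) else 1 / (N + Mb))
          * ennreal (if x = 0 then a0 / measure (\<nu> 0) {0} else N + Mb))"
        unfolding r.Gm_def n0 r.m_def unfolding \<nu>0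
        by (rule density_density_eq[OF wm wm])
      also have "\<dots> = density G0 (\<lambda>_. 1)"
      proof (rule arg_cong[where f="density G0"], rule ext)
        fix x :: real
        have "(a0 + Mb) / (a0 * (N + Mb)) * (a0 / measure (\<nu> 0) {0}) = 1"
          using a0 Mb mpos by (simp add: m0)
        moreover have "1 / (N + Mb) * (N + Mb) = 1" using mpos by simp
        ultimately show "ennreal (if x = 0 then (a0 + Mb) / (a0 * (N + Mb)) else 1 / (N + Mb))
          * ennreal (if x = 0 then a0 / measure (\<nu> 0) {0} else N + Mb) = 1"
          using coef mpos a0 by (simp add: ennreal_mult[symmetric] del: times_divide_eq_left times_divide_eq_right)
      qed
      finally show ?thesis by (simp add: density_1)
    qed
    show ?thesis
      using d.exists_solution unfolding Gm0 \<kappa> kC momN momE .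
  qed
qed

end
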